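(* Let $d\ge 2$, let $n_1,\dots,n_d$ and $r_1,\dots,r_{d-1}$ be positive integers, and put $r_0=r_d=1$; assume the parameter space $\mathcal S^{\mathrm{TT}}$ (defined in the context) is nonempty. The set $$\mathcal M^{\mathrm{TT}}=\left\{(\mathcal X,\mathbf P_1,\dots,\mathbf P_{d-1}):\ \mathcal X=\llbracket\mathcal U_1,\dots,\mathcal U_d\rrbracket,\ \mathbf P_k=\mathbf I-\mathbf X_{\ge k+1}(\mathbf X_{\ge k+1}^\top\mathbf X_{\ge k+1})^{-1}\mathbf X_{\ge k+1}^\top\ (k=1,\dots,d-1),\ (\mathcal U_1,\dots,\mathcal U_d)\in\mathcal S^{\mathrm{TT}}\right\}$$ is an embedded submanifold of $$\mathcal E^{\mathrm{TT}}=\mathbb R^{n_1\times\cdots\times n_d}\times\mathrm{Sym}(n_2n_3\cdots n_d)\times\mathrm{Sym}(n_3\cdots n_d)\times\cdots\times\mathrm{Sym}(n_d)$$ with dimension $\dim(\mathcal M^{\mathrm{TT}})=\dim(\mathcal S^{\mathrm{TT}}/\!\sim)=\sum_{k=1}^d r_{k-1}n_kr_k-\sum_{k=1}^{d-1}r_k^2$.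
   Context: $\mathrm{Sym}(n)$ is the space of real symmetric $n\times n$ matrices. For core tensors $\mathcal U_k\in\mathbb R^{r_{k-1}\times n_k\times r_k}$ write $\mathbf U_k(i_k)=\mathcal U_k(:,i_k,:)\in\mathbb R^{r_{k-1}\times r_k}$, and let $\llbracket\mathcal U_1,\dots,\mathcal U_d\rrbracket$ be the tensor $\mathcal X$ with $\mathcal X(i_1,\dots,i_d)=\mathbf U_1(i_1)\mathbf U_2(i_2)\cdots\mathbf U_d(i_d)$. The right unfolding $\mathrm R(\mathcal U_k)\in\mathbb R^{r_{k-1}\times(n_kr_k)}$ is the reshaping of $\mathcal U_k$ whose rows are indexed by the first index. The parameter space is $$\mathcal S^{\mathrm{TT}}=\{(\mathcal U_1,\dots,\mathcal U_d):\mathcal U_k\in\mathbb R^{r_{k-1}\times n_k\times r_k}\ (k=1,\dots,d),\ \mathrm{rank}(\mathrm R(\mathcal U_k))=r_{k-1}\ (k=2,\dots,d)\}.$$ For $k=1,\dots,d-1$, the interface matrix $\mathbf X_{\ge k+1}\in\mathbb R^{(n_{k+1}\cdots n_d)\times r_k}$ has, in the row indexed by $(i_{k+1},\dots,i_d)$ (row number $i_{k+1}+\sum_{j=k+2}^d(i_j-1)\prod_{\ell=k+1}^{j-1}n_\ell$), the row vector $(\mathbf U_{k+1}(i_{k+1})\cdots\mathbf U_d(i_d))^\top$; it has rank $r_k$ for parameters in $\mathcal S^{\mathrm{TT}}$. $\mathbf I$ is the identity of size $n_{k+1}\cdots n_d$. The relation $\sim$ on $\mathcal S^{\mathrm{TT}}$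 is: two tuples are equivalent iff they lie in the same orbit of the action of $\mathrm{GL}(r_1)\times\cdots\times\mathrm{GL}(r_{d-1})$ replacing each slice $\mathbf U_k(i)$ by $\mathbf A_{k-1}^{-1}\mathbf U_k(i)\mathbf A_k$ (with $\mathbf A_0=\mathbf A_d=1$); $\mathcal S^{\mathrm{TT}}/\!\sim$ is the resulting quotient manifold of the open set $\mathcal S^{\mathrm{TT}}$. *)

theory Defs
  imports
    "HOL-Analysis.Analysis"
    "HOL-Analysis.Finite_Function_Topology"
    "Jordan_Normal_Form.DL_Rank"
    "Jordan_Normal_Form.Gauss_Jordan_Elimination"
begin

section \<open>Smooth maps and manifolds in linear subspaces of normed spaces\<close>

text \<open>
  The dimensions in the main statement depend on natural number parameters, so finite-dimensional
  spaces occur as linear subspaces of (possibly infinite-dimensional) types. The real vectors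
  indexed by a finite set \<open>I\<close> are the finitely supported functions with support in \<open>I\<close>.
\<close>

definition coord_space :: "'i set \<Rightarrow> ('i \<Rightarrow>\<^sub>0 real) set" where
  "coord_space I = {x. Poly_Mapping.keys x \<subseteq> I}"

abbreviation Rn :: "nat \<Rightarrow> (nat \<Rightarrow>\<^sub>0 real) set" where
  "Rn m \<equiv> coord_space {..<m}"

text \<open>Intended for finite \<open>I\<close> only.\<close>

definition tabulate :: "'i set \<Rightarrow> ('i \<Rightarrow> real) \<Rightarrow> 'i \<Rightarrow>\<^sub>0 real" where
  "tabulate I f = Abs_poly_mapping (\<lambda>x. if x \<in> I then f x else 0)"

lemma lookup_tabulate:
  assumes "finite I"
  shows "Poly_Mapping.lookup (tabulate I f) x = (if x \<in> I then f x else 0)"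
proof -
  have "finite {x. (if x \<in> I then f x else 0) \<noteq> 0}"
    by (rule finite_subset[OF _ assms]) auto
  then show ?thesis
    unfolding tabulate_def by simp
qed

text \<open>
  \<open>f\<close> is of class \<open>C\<^sup>k\<close> on a relatively open subset \<open>U\<close> of the finite-dimensional subspace \<open>E\<close>.
  The derivative within \<open>U\<close> is uniquely determined only on \<open>E\<close>, whence the restriction of the
  directions to \<open>E\<close>.
\<close>

primrec Ck_on :: "nat \<Rightarrow> 'a::real_normed_vector set \<Rightarrow> 'a set \<Rightarrow> ('a \<Rightarrow> 'b::real_normed_vector) \<Rightarrow> bool"
  where
    "Ck_on 0 E U f \<longleftrightarrow> continuous_on U f"
  | "Ck_on (Suc k) E U f \<longleftrightarrow>
      (\<exists>f'. (\<forall>x\<in>U. (f has_derivative f' x) (at x within U)) \<and>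
            (\<forall>v\<in>E. Ck_on k E U (\<lambda>x. f' x v)))"

definition smooth_on ::
    "'a::real_normed_vector set \<Rightarrow> 'a set \<Rightarrow> ('a \<Rightarrow> 'b::real_normed_vector) \<Rightarrow> bool" where
  "smooth_on E U f \<longleftrightarrow> openin (top_of_set E) U \<and> (\<forall>k. Ck_on k E U f)"

definition diffeomorphism ::
    "'a::real_normed_vector set \<Rightarrow> 'a set \<Rightarrow> 'b::real_normed_vector set \<Rightarrow> 'b set \<Rightarrow> ('a \<Rightarrow> 'b) \<Rightarrow> bool"
  where
  "diffeomorphism E U F V f \<longleftrightarrow>
     bij_betw f U V \<and> smooth_on E U f \<and> smooth_on F V (inv_into U f)"

definition submersion ::
    "'a::real_normed_vector set \<Rightarrow> 'a set \<Rightarrow> 'b::real_normed_vector set \<Rightarrow> ('a \<Rightarrow> 'b) \<Rightarrow> bool"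
  where
  "submersion E U F f \<longleftrightarrow>
     smooth_on E U f \<and> f ` U \<subseteq> F \<and>
     (\<forall>x\<in>U. \<exists>D. (f has_derivative D) (at x within U) \<and> D ` E = F)"

text \<open>Embedded submanifolds of a finite-dimensional vector space, by slice charts.\<close>

definition embedded_submanifold :: "'a::real_normed_vector set \<Rightarrow> 'a set \<Rightarrow> nat \<Rightarrow> bool" where
  "embedded_submanifold E M m \<longleftrightarrow>
     real_vector.subspace E \<and> M \<subseteq> E \<and> m \<le> real_vector.dim E \<and>
     (\<forall>x\<in>M. \<exists>U V \<phi>. x \<in> U \<and> diffeomorphism E U (Rn (real_vector.dim E)) V \<phi> \<and>
        \<phi> ` (M \<inter> U) = V \<inter> Rn m)"

definition smooth_manifold ::
    "'p topology \<Rightarrow> nat \<Rightarrow> ('p set \<times> ('p \<Rightarrow> (nat \<Rightarrow>\<^sub>0 real))) set \<Rightarrow> bool" where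
  "smooth_manifold X m \<A> \<longleftrightarrow>
     Hausdorff_space X \<and> second_countable X \<and>
     (\<Union>(W, \<phi>)\<in>\<A>. W) = topspace X \<and>
     (\<forall>(W, \<phi>)\<in>\<A>. openin X W \<and> openin (top_of_set (Rn m)) (\<phi> ` W) \<and>
        homeomorphic_map (subtopology X W) (top_of_set (\<phi> ` W)) \<phi>) \<and>
     (\<forall>(W, \<phi>)\<in>\<A>. \<forall>(W', \<psi>)\<in>\<A>. smooth_on (Rn m) (\<phi> ` (W \<inter> W')) (\<psi> \<circ> inv_into W \<phi>))"

text \<open>
  The quotient of an open subset \<open>S\<close> of the vector space \<open>E\<close> by the equivalence relation \<open>R\<close> is a
  quotient manifold of dimension \<open>m\<close>: with the quotient topology it carries a smooth structure for
  which the canonical projection is a submersion. Such a structure is unique.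
\<close>

definition quotient_manifold ::
    "'a::real_normed_vector set \<Rightarrow> 'a set \<Rightarrow> ('a \<times> 'a) set \<Rightarrow> nat \<Rightarrow> bool" where
  "quotient_manifold E S R m \<longleftrightarrow>
     real_vector.subspace E \<and> openin (top_of_set E) S \<and> equiv S R \<and>
     (\<exists>X \<A>. quotient_map (top_of_set S) X (\<lambda>x. R `` {x}) \<and>
        smooth_manifold X m \<A> \<and>
        (\<forall>(W, \<phi>)\<in>\<A>. submersion E {x \<in> S. R `` {x} \<in> W} (Rn m) (\<lambda>x. \<phi> (R `` {x}))))"


section \<open>Tensor trains\<close>

text \<open>
  Cores are numbered \<open>1, \<dots>, d\<close>, with mode sizes \<open>n k\<close> and ranks \<open>r k\<close>, where \<open>r 0 = r d = 1\<close>.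
  Indices within a mode, and row and column indices of matrices, start at \<open>0\<close>. A tuple of cores
  is a single vector \<open>U\<close> whose component \<open>(k, a, i, b)\<close> is the entry \<open>(a, i, b)\<close> of the
  \<open>k\<close>-th core.
\<close>

type_synonym cores = "(nat \<times> nat \<times> nat \<times> nat) \<Rightarrow>\<^sub>0 real"

definition core_space :: "nat \<Rightarrow> (nat \<Rightarrow> nat) \<Rightarrow> (nat \<Rightarrow> nat) \<Rightarrow> cores set" where
  "core_space d n r =
     coord_space {(k, a, i, b). k \<in> {1..d} \<and> a < r (k - 1) \<and> i < n k \<and> b < r k}"

definition slice :: "(nat \<Rightarrow> nat) \<Rightarrow> cores \<Rightarrow> nat \<Rightarrow> nat \<Rightarrow> real mat" where
  "slice r U k i = mat (r (k - 1)) (r k) (\<lambda>(a, b). Poly_Mapping.lookup U (k, a, i, b))"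

definition right_unfolding :: "(nat \<Rightarrow> nat) \<Rightarrow> (nat \<Rightarrow> nat) \<Rightarrow> cores \<Rightarrow> nat \<Rightarrow> real mat" where
  "right_unfolding n r U k =
     mat (r (k - 1)) (n k * r k) (\<lambda>(a, c). Poly_Mapping.lookup U (k, a, c mod n k, c div n k))"

definition tt_params :: "nat \<Rightarrow> (nat \<Rightarrow> nat) \<Rightarrow> (nat \<Rightarrow> nat) \<Rightarrow> cores set" where
  "tt_params d n r =
     {U \<in> core_space d n r. \<forall>k\<in>{2..d}. vec_space.rank (r (k - 1)) (right_unfolding n r U k) = r (k - 1)}"

text \<open>The product of the slices of the cores \<open>k, \<dots>, d\<close> at the multi-index \<open>i\<close>.\<close>

definition slice_prod :: "nat \<Rightarrow> (nat \<Rightarrow> nat) \<Rightarrow> cores \<Rightarrow> nat \<Rightarrow> (nat \<Rightarrow> nat) \<Rightarrow> real mat" where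
  "slice_prod d r U k i = foldr (\<lambda>j B. slice r U j (i j) * B) [k..<Suc d] (1\<^sub>m (r d))"

definition multi_indices :: "nat \<Rightarrow> (nat \<Rightarrow> nat) \<Rightarrow> nat \<Rightarrow> (nat \<Rightarrow> nat) set" where
  "multi_indices d n k = Pi\<^sub>E {k..d} (\<lambda>j. {..<n j})"

definition tt_tensor :: "nat \<Rightarrow> (nat \<Rightarrow> nat) \<Rightarrow> (nat \<Rightarrow> nat) \<Rightarrow> cores \<Rightarrow> (nat \<Rightarrow> nat) \<Rightarrow>\<^sub>0 real" where
  "tt_tensor d n r U = tabulate (multi_indices d n 1) (\<lambda>i. slice_prod d r U 1 i $$ (0, 0))"

definition tail_size :: "nat \<Rightarrow> (nat \<Rightarrow> nat) \<Rightarrow> nat \<Rightarrow> nat" where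
  "tail_size d n k = (\<Prod>j\<in>{k+1..d}. n j)"

definition row_number :: "nat \<Rightarrow> (nat \<Rightarrow> nat) \<Rightarrow> nat \<Rightarrow> (nat \<Rightarrow> nat) \<Rightarrow> nat" where
  "row_number d n k i = (\<Sum>j\<in>{k+1..d}. i j * (\<Prod>l\<in>{k+1..<j}. n l))"

lemma row_number_bij:
  "bij_betw (row_number d n k) (multi_indices d n (k+1)) {..<tail_size d n k}"
proof -
  have step: "row_number (Suc d) n k i = row_number d n k i + i (Suc d) * tail_size d n k"
    "tail_size (Suc d) n k = tail_size d n k * n (Suc d)"
    if "k \<le> d" for d i
    using that
    by (simp_all add: row_number_def tail_size_def atLeastLessThanSuc_atLeastAtMost)
  have bound: "row_number d n k i < tail_size d n k"
    if "\<forall>j\<in>{k+1..d}. i j < n j" for d i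
    using that
  proof (induction d)
    case 0
    then show ?case by (simp add: row_number_def tail_size_def)
  next
    case (Suc d)
    show ?case
    proof (cases "k \<le> d")
      case True
      then have "row_number d n k i < tail_size d n k" "Suc (i (Suc d)) \<le> n (Suc d)"
        using Suc by (auto simp: Suc_le_eq)
      then have "row_number d n k i + i (Suc d) * tail_size d n k < Suc (i (Suc d)) * tail_size d n k"
        "Suc (i (Suc d)) * tail_size d n k \<le> n (Suc d) * tail_size d n k"
        by (simp, intro mult_le_mono1)
      then show ?thesis using step[OF True] by (simp add: mult.commute)
    qed (simp add: row_number_def tail_size_def)
  qed
  have inj: "\<forall>j\<in>{k+1..d}. i j = i' j"
    if "\<forall>j\<in>{k+1..d}. i j < n j" "\<forall>j\<in>{k+1..d}. i' j < n j"
      "row_number d n k i = row_number d n k i'" for d i i'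
    using that
  proof (induction d)
    case (Suc d)
    show ?case
    proof (cases "k \<le> d")
      case True
      let ?a = "row_number d n k i" and ?a' = "row_number d n k i'" and ?t = "tail_size d n k"
      have lt: "?a < ?t" "?a' < ?t"
        using Suc.prems by (auto intro!: bound)
      have eq: "?a + i (Suc d) * ?t = ?a' + i' (Suc d) * ?t"
        using Suc.prems(3) step[OF True] by simp
      have "?a = ?a'"
        using arg_cong[OF eq, of "\<lambda>x. x mod ?t"] lt by simp
      moreover have "i (Suc d) = i' (Suc d)"
        using arg_cong[OF eq, of "\<lambda>x. x div ?t"] lt by simp
      moreover have "\<forall>j\<in>{k+1..d}. i j = i' j"
        using Suc.IH Suc.prems \<open>?a = ?a'\<close> by simp
      ultimately show ?thesis by (auto simp: le_Suc_eq)
    qed simp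
  qed simp
  have "inj_on (row_number d n k) (multi_indices d n (k+1))"
  proof (rule inj_onI)
    fix i i'
    assume A: "i \<in> multi_indices d n (k+1)" "i' \<in> multi_indices d n (k+1)"
      "row_number d n k i = row_number d n k i'"
    then have "\<forall>j\<in>{k+1..d}. i j = i' j"
      by (intro inj) (auto simp: multi_indices_def)
    with A show "i = i'"
      unfolding multi_indices_def by (intro PiE_ext) auto
  qed
  moreover have "row_number d n k ` multi_indices d n (k+1) \<subseteq> {..<tail_size d n k}"
    by (auto simp: multi_indices_def PiE_iff intro!: bound)
  moreover have "card (multi_indices d n (k+1)) = tail_size d n k"
    by (simp add: multi_indices_def tail_size_def card_PiE)
  ultimately show ?thesis
    by (simp add: bij_betw_def card_image card_subset_eq)
qed

text \<open>The interface matrix built from the cores \<open>k + 1, \<dots>, d\<close>.\<close>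

definition interface :: "nat \<Rightarrow> (nat \<Rightarrow> nat) \<Rightarrow> (nat \<Rightarrow> nat) \<Rightarrow> cores \<Rightarrow> nat \<Rightarrow> real mat" where
  "interface d n r U k =
     mat (tail_size d n k) (r k) (\<lambda>(p, b).
       slice_prod d r U (k+1) (inv_into (multi_indices d n (k+1)) (row_number d n k) p) $$ (b, 0))"

text \<open>Total version of the library's partial matrix inverse, used for invertible matrices only.\<close>

definition minv :: "real mat \<Rightarrow> real mat" where
  "minv A = the (mat_inverse A)"

definition interface_proj :: "nat \<Rightarrow> (nat \<Rightarrow> nat) \<Rightarrow> (nat \<Rightarrow> nat) \<Rightarrow> cores \<Rightarrow> nat \<Rightarrow> real mat" where
  "interface_proj d n r U k =
     (let X = interface d n r U k; N = tail_size d n k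
      in 1\<^sub>m N - X * minv (X\<^sup>T * X) * X\<^sup>T)"

text \<open>
  A tuple of square matrices of orders \<open>tail_size d n k\<close>, for \<open>k = 1, \<dots>, d - 1\<close>, is encoded as a
  single vector \<open>P\<close> whose component \<open>(k, a, b)\<close> is the entry \<open>(a, b)\<close> of the \<open>k\<close>-th matrix.
\<close>

definition proj_indices :: "nat \<Rightarrow> (nat \<Rightarrow> nat) \<Rightarrow> (nat \<times> nat \<times> nat) set" where
  "proj_indices d n = {(k, a, b). k \<in> {1..<d} \<and> a < tail_size d n k \<and> b < tail_size d n k}"

type_synonym tt_point = "((nat \<Rightarrow> nat) \<Rightarrow>\<^sub>0 real) \<times> ((nat \<times> nat \<times> nat) \<Rightarrow>\<^sub>0 real)"

definition tt_ambient :: "nat \<Rightarrow> (nat \<Rightarrow> nat) \<Rightarrow> tt_point set" where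
  "tt_ambient d n =
     {(X, P). X \<in> coord_space (multi_indices d n 1) \<and> P \<in> coord_space (proj_indices d n) \<and>
        (\<forall>k a b. Poly_Mapping.lookup P (k, a, b) = Poly_Mapping.lookup P (k, b, a))}"

definition tt_manifold :: "nat \<Rightarrow> (nat \<Rightarrow> nat) \<Rightarrow> (nat \<Rightarrow> nat) \<Rightarrow> tt_point set" where
  "tt_manifold d n r =
     {(X, P). \<exists>U\<in>tt_params d n r.
        X = tt_tensor d n r U \<and>
        P = tabulate (proj_indices d n) (\<lambda>(k, a, b). interface_proj d n r U k $$ (a, b))}"

definition tt_equiv :: "nat \<Rightarrow> (nat \<Rightarrow> nat) \<Rightarrow> (nat \<Rightarrow> nat) \<Rightarrow> (cores \<times> cores) set" where
  "tt_equiv d n r =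
     {(U, V). U \<in> tt_params d n r \<and> V \<in> tt_params d n r \<and>
        (\<exists>A. A 0 = 1\<^sub>m 1 \<and> A d = 1\<^sub>m 1 \<and>
             (\<forall>k\<in>{1..<d}. A k \<in> carrier_mat (r k) (r k) \<and> invertible_mat (A k)) \<and>
             (\<forall>k\<in>{1..d}. \<forall>i<n k. slice r V k i = minv (A (k - 1)) * slice r U k i * A k))}"

lemma finite_multi_indices: "finite (multi_indices d n k)"
  unfolding multi_indices_def by (auto intro: finite_PiE)

lemma finite_proj_indices: "finite (proj_indices d n)"
proof (rule finite_subset)
  let ?N = "\<Union>k\<in>{1..<d}. {..<tail_size d n k}"
  show "proj_indices d n \<subseteq> {1..<d} \<times> ?N \<times> ?N"
    unfolding proj_indices_def by auto
qed auto

end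

theory Submission
  imports Defs
begin

text \<open>
  Write \<open>F\<close> for the map sending a tuple of cores to the tensor together with the projectors
  \<open>P\<^sub>k\<close>, so that the set in question is the image of \<open>F\<close>. Choose, for every \<open>k\<close>, \<open>r\<^sub>k\<close>
  columns of the right unfolding of core \<open>k + 1\<close>; by nesting they select \<open>r\<^sub>k\<close> rows of the
  interface matrix \<open>X\<^sub>k\<close>. If the selected blocks \<open>A\<^sub>k\<^sup>T\<close> of all interface matrices are invertible,
  then the gauge transformation by the \<open>A\<^sub>k\<close> turns the selected columns of the cores into identity
  matrices and leaves the remaining entries free; every choice of the free entries occurs. Since
  \<open>Q = I - P\<^sub>k\<close> projects onto the column space of \<open>X\<^sub>k\<close>, the normalised interface matrix
  \<open>X\<^sub>k A\<^sub>k\<^sup>-\<^sup>T\<close> equals \<open>Q(:,S) Q(S,S)\<^sup>-\<^sup>1\<close> for the selected rows \<open>S\<close>, and the normalised cores are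
  among its entries and those of the tensor. So the free entries are rational functions of the
  point \<open>F U\<close>: they are charts both of the quotient, which \<open>F\<close> identifies with its image, and of the
  image. The selected entries of the tensor and of the \<open>P\<^sub>k\<close> serve as linear slice coordinates, and
  the resulting slice charts have explicit rational inverses.
\<close>

section \<open>Smooth maps\<close>

text \<open>Nesting the selections is what makes the charts rational. The row of
  \<open>X_(k-1)\<close> at the multi-index \<open>(i, mi J k b)\<close> is the transposed
  \<open>b\<close>-th column of \<open>U_k(i) A_k\<close>. After normalisation by
  \<open>A_(k-1)\<close> it is a column of the normalised slice, so core \<open>k\<close> for
  \<open>k \<ge> 2\<close> is read off from \<open>P_(k-1)\<close> alone. For core 1 the tensor
  entries at such multi-indices are already normalised, since \<open>A_0 = 1\<close>. An injective
  immersion need not have an embedded image. Here every chart lives on an open subset of the ambient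
  space, where \<open>det Q(S,S) \<noteq> 0\<close> for all \<open>k\<close>, and this subset meets
  the image exactly in the images of the normal forms for one selection. Apart from tensor entries,
  the slice coordinates are entries of \<open>P_k\<close> at \<open>(p, s)\<close> with
  \<open>p\<close> outside \<open>S\<close> and \<open>s\<close> in \<open>S\<close>. None of them
  enters \<open>Q(S,S)\<close>, and the relation \<open>Q(p,S) = x Q(S,S)\<close>, with
  \<open>x\<close> the normalised row, can be solved for \<open>x\<close> as well as for
  \<open>Q(p,S)\<close>. This solvability in both directions takes the place of the inverse function
  theorem.\<close>

lemma Ck_on_cong:
  assumes "\<And>x. x \<in> U \<Longrightarrow> f x = g x" "Ck_on k E U f"
  shows "Ck_on k E U g"
  using assms
proof (induction k arbitrary: f g)
  case 0
  then show ?case by (simp cong: continuous_on_cong)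
next
  case (Suc k)
  then obtain f' where f': "\<forall>x\<in>U. (f has_derivative f' x) (at x within U)"
    "\<forall>v\<in>E. Ck_on k E U (\<lambda>x. f' x v)" by auto
  have "(g has_derivative f' x) (at x within U)" if "x \<in> U" for x
    using f'(1) that Suc.prems(1) by (intro has_derivative_transform[of x U g f "f' x"]) auto
  with f'(2) show ?case by auto
qed

lemma Ck_on_Suc_imp: "Ck_on (Suc k) E U f \<Longrightarrow> Ck_on k E U f"
proof (induction k arbitrary: f)
  case 0
  then show ?case by (auto intro: has_derivative_continuous_on)
next
  case (Suc k)
  then obtain f' where "\<forall>x\<in>U. (f has_derivative f' x) (at x within U)"
    "\<forall>v\<in>E. Ck_on (Suc k) E U (\<lambda>x. f' x v)" by auto
  then show ?case using Suc.IH by (auto simp del: Ck_on.simps simp: Ck_on.simps(2)[of k])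
qed

lemma Ck_on_SucI:
  assumes "\<And>x. x \<in> U \<Longrightarrow> (f has_derivative f' x) (at x within U)"
    and "\<And>v. v \<in> E \<Longrightarrow> Ck_on k E U (\<lambda>x. f' x v)"
  shows "Ck_on (Suc k) E U f"
  using assms by auto

lemma Ck_on_const: "Ck_on k E U (\<lambda>x. c)"
  by (induction k arbitrary: c) (auto intro!: exI[of _ "\<lambda>x v. 0"])

lemma Ck_on_linear:
  assumes "bounded_linear L" shows "Ck_on k E U L"
proof (cases k)
  case 0
  then show ?thesis using assms by (simp add: linear_continuous_on)
next
  case (Suc j)
  show ?thesis unfolding Suc
    by (rule Ck_on_SucI[where f' = "\<lambda>x. L"])
      (auto intro: Ck_on_const bounded_linear_imp_has_derivative assms)
qed

lemma Ck_on_postcompose: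
  assumes L: "bounded_linear L" and "Ck_on k E U f"
  shows "Ck_on k E U (\<lambda>x. L (f x))"
  using assms(2)
proof (induction k arbitrary: f)
  case 0
  then show ?case using L by (simp add: bounded_linear.continuous_on)
next
  case (Suc k)
  then obtain f' where f': "\<forall>x\<in>U. (f has_derivative f' x) (at x within U)"
    "\<forall>v\<in>E. Ck_on k E U (\<lambda>x. f' x v)" by auto
  show ?case
    by (rule Ck_on_SucI[where f' = "\<lambda>x v. L (f' x v)"])
      (use f' Suc.IH in \<open>auto intro: bounded_linear.has_derivative[OF L]\<close>)
qed

text \<open>With a linear inner map the derivative of the composite in direction \<open>v\<close> is
  that of \<open>f\<close> at \<open>L x\<close> in the fixed direction \<open>L v\<close>, so the
  induction hypothesis applies to it.\<close>

lemma Ck_on_precompose: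
  assumes L: "bounded_linear L" and sub: "L ` E' \<subseteq> E" "L ` U' \<subseteq> U" and "Ck_on k E U f"
  shows "Ck_on k E' U' (\<lambda>x. f (L x))"
  using assms(4)
proof (induction k arbitrary: f)
  case 0
  then show ?case using sub(2) L
    by (auto intro: continuous_on_compose2 linear_continuous_on)
next
  case (Suc k)
  then obtain f' where f': "\<forall>x\<in>U. (f has_derivative f' x) (at x within U)"
    "\<forall>v\<in>E. Ck_on k E U (\<lambda>x. f' x v)" by auto
  have "((\<lambda>x. f (L x)) has_derivative (\<lambda>v. f' (L x) (L v))) (at x within U')" if "x \<in> U'" for x
  proof -
    have 1: "(L has_derivative L) (at x within U')"
      by (rule bounded_linear_imp_has_derivative[OF L])
    have 2: "(f has_derivative f' (L x)) (at (L x) within L ` U')"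
      using f'(1) sub(2) that by (auto intro: has_derivative_subset)
    show ?thesis by (rule has_derivative_in_compose[OF 1 2])
  qed
  moreover have "Ck_on k E' U' (\<lambda>x. f' (L x) (L v))" if "v \<in> E'" for v
    using f'(2) sub(1) that by (intro Suc.IH[of "\<lambda>x. f' x (L v)"]) auto
  ultimately show ?case by (rule Ck_on_SucI)
qed

lemma Ck_on_add:
  assumes "Ck_on k E U f" "Ck_on k E U g"
  shows "Ck_on k E U (\<lambda>x. f x + g x)"
  using assms
proof (induction k arbitrary: f g)
  case 0
  then show ?case by (simp add: continuous_on_add)
next
  case (Suc k)
  then obtain f' g' where f': "\<forall>x\<in>U. (f has_derivative f' x) (at x within U)"
    "\<forall>v\<in>E. Ck_on k E U (\<lambda>x. f' x v)" and g': "\<forall>x\<in>U. (g has_derivative g' x) (at x within U)"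
    "\<forall>v\<in>E. Ck_on k E U (\<lambda>x. g' x v)" by auto
  show ?case
    by (rule Ck_on_SucI[where f' = "\<lambda>x v. f' x v + g' x v"])
      (use f' g' Suc.IH in \<open>auto intro: has_derivative_add\<close>)
qed

lemma Ck_on_mult:
  fixes f g :: "'a::real_normed_vector \<Rightarrow> real"
  assumes "Ck_on k E U f" "Ck_on k E U g"
  shows "Ck_on k E U (\<lambda>x. f x * g x)"
  using assms
proof (induction k arbitrary: f g)
  case 0
  then show ?case by (simp add: continuous_on_mult)
next
  case (Suc k)
  then obtain f' g' where f': "\<forall>x\<in>U. (f has_derivative f' x) (at x within U)"
    "\<forall>v\<in>E. Ck_on k E U (\<lambda>x. f' x v)" and g': "\<forall>x\<in>U. (g has_derivative g' x) (at x within U)"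
    "\<forall>v\<in>E. Ck_on k E U (\<lambda>x. g' x v)" by auto
  have *: "Ck_on k E U f" "Ck_on k E U g" using Suc.prems Ck_on_Suc_imp by blast+
  show ?case
    by (rule Ck_on_SucI[where f' = "\<lambda>x v. f x * g' x v + f' x v * g x"])
      (use f' g' * Suc.IH in \<open>auto intro!: has_derivative_mult Ck_on_add\<close>)
qed

text \<open>The derivative of \<open>1 / f\<close> is, up to sign, the derivative of
  \<open>f\<close> times two copies of \<open>1 / f\<close>, so order \<open>k\<close> for
  \<open>1 / f\<close> itself feeds the step to order \<open>k + 1\<close>.\<close>

lemma Ck_on_inverse:
  fixes f :: "'a::real_normed_vector \<Rightarrow> real"
  assumes "Ck_on k E U f" "\<And>x. x \<in> U \<Longrightarrow> f x \<noteq> 0"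
  shows "Ck_on k E U (\<lambda>x. inverse (f x))"
  using assms
proof (induction k arbitrary: f)
  case 0
  then show ?case by (simp add: continuous_on_inverse)
next
  case (Suc k)
  then obtain f' where f': "\<forall>x\<in>U. (f has_derivative f' x) (at x within U)"
    "\<forall>v\<in>E. Ck_on k E U (\<lambda>x. f' x v)" by auto
  have *: "Ck_on k E U (\<lambda>x. inverse (f x))" using Suc Ck_on_Suc_imp by blast
  show ?case
  proof (rule Ck_on_SucI[where f' = "\<lambda>x v. - (inverse (f x) * f' x v * inverse (f x))"])
    fix v assume "v \<in> E"
    then have "Ck_on k E U (\<lambda>x. inverse (f x) * f' x v * inverse (f x))"
      using * f'(2) by (intro Ck_on_mult) auto
    then show "Ck_on k E U (\<lambda>x. - (inverse (f x) * f' x v * inverse (f x)))"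
      by (rule Ck_on_postcompose[OF bounded_linear_minus[OF bounded_linear_ident]])
  qed (use f' Suc.prems in \<open>auto intro: has_derivative_inverse\<close>)
qed

text \<open>The analytic half of \<open>smooth_on\<close>. Openness of the domain is proved
  separately, so the closure rules need not carry it.\<close>

definition Cinf_on :: "'a::real_normed_vector set \<Rightarrow> 'a set \<Rightarrow> ('a \<Rightarrow> 'b::real_normed_vector) \<Rightarrow> bool"
  where "Cinf_on E U f \<longleftrightarrow> (\<forall>k. Ck_on k E U f)"

lemma smooth_on_iff: "smooth_on E U f \<longleftrightarrow> openin (top_of_set E) U \<and> Cinf_on E U f"
  by (simp add: smooth_on_def Cinf_on_def)

lemma Cinf_on_cong:
  assumes "\<And>x. x \<in> U \<Longrightarrow> f x = g x" "Cinf_on E U f"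
  shows "Cinf_on E U g"
  using assms Ck_on_cong[of U f g] unfolding Cinf_on_def by simp

lemma Cinf_on_continuous: "Cinf_on E U f \<Longrightarrow> continuous_on U f"
  unfolding Cinf_on_def by (auto dest: spec[of _ 0])

lemma Cinf_on_differentiable:
  assumes "Cinf_on E U f" "x \<in> U" obtains D where "(f has_derivative D) (at x within U)"
proof -
  have "Ck_on (Suc 0) E U f" using assms(1) unfolding Cinf_on_def by blast
  then show thesis using assms(2) that by auto
qed

lemma Cinf_on_const: "Cinf_on E U (\<lambda>x. c)"
  by (simp add: Cinf_on_def Ck_on_const)

lemma Cinf_on_linear: "bounded_linear L \<Longrightarrow> Cinf_on E U L"
  by (simp add: Cinf_on_def Ck_on_linear)

lemma Cinf_on_postcompose: "bounded_linear L \<Longrightarrow> Cinf_on E U f \<Longrightarrow> Cinf_on E U (\<lambda>x. L (f x))"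
  by (simp add: Cinf_on_def Ck_on_postcompose)

lemma Cinf_on_precompose:
  assumes "bounded_linear L" "L ` E' \<subseteq> E" "L ` U' \<subseteq> U" "Cinf_on E U f"
  shows "Cinf_on E' U' (\<lambda>x. f (L x))"
  using assms(4) Ck_on_precompose[OF assms(1-3), of _ f] unfolding Cinf_on_def by (metis (no_types))

lemma Cinf_on_subset: "Cinf_on E U f \<Longrightarrow> V \<subseteq> U \<Longrightarrow> Cinf_on E V f"
  using Cinf_on_precompose[OF bounded_linear_ident, of E E V U f] by auto

lemma Cinf_on_add: "Cinf_on E U f \<Longrightarrow> Cinf_on E U g \<Longrightarrow> Cinf_on E U (\<lambda>x. f x + g x)"
  by (simp add: Cinf_on_def Ck_on_add)

lemma Cinf_on_minus: "Cinf_on E U f \<Longrightarrow> Cinf_on E U (\<lambda>x. - f x)"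
  by (rule Cinf_on_postcompose[OF bounded_linear_minus[OF bounded_linear_ident]])

lemma Cinf_on_diff: "Cinf_on E U f \<Longrightarrow> Cinf_on E U g \<Longrightarrow> Cinf_on E U (\<lambda>x. f x - g x)"
  using Cinf_on_add[OF _ Cinf_on_minus, of E U f g] by simp

lemma Cinf_on_mult:
  fixes f g :: "'a::real_normed_vector \<Rightarrow> real"
  shows "Cinf_on E U f \<Longrightarrow> Cinf_on E U g \<Longrightarrow> Cinf_on E U (\<lambda>x. f x * g x)"
  by (simp add: Cinf_on_def Ck_on_mult)

lemma Cinf_on_divide:
  fixes f g :: "'a::real_normed_vector \<Rightarrow> real"
  assumes "Cinf_on E U f" "Cinf_on E U g" "\<And>x. x \<in> U \<Longrightarrow> g x \<noteq> 0"
  shows "Cinf_on E U (\<lambda>x. f x / g x)"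
  using assms by (auto simp: Cinf_on_def divide_inverse intro!: Ck_on_mult Ck_on_inverse)

lemma Cinf_on_sum: "(\<And>i. i \<in> I \<Longrightarrow> Cinf_on E U (f i)) \<Longrightarrow> Cinf_on E U (\<lambda>x. \<Sum>i\<in>I. f i x)"
  by (induction I rule: infinite_finite_induct) (auto intro: Cinf_on_const Cinf_on_add)

lemma Cinf_on_prod:
  fixes f :: "'i \<Rightarrow> 'a::real_normed_vector \<Rightarrow> real"
  shows "(\<And>i. i \<in> I \<Longrightarrow> Cinf_on E U (f i)) \<Longrightarrow> Cinf_on E U (\<lambda>x. \<Prod>i\<in>I. f i x)"
  by (induction I rule: infinite_finite_induct) (auto intro: Cinf_on_const Cinf_on_mult)

lemma Cinf_on_scaleR_const:
  "Cinf_on E U f \<Longrightarrow> Cinf_on E U (\<lambda>x. f x *\<^sub>R v)"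
  by (rule Cinf_on_postcompose[OF bounded_linear_scaleR_left])

section \<open>Determinants and inverse matrices as smooth functions of the entries\<close>

lemma Cinf_on_det:
  fixes A :: "'a::real_normed_vector \<Rightarrow> real mat"
  assumes "\<And>x. x \<in> U \<Longrightarrow> A x \<in> carrier_mat m m"
    and "\<And>i j. i < m \<Longrightarrow> j < m \<Longrightarrow> Cinf_on E U (\<lambda>x. A x $$ (i, j))"
  shows "Cinf_on E U (\<lambda>x. det (A x))"
proof (rule Cinf_on_cong)
  show "Cinf_on E U (\<lambda>x. \<Sum>p | p permutes {0..<m}. signof p * (\<Prod>i = 0..<m. A x $$ (i, p i)))"
    by (intro Cinf_on_sum Cinf_on_mult Cinf_on_prod Cinf_on_const assms(2))
      (auto dest: permutes_in_image)
qed (simp add: det_def'[OF assms(1)])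

lemma minv_mat:
  fixes A :: "real mat"
  assumes A: "A \<in> carrier_mat m m" and d: "det A \<noteq> 0"
  shows "minv A \<in> carrier_mat m m" "A * minv A = 1\<^sub>m m" "minv A * A = 1\<^sub>m m"
proof -
  obtain B where "mat_inverse A = Some B"
    using mat_inverse(1)[OF A, of "()"] det_non_zero_imp_unit[OF A d, of "()"]
    by (cases "mat_inverse A") auto
  with mat_inverse(2)[OF A this] show "minv A \<in> carrier_mat m m" "A * minv A = 1\<^sub>m m" "minv A * A = 1\<^sub>m m"
    by (auto simp: minv_def)
qed

text \<open>A right inverse suffices: multiplicativity of the determinant makes \<open>A\<close>
  invertible, and associativity identifies the two inverses.\<close>

lemma minv_eqI:
  fixes A :: "real mat"
  assumes A: "A \<in> carrier_mat m m" and B: "B \<in> carrier_mat m m" and AB: "A * B = 1\<^sub>m m"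
  shows "minv A = B"
proof -
  have "det A * det B = 1"
    using det_mult[OF A B] AB by simp
  then have d: "det A \<noteq> 0" by auto
  have "minv A * (A * B) = B"
    using assoc_mult_mat[OF minv_mat(1)[OF A d] A B] minv_mat(3)[OF A d] B by simp
  then show ?thesis using AB minv_mat(1)[OF A d] by simp
qed

text \<open>Cramer's rule, which turns inversion into a quotient of polynomials in the
  entries.\<close>

lemma minv_index:
  fixes A :: "real mat"
  assumes A: "A \<in> carrier_mat m m" and d: "det A \<noteq> 0" and ij: "i < m" "j < m"
  shows "minv A $$ (i, j) = (-1) ^ (j + i) * det (mat_delete A j i) / det A"
proof -
  have "minv A = (1 / det A) \<cdot>\<^sub>m adj_mat A"
    by (rule minv_eqI[OF A]) (use adj_mat[OF A] d A in \<open>auto simp: mult_smult_distrib[OF A]\<close>)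
  then show ?thesis using ij A by (simp add: adj_mat_def cofactor_def)
qed

lemma Cinf_on_minv:
  fixes A :: "'a::real_normed_vector \<Rightarrow> real mat"
  assumes A: "\<And>x. x \<in> U \<Longrightarrow> A x \<in> carrier_mat m m"
    and d: "\<And>x. x \<in> U \<Longrightarrow> det (A x) \<noteq> 0"
    and sm: "\<And>i j. i < m \<Longrightarrow> j < m \<Longrightarrow> Cinf_on E U (\<lambda>x. A x $$ (i, j))"
    and ij: "i < m" "j < m"
  shows "Cinf_on E U (\<lambda>x. minv (A x) $$ (i, j))"
proof (rule Cinf_on_cong)
  have "Cinf_on E U (\<lambda>x. mat_delete (A x) j i $$ (a, b))" if "a < m - 1" "b < m - 1" for a b
  proof (rule Cinf_on_cong)
    show "Cinf_on E U (\<lambda>x. A x $$ (if a < j then a else Suc a, if b < i then b else Suc b))"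
      using that by (intro sm) auto
  qed (use A that ij in \<open>auto simp: mat_delete_def dest!: A\<close>)
  then show "Cinf_on E U (\<lambda>x. (-1) ^ (j + i) * det (mat_delete (A x) j i) / det (A x))"
    by (intro Cinf_on_divide Cinf_on_mult Cinf_on_const Cinf_on_det[where m = "m - 1"] Cinf_on_det[OF A sm])
      (use A d in \<open>auto dest!: A simp: mat_delete_carrier\<close>)
qed (use minv_index[OF A d ij] in simp)

text \<open>Since \<open>K\<close> is finite, the simultaneous conditions amount to the nonvanishing
  of one continuous function, the product.\<close>

lemma openin_nonzero:
  fixes f :: "'i \<Rightarrow> 'a::real_normed_vector \<Rightarrow> real"
  assumes "finite K" "\<And>k. k \<in> K \<Longrightarrow> Cinf_on E E (f k)"
  shows "openin (top_of_set E) {y \<in> E. \<forall>k\<in>K. f k y \<noteq> 0}"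
proof -
  have "continuous_on E (\<lambda>y. \<Prod>k\<in>K. f k y)"
    by (rule Cinf_on_continuous[OF Cinf_on_prod[OF assms(2)]])
  then have "openin (top_of_set E) (E \<inter> (\<lambda>y. \<Prod>k\<in>K. f k y) -` (- {0}))"
    by (rule continuous_openin_preimage_gen) auto
  moreover have "E \<inter> (\<lambda>y. \<Prod>k\<in>K. f k y) -` (- {0}) = {y \<in> E. \<forall>k\<in>K. f k y \<noteq> 0}"
    using assms(1) by auto
  ultimately show ?thesis by simp
qed

section \<open>Coordinates\<close>

abbreviation "lookup \<equiv> Poly_Mapping.lookup"

lemma lookup_scaleR: "lookup (c *\<^sub>R x) i = c *\<^sub>R lookup x i"
proof -
  have "finite {i. c *\<^sub>R lookup x i \<noteq> 0}"
    by (rule finite_subset[OF _ finite_keys[of x]]) (auto simp: in_keys_iff)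
  then show ?thesis unfolding scaleR_poly_mapping_def by simp
qed

lemma lookup_sum: "lookup (sum f I) i = (\<Sum>j\<in>I. lookup (f j) i)"
  by (induction I rule: infinite_finite_induct) (auto simp: lookup_add)

lemma bounded_linear_lookup:
  "bounded_linear (\<lambda>x :: 'i \<Rightarrow>\<^sub>0 'b::real_normed_vector. lookup x i)"
proof (rule bounded_linear_intro[where K = 1])
  fix x :: "'i \<Rightarrow>\<^sub>0 'b"
  \<comment> \<open>The norm is the sum of the norms of the coefficients, so it dominates each of
    them and the constant 1 works.\<close>
  have "norm (lookup x i) \<le> (\<Sum>n \<in> Poly_Mapping.keys x. norm (lookup x n))"
  proof (cases "i \<in> Poly_Mapping.keys x")
    case True
    then show ?thesis by (intro member_le_sum) auto
  qed (auto simp: in_keys_iff intro: sum_nonneg)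
  then show "norm (lookup x i) \<le> norm x * 1"
    by (simp add: norm_poly_mapping_def dist_poly_mapping_def)
qed (auto simp: lookup_add lookup_scaleR)

lemma coord_space_iff: "x \<in> coord_space I \<longleftrightarrow> (\<forall>i. i \<notin> I \<longrightarrow> lookup x i = 0)"
  by (auto simp: coord_space_def in_keys_iff)

lemma subspace_coord_space: "real_vector.subspace (coord_space I)"
  by (auto simp: real_vector.subspace_def coord_space_iff lookup_add lookup_scaleR)

lemma coord_space_mono: "I \<subseteq> J \<Longrightarrow> coord_space I \<subseteq> coord_space J"
  by (auto simp: coord_space_def)

lemma coord_space_expand:
  assumes "finite I" "x \<in> coord_space I"
  shows "x = (\<Sum>i\<in>I. lookup x i *\<^sub>R Poly_Mapping.single i 1)"
proof (rule poly_mapping_eqI)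
  fix j
  show "lookup x j = lookup (\<Sum>i\<in>I. lookup x i *\<^sub>R Poly_Mapping.single i 1) j"
    using assms by (auto simp: lookup_sum lookup_scaleR lookup_single when_def coord_space_iff if_distrib sum.delta'
        cong: if_cong)
qed

lemma tabulate_in: "finite I \<Longrightarrow> tabulate I f \<in> coord_space I"
  by (simp add: coord_space_iff lookup_tabulate)

lemma tabulate_lookup: "finite I \<Longrightarrow> x \<in> coord_space I \<Longrightarrow> tabulate I (lookup x) = x"
  by (intro poly_mapping_eqI) (auto simp: lookup_tabulate coord_space_iff)

lemma tabulate_cong: "finite I \<Longrightarrow> (\<And>i. i \<in> I \<Longrightarrow> f i = g i) \<Longrightarrow> tabulate I f = tabulate I g"
  by (intro poly_mapping_eqI) (auto simp: lookup_tabulate)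

lemma Cinf_on_lookup: "Cinf_on E U f \<Longrightarrow> Cinf_on E U (\<lambda>x. lookup (f x) i)"
  by (rule Cinf_on_postcompose[OF bounded_linear_lookup])

lemma Cinf_on_tabulate:
  assumes "finite I" "\<And>i. i \<in> I \<Longrightarrow> Cinf_on E U (\<lambda>x. f x i)"
  shows "Cinf_on E U (\<lambda>x. tabulate I (f x))"
proof (rule Cinf_on_cong)
  show "Cinf_on E U (\<lambda>x. \<Sum>i\<in>I. f x i *\<^sub>R Poly_Mapping.single i (1::real))"
    by (intro Cinf_on_sum Cinf_on_scaleR_const assms(2))
  show "(\<Sum>i\<in>I. f x i *\<^sub>R Poly_Mapping.single i (1::real)) = tabulate I (f x)" for x
    using coord_space_expand[OF assms(1) tabulate_in[OF assms(1), of "f x"]]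
    by (simp add: lookup_tabulate[OF assms(1)])
qed

lemma Cinf_on_Pair:
  assumes "Cinf_on E U f" "Cinf_on E U g"
  shows "Cinf_on E U (\<lambda>x. (f x, g x))"
proof -
  have "Cinf_on E U (\<lambda>x. (f x, 0) + (0, g x))"
    using assms by (intro Cinf_on_add Cinf_on_postcompose[where L = "\<lambda>x. (x, 0)"]
        Cinf_on_postcompose[where L = "\<lambda>x. (0, x)"] bounded_linear_Pair bounded_linear_zero bounded_linear_ident)
  then show ?thesis by simp
qed

lemma sum_Pair: "(\<Sum>i\<in>I. (f i, g i)) = (\<Sum>i\<in>I. f i, \<Sum>i\<in>I. g i)"
  by (induction I rule: infinite_finite_induct) (auto simp: zero_prod_def)

text \<open>A finite tight frame: the vectors \<open>e i\<close> need not be linearly independent.\<close>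

definition frame ::
    "'a::real_normed_vector set \<Rightarrow> 'i set \<Rightarrow> ('i \<Rightarrow> 'a \<Rightarrow> real) \<Rightarrow> ('i \<Rightarrow> 'a) \<Rightarrow> bool" where
  "frame E I c e \<longleftrightarrow> finite I \<and> (\<forall>i\<in>I. bounded_linear (c i)) \<and> (\<forall>i\<in>I. e i \<in> E) \<and>
     (\<forall>y\<in>E. y = (\<Sum>i\<in>I. c i y *\<^sub>R e i))"

section \<open>Topology and linear coordinates of a space with a finite frame\<close>

lemma second_countable_euclidean:
  "second_countable (euclidean :: 'a::second_countable_topology topology)"
proof -
  obtain B :: "'a set set" where B: "countable B" "topological_basis B"
    using ex_countable_basis by blast
  have "\<exists>V\<in>B. x \<in> V \<and> V \<subseteq> U" if "open U" "x \<in> U" for U x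
    using topological_basisE[OF B(2) that] by metis
  then show ?thesis
    using B(1) topological_basis_open[OF B(2)] unfolding second_countable_def
    by (intro exI[of _ B]) simp
qed

lemma bounded_linear_sum_scaleR:
  "(\<And>i. i \<in> I \<Longrightarrow> bounded_linear (c i)) \<Longrightarrow> bounded_linear (\<lambda>y. \<Sum>i\<in>I. c i y *\<^sub>R e i)"
  by (intro bounded_linear_sum bounded_linear_compose[OF bounded_linear_scaleR_left])

text \<open>The frame coefficients map \<open>E\<close> homeomorphically onto a subset of the
  product space of real sequences, because reconstruction from the coefficients is continuous as
  well. No countability is assumed of the surrounding type.\<close>

lemma second_countable_frame:
  fixes E :: "'a::real_normed_vector set"
  assumes "frame E I c e" shows "second_countable (top_of_set E)"
proof -
  have I: "finite I" "\<And>i. i \<in> I \<Longrightarrow> bounded_linear (c i)"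
    "\<And>y. y \<in> E \<Longrightarrow> y = (\<Sum>i\<in>I. c i y *\<^sub>R e i)"
    using assms by (auto simp: frame_def)
  obtain h where h: "bij_betw h {..<card I} I"
    using ex_bij_betw_nat_finite[OF I(1)] by (auto simp: atLeast0LessThan)
  define f where "f = (\<lambda>y j. if j < card I then c (h j) y else 0)"
  define g :: "(nat \<Rightarrow> real) \<Rightarrow> 'a" where "g = (\<lambda>w. \<Sum>j<card I. w j *\<^sub>R e (h j))"
  have hI: "h j \<in> I" if "j < card I" for j
    using h that by (auto dest: bij_betwE)
  have gf: "g (f y) = y" if "y \<in> E" for y
    using sum.reindex_bij_betw[OF h, of "\<lambda>i. c i y *\<^sub>R e i"]
    by (simp add: f_def g_def I(3)[OF that, symmetric])
  have cf: "continuous_on E f"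
  proof (intro continuous_on_coordinatewise_then_product)
    fix j show "continuous_on E (\<lambda>y. f y j)"
      by (cases "j < card I") (auto simp: f_def intro!: linear_continuous_on I hI)
  qed
  have cg: "continuous_on S g" for S
    unfolding g_def
    by (intro continuous_intros continuous_on_subset[OF continuous_on_product_coordinates]) auto
  have "homeomorphic_maps (top_of_set E) (top_of_set (f ` E)) f g"
    unfolding homeomorphic_maps_def using cf cg gf by auto
  then have "top_of_set E homeomorphic_space top_of_set (f ` E)"
    unfolding homeomorphic_space_def by blast
  from homeomorphic_space_second_countability[OF this] show ?thesis
    by (simp add: second_countable_subtopology[OF second_countable_euclidean])
qed

text \<open>The vectors \<open>u t\<close> are extended to a basis of \<open>E\<close>, numbered so
  that they come first; coordinates in this basis straighten the slice to the first
  \<open>card T\<close> axes.\<close>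

lemma slice_isomorphism:
  fixes E :: "'a::real_normed_vector set" and u :: "'t \<Rightarrow> 'a"
  assumes fr: "frame E I c e" and E: "real_vector.subspace E"
    and T: "finite T" and u: "u ` T \<subseteq> E" "independent (u ` T)" "inj_on u T"
  obtains L L' where "bounded_linear L" "bounded_linear L'"
    "L ` E \<subseteq> Rn (dim E)" "L' ` Rn (dim E) \<subseteq> E"
    "\<And>y. y \<in> E \<Longrightarrow> L' (L y) = y" "\<And>z. z \<in> Rn (dim E) \<Longrightarrow> L (L' z) = z"
    "L ` span (u ` T) = Rn (card T)" "card T \<le> dim E"
proof -
  let ?N = "dim E" and ?m = "card T"
  have I: "finite I" "\<And>i. i \<in> I \<Longrightarrow> bounded_linear (c i)" "\<And>i. i \<in> I \<Longrightarrow> e i \<in> E"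
    "\<And>y. y \<in> E \<Longrightarrow> y = (\<Sum>i\<in>I. c i y *\<^sub>R e i)"
    using fr by (auto simp: frame_def)
  obtain B where B: "u ` T \<subseteq> B" "B \<subseteq> E" "independent B" "E \<subseteq> span B"
    using real_vector.maximal_independent_subset_extend[OF u(1,2)] by blast
  have spanB: "span B = E"
    using B E by (metis real_vector.span_minimal subset_antisym)
  have "E \<subseteq> span (e ` I)"
  proof
    fix y assume "y \<in> E"
    have "(\<Sum>i\<in>I. c i y *\<^sub>R e i) \<in> span (e ` I)"
      by (intro real_vector.span_sum real_vector.span_scale real_vector.span_base) auto
    then show "y \<in> span (e ` I)" by (simp add: I(4)[OF \<open>y \<in> E\<close>, symmetric])
  qed
  then have fB: "finite B"
    using real_vector.independent_span_bound[of "e ` I" B] I(1) B by auto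
  have cB: "card B = ?N" using B by (intro real_vector.basis_card_eq_dim) auto
  have cT: "card (u ` T) = ?m" by (rule card_image[OF u(3)])
  have mN: "?m \<le> ?N" using card_mono[OF fB B(1)] cB cT by simp
  obtain f where f: "bij_betw f {..<?m} (u ` T)"
    using ex_bij_betw_nat_finite[of "u ` T"] T cT by (auto simp: atLeast0LessThan)
  have "card {?m..<?N} = card (B - u ` T)"
    using card_Diff_subset[OF _ B(1)] T cB cT by simp
  then obtain g where g: "bij_betw g {?m..<?N} (B - u ` T)"
    using bij_betw_iff_card[of "{?m..<?N}" "B - u ` T"] fB by auto
  define h where "h = (\<lambda>j. if j \<in> {..<?m} then f j else g j)"
  have h1: "bij_betw h {..<?m} (u ` T)"
    using f by (rule bij_betw_cong[THEN iffD1, rotated]) (simp add: h_def)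
  have h2: "bij_betw h {?m..<?N} (B - u ` T)"
    using g by (rule bij_betw_cong[THEN iffD1, rotated]) (simp add: h_def)
  have h: "bij_betw h {..<?N} B"
    using bij_betw_combine[OF h1 h2] mN B(1) by (simp add: ivl_disj_un Un_absorb1)
  have hB: "h j \<in> B" if "j < ?N" for j using h that by (auto dest: bij_betwE)
  define L' :: "(nat \<Rightarrow>\<^sub>0 real) \<Rightarrow> 'a" where "L' = (\<lambda>z. \<Sum>j<?N. lookup z j *\<^sub>R h j)"
  define R where "R = (\<lambda>y. tabulate {..<?N} (\<lambda>j. real_vector.representation B y (h j)))"
  \<comment> \<open>\<open>R\<close> is linear only on \<open>E\<close>, because
    \<open>representation\<close> is zero off the span of the basis. Applying it to the frame
    vectors alone gives a bounded linear map on the whole type that agrees with \<open>R\<close> on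
    \<open>E\<close>.\<close>
  define L where "L = (\<lambda>y. \<Sum>i\<in>I. c i y *\<^sub>R R (e i))"
  have blL: "bounded_linear L" "bounded_linear L'"
    unfolding L_def L'_def by (intro bounded_linear_sum_scaleR I(2) bounded_linear_lookup; simp)+
  have LR: "L y = R y" if "y \<in> E" for y
  proof (rule poly_mapping_eqI)
    fix j
    have "real_vector.representation B (\<Sum>i\<in>I. c i y *\<^sub>R e i) b =
        (\<Sum>i\<in>I. c i y * real_vector.representation B (e i) b)" for b
      by (simp add: real_vector.representation_sum[OF B(3)] real_vector.representation_scale[OF B(3)]
          spanB I(3) E real_vector.subspace_scale)
    then have "real_vector.representation B y b = (\<Sum>i\<in>I. c i y * real_vector.representation B (e i) b)" for b
      by (simp add: I(4)[OF that, symmetric])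
    then show "lookup (L y) j = lookup (R y) j"
      by (simp add: L_def R_def lookup_sum lookup_scaleR lookup_tabulate)
  qed
  have L'L: "L' (L y) = y" if "y \<in> E" for y
  proof -
    have "L' (R y) = (\<Sum>j<?N. real_vector.representation B y (h j) *\<^sub>R h j)"
      by (simp add: L'_def R_def lookup_tabulate)
    also have "\<dots> = (\<Sum>b\<in>B. real_vector.representation B y b *\<^sub>R b)"
      by (rule sum.reindex_bij_betw[OF h])
    also have "\<dots> = y"
      using that spanB fB by (intro real_vector.sum_representation_eq[OF B(3)]) auto
    finally show ?thesis using LR[OF that] by simp
  qed
  have L'E: "L' z \<in> E" for z
    unfolding L'_def using hB B(2) E
    by (intro real_vector.subspace_sum real_vector.subspace_scale) auto
  have LL': "L (L' z) = z" if z: "z \<in> Rn ?N" for z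
  proof -
    have "real_vector.representation B (L' z) (h j) = lookup z j" if j: "j < ?N" for j
    proof -
      have "real_vector.representation B (L' z) (h j) =
          (\<Sum>i<?N. lookup z i * (if h j = h i then 1 else 0))"
      proof -
        have hE: "h i \<in> E" if "i < ?N" for i using hB[OF that] B(2) by auto
        have "real_vector.representation B (L' z) =
            (\<lambda>b. \<Sum>i<?N. real_vector.representation B (lookup z i *\<^sub>R h i) b)"
          unfolding L'_def using hE
          by (intro real_vector.representation_sum[OF B(3)]) (simp add: spanB E real_vector.subspace_scale)
        then show ?thesis
          by (simp add: real_vector.representation_scale[OF B(3)] spanB hE
              real_vector.representation_basis[OF B(3)] hB eq_commute[of "h j"])
      qed
      also have "\<dots> = (\<Sum>i<?N. if i = j then lookup z i else 0)"
        using h j by (intro sum.cong) (auto simp: bij_betw_def inj_on_def)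
      finally show ?thesis using j by simp
    qed
    then show ?thesis
      unfolding LR[OF L'E] using z by (intro poly_mapping_eqI) (auto simp: R_def lookup_tabulate coord_space_iff)
  qed
  have "L y \<in> Rn ?m" if y: "y \<in> span (u ` T)" for y
  proof -
    have yE: "y \<in> E" using y u(1) E by (metis real_vector.span_minimal subsetD)
    have "real_vector.representation B y (h j) = 0" if "\<not> j < ?m" "j < ?N" for j
    proof -
      have "h j \<notin> u ` T" using bij_betwE[OF h2] that by auto
      then show ?thesis
        using real_vector.representation_extend[OF B(3) y B(1)] real_vector.representation_ne_zero[of "u ` T" y "h j"]
        by auto
    qed
    then show ?thesis unfolding LR[OF yE] by (auto simp: R_def coord_space_iff lookup_tabulate)
  qed
  moreover have "z \<in> L ` span (u ` T)" if z: "z \<in> Rn ?m" for z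
  proof -
    have zN: "z \<in> Rn ?N" using z mN coord_space_mono[of "{..<?m}" "{..<?N}"] by auto
    have "L' z \<in> span (u ` T)"
      unfolding L'_def
    proof (intro real_vector.span_sum)
      fix j assume "j \<in> {..<?N}"
      show "lookup z j *\<^sub>R h j \<in> span (u ` T)"
      proof (cases "j < ?m")
        case True
        then show ?thesis using h1 by (intro real_vector.span_scale real_vector.span_base) (auto dest: bij_betwE)
      next
        case False
        then have "lookup z j = 0" using z by (auto simp: coord_space_iff)
        then show ?thesis by (simp add: real_vector.span_zero)
      qed
    qed
    then show ?thesis using LL'[OF zN] by (metis imageI)
  qed
  ultimately have "L ` span (u ` T) = Rn ?m" by auto
  moreover have "L ` E \<subseteq> Rn ?N" using LR by (auto simp: R_def tabulate_in)
  moreover have "L' ` Rn ?N \<subseteq> E" using L'E by auto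
  ultimately show thesis using that[OF blL] L'L LL' mN by metis
qed

section \<open>Slice charts without the inverse function theorem\<close>

text \<open>
  The coordinates \<open>q\<close> along the linear slice \<open>u\<close> are tied to the retraction \<open>g\<close> of \<open>F\<close> by
  \<open>q y = p (g y) y\<close>, where \<open>p\<close> depends on \<open>y\<close> only modulo the slice. Hence the map
  \<open>y \<mapsto> \<Sum>t. g y t u t + (1 - \<pi>) (y - F (g y))\<close>, with \<open>\<pi>\<close> the projection onto the slice, has an
  explicit inverse.
\<close>

lemma slice_chart:
  fixes E :: "'a::real_normed_vector set" and u :: "'t \<Rightarrow> 'a"
    and q :: "'t \<Rightarrow> 'a \<Rightarrow> real" and p :: "('t \<Rightarrow> real) \<Rightarrow> 'a \<Rightarrow> 't \<Rightarrow> real"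
  assumes fr: "frame E I c e" and E: "real_vector.subspace E"
    and T: "finite T" and uE: "\<And>t. t \<in> T \<Longrightarrow> u t \<in> E"
    and q: "\<And>t. t \<in> T \<Longrightarrow> bounded_linear (q t)"
    and qu: "\<And>t t'. t \<in> T \<Longrightarrow> t' \<in> T \<Longrightarrow> q t (u t') = (if t = t' then 1 else 0)"
    and \<Omega>: "openin (top_of_set E) \<Omega>"
    and F_in: "\<And>w. F w \<in> \<Omega>" and M: "M \<inter> \<Omega> = range F"
    and gF: "\<And>w t. t \<in> T \<Longrightarrow> g (F w) t = w t"
    and F_cong: "\<And>w w'. (\<And>t. t \<in> T \<Longrightarrow> w t = w' t) \<Longrightarrow> F w = F w'"
    and p: "\<And>y t. y \<in> \<Omega> \<Longrightarrow> t \<in> T \<Longrightarrow> q t y = p (g y) y t"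
    and p_cong: "\<And>w w' y y' t. t \<in> T \<Longrightarrow> (\<And>t. t \<in> T \<Longrightarrow> w t = w' t) \<Longrightarrow> y \<in> E \<Longrightarrow> y' \<in> E \<Longrightarrow>
      y - y' \<in> span (u ` T) \<Longrightarrow> p w y t = p w' y' t"
    and p_inj: "\<And>y w t. y \<in> \<Omega> \<Longrightarrow> (\<And>t. t \<in> T \<Longrightarrow> q t y = p w y t) \<Longrightarrow> t \<in> T \<Longrightarrow> g y t = w t"
    and \<Omega>_cong: "\<And>y y'. y \<in> E \<Longrightarrow> y' \<in> \<Omega> \<Longrightarrow> y - y' \<in> span (u ` T) \<Longrightarrow> y \<in> \<Omega>"
    and sm_g: "\<And>t. t \<in> T \<Longrightarrow> Cinf_on E \<Omega> (\<lambda>y. g y t)"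
    and sm_Fg: "Cinf_on E \<Omega> (\<lambda>y. F (g y))"
    and sm_Fq: "Cinf_on E E (\<lambda>y. F (\<lambda>t. q t y))"
    and sm_p: "\<And>t. t \<in> T \<Longrightarrow> Cinf_on E {y \<in> E. y + F (\<lambda>t. q t y) \<in> \<Omega>}
      (\<lambda>y. p (\<lambda>t. q t y) (y + F (\<lambda>t. q t y)) t)"
  shows "\<exists>V \<phi>. diffeomorphism E \<Omega> (Rn (dim E)) V \<phi> \<and> \<phi> ` (M \<inter> \<Omega>) = V \<inter> Rn (card T)"
    and "card T \<le> dim E"
proof -
  let ?N = "dim E"
  let ?S = "span (u ` T)"
  define s where "s = (\<lambda>a. \<Sum>t\<in>T. a t *\<^sub>R u t)"
  define Q where "Q = (\<lambda>y t. q t y)"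
  \<comment> \<open>In this proof \<open>\<pi>\<close> is the complementary projection: it kills the
    slice, and its values have slice coordinates zero.\<close>
  define \<pi> where "\<pi> = (\<lambda>y. y - s (Q y))"
  have \<Omega>E: "\<Omega> \<subseteq> E" using \<Omega> by (rule openin_imp_subset)
  have FE: "F w \<in> E" for w using F_in \<Omega>E by auto
  have sS: "s a \<in> ?S" for a
    unfolding s_def by (intro real_vector.span_sum real_vector.span_scale real_vector.span_base) auto
  have SE: "?S \<subseteq> E" using uE E by (intro real_vector.span_minimal) auto
  have sE: "s a \<in> E" for a using sS SE by auto
  have s_cong: "s a = s b" if "\<And>t. t \<in> T \<Longrightarrow> a t = b t" for a b
    unfolding s_def using that by (intro sum.cong) auto
  have Qs: "Q (s a) t = a t" if "t \<in> T" for a t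
  proof -
    have "Q (s a) t = (\<Sum>t'\<in>T. a t' * q t (u t'))"
      unfolding Q_def s_def using bounded_linear.linear[OF q[OF that]]
      by (simp add: linear_sum linear_scale)
    also have "\<dots> = (\<Sum>t'\<in>T. if t = t' then a t' else 0)"
      using qu[OF that] by (intro sum.cong) auto
    finally show ?thesis using T that by simp
  qed
  have Qadd: "Q (y + z) t = Q y t + Q z t" and Qdiff: "Q (y - z) t = Q y t - Q z t" if "t \<in> T" for y z t
    using bounded_linear.linear[OF q[OF that]] by (auto simp: Q_def linear_add linear_diff)
  have Q\<pi>: "Q (\<pi> y) t = 0" if "t \<in> T" for y t
    unfolding \<pi>_def using that by (simp add: Qdiff Qs)
  have \<pi>E: "\<pi> y \<in> E" if "y \<in> E" for y
    unfolding \<pi>_def using that sE E by (intro real_vector.subspace_diff) auto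
  have sQ: "s (Q y) = y" if "y \<in> ?S" for y
    using that
  proof (induction rule: real_vector.span_induct_alt)
    case base
    show ?case using real_vector.span_zero
      by (auto simp: s_def Q_def linear_0[OF bounded_linear.linear[OF q]] intro!: sum.neutral)
  next
    case (step a x y)
    then obtain t where t: "t \<in> T" "x = u t" by auto
    define b where "b = (\<lambda>t'. if t' = t then a else 0)"
    have "s (Q (a *\<^sub>R x + y)) = s (\<lambda>t'. b t' + Q y t')"
      using t qu by (intro s_cong) (auto simp: b_def Q_def linear_add[OF bounded_linear.linear[OF q]]
          linear_scale[OF bounded_linear.linear[OF q]])
    also have "\<dots> = s b + s (Q y)"
      unfolding s_def by (simp add: scaleR_add_left sum.distrib)
    also have "s b = (\<Sum>t'\<in>T. if t' = t then a *\<^sub>R u t else 0)"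
      unfolding s_def b_def by (intro sum.cong) auto
    also have "\<dots> = a *\<^sub>R x" using t T by simp
    finally show ?case using step by simp
  qed
  have \<pi>_span: "\<pi> y = 0 \<longleftrightarrow> y \<in> ?S" for y
    unfolding \<pi>_def using sQ sS[of "Q y"] by auto
  have \<pi>_diff: "\<pi> (y - z) = \<pi> y - \<pi> z" for y z
    unfolding \<pi>_def s_def by (simp add: Qdiff scaleR_diff_left sum_subtractf cong: sum.cong)
  have \<pi>_s: "\<pi> (s a) = 0" for a using sS \<pi>_span by simp
  have \<pi>\<pi>: "\<pi> (\<pi> y) = \<pi> y" for y
  proof -
    have "\<pi> (y - s (Q y)) = \<pi> y" by (simp add: \<pi>_diff \<pi>_s)
    moreover have "y - s (Q y) = \<pi> y" by (simp add: \<pi>_def)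
    ultimately show ?thesis by simp
  qed
  have \<pi>_add: "\<pi> (y + z) = \<pi> y + \<pi> z" for y z
    using \<pi>_diff[of "y + z" z] by (simp add: algebra_simps)
  define \<phi> where "\<phi> = (\<lambda>y. s (g y) + \<pi> (y - F (g y)))"
  \<comment> \<open>The inverse of \<open>\<phi>\<close>: if \<open>w = \<phi> y\<close>, then
    \<open>Q w\<close> is \<open>g y\<close> on \<open>T\<close>, and \<open>w + F (Q w)\<close>
    agrees with \<open>y\<close> modulo the slice. This gives \<open>\<pi> y\<close>. The slice
    coordinates of \<open>y\<close> are \<open>p (g y) y\<close>, where \<open>y\<close> may be
    replaced by \<open>w + F (Q w)\<close>.\<close>
  define \<psi> where "\<psi> = (\<lambda>w. \<pi> (w + F (Q w)) + s (p (Q w) (w + F (Q w))))"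
  define V where "V = {w \<in> E. w + F (Q w) \<in> \<Omega>}"
  have \<phi>E: "\<phi> y \<in> E" if "y \<in> \<Omega>" for y
    unfolding \<phi>_def using that \<Omega>E FE
    by (intro real_vector.subspace_add[OF E] sE \<pi>E real_vector.subspace_diff[OF E]) auto
  have Q\<phi>: "Q (\<phi> y) t = g y t" if "t \<in> T" for y t
    unfolding \<phi>_def using that by (simp add: Qadd Qs Q\<pi>)
  have F\<phi>: "F (Q (\<phi> y)) = F (g y)" for y
    by (rule F_cong) (simp add: Q\<phi>)
  have \<phi>_mod: "\<phi> y + F (Q (\<phi> y)) - y \<in> ?S" for y
    unfolding \<pi>_span[symmetric] F\<phi> by (simp add: \<phi>_def \<pi>_diff \<pi>_add \<pi>\<pi> \<pi>_s)
  have \<phi>V: "\<phi> y \<in> V" if y: "y \<in> \<Omega>" for y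
    unfolding V_def using \<phi>E[OF y] \<phi>_mod y FE
    by (auto intro: \<Omega>_cong[of _ y] real_vector.subspace_add[OF E])
  have \<psi>\<phi>: "\<psi> (\<phi> y) = y" if y: "y \<in> \<Omega>" for y
  proof -
    have "p (Q (\<phi> y)) (\<phi> y + F (Q (\<phi> y))) t = Q y t" if t: "t \<in> T" for t
    proof -
      have "p (Q (\<phi> y)) (\<phi> y + F (Q (\<phi> y))) t = p (g y) y t"
        by (rule p_cong[OF t]) (use Q\<phi> \<phi>_mod \<phi>E y \<Omega>E FE in \<open>auto intro: real_vector.subspace_add[OF E]\<close>)
      then show ?thesis using p[OF y t] by (simp add: Q_def)
    qed
    then have "s (p (Q (\<phi> y)) (\<phi> y + F (Q (\<phi> y)))) = s (Q y)" by (rule s_cong)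
    moreover have "\<pi> (\<phi> y + F (Q (\<phi> y))) = \<pi> y"
      using \<phi>_mod[of y] \<pi>_span[of "\<phi> y + F (Q (\<phi> y)) - y"] by (simp add: \<pi>_diff)
    ultimately show ?thesis unfolding \<psi>_def by (simp add: \<pi>_def)
  qed
  have \<psi>_mod: "\<psi> w - (w + F (Q w)) \<in> ?S" for w
    unfolding \<pi>_span[symmetric] by (simp add: \<psi>_def \<pi>_diff \<pi>_add \<pi>\<pi> \<pi>_s)
  have \<psi>E: "\<psi> w \<in> E" if "w \<in> E" for w
    unfolding \<psi>_def using that FE
    by (intro real_vector.subspace_add[OF E] sE \<pi>E) auto
  have \<psi>\<Omega>: "\<psi> w \<in> \<Omega>" if "w \<in> V" for w
    using that \<psi>_mod \<psi>E unfolding V_def by (auto intro: \<Omega>_cong)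
  \<comment> \<open>The slice coordinates of \<open>\<psi> w\<close> were set so that they solve the
    defining equation with \<open>Q w\<close> in the role of \<open>g\<close>; \<open>p_inj\<close>
    says that this equation has no other solution.\<close>
  have g\<psi>: "g (\<psi> w) t = Q w t" if w: "w \<in> V" and t: "t \<in> T" for w t
  proof (rule p_inj[OF \<psi>\<Omega>[OF w] _ t])
    fix t assume t: "t \<in> T"
    have "q t (\<psi> w) = Q (\<psi> w) t" by (simp add: Q_def)
    also have "\<dots> = p (Q w) (w + F (Q w)) t"
      unfolding \<psi>_def using t by (simp add: Qadd Qs Q\<pi>)
    also have "\<dots> = p (Q w) (\<psi> w) t"
    proof (rule p_cong[OF t])
      show "w + F (Q w) - \<psi> w \<in> ?S"
        using real_vector.span_neg[OF \<psi>_mod[of w]] by simp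
    qed (use w \<psi>E FE in \<open>auto simp: V_def intro: real_vector.subspace_add[OF E]\<close>)
    finally show "q t (\<psi> w) = p (Q w) (\<psi> w) t" .
  qed
  have \<phi>\<psi>: "\<phi> (\<psi> w) = w" if w: "w \<in> V" for w
  proof -
    have "F (g (\<psi> w)) = F (Q w)" by (rule F_cong) (simp add: g\<psi>[OF w])
    moreover have "s (g (\<psi> w)) = s (Q w)" by (rule s_cong) (simp add: g\<psi>[OF w])
    ultimately show ?thesis unfolding \<phi>_def
      by (simp add: \<psi>_def \<pi>_diff \<pi>_add \<pi>\<pi> \<pi>_s) (simp add: \<pi>_def)
  qed
  have M_iff: "y \<in> M \<longleftrightarrow> \<phi> y \<in> ?S" if y: "y \<in> \<Omega>" for y
  proof
    assume "y \<in> M"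
    then obtain w where w: "y = F w" using M y by auto
    have "F (g y) = y" using gF[of _ w] unfolding w by (intro F_cong) auto
    then show "\<phi> y \<in> ?S" using \<pi>_s[of "\<lambda>_. 0"] sS by (simp add: \<phi>_def s_def)
  next
    assume "\<phi> y \<in> ?S"
    then have *: "\<phi> y = s (g y)"
      using sQ[of "\<phi> y"] Q\<phi> s_cong[of "Q (\<phi> y)" "g y"] by simp
    \<comment> \<open>This point lies on \<open>M\<close> and has the same image under
      \<open>\<phi>\<close> as \<open>y\<close>, so the left inverse \<open>\<psi>\<close> makes the
      two equal.\<close>
    let ?y = "F (g y)"
    have "F (g ?y) = ?y" using gF by (intro F_cong) auto
    moreover have "s (g ?y) = s (g y)" using gF by (intro s_cong) auto
    ultimately have "\<phi> ?y = \<phi> y" using \<pi>_s[of "\<lambda>_. 0"] * by (simp add: \<phi>_def s_def)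
    then have "?y = y" using \<psi>\<phi>[OF y] \<psi>\<phi>[OF F_in[of "g y"]] by simp
    then show "y \<in> M" using M by (metis IntD1 rangeI)
  qed
  have inj: "inj_on u T"
  proof (rule inj_onI)
    fix t t' assume "t \<in> T" "t' \<in> T" "u t = u t'"
    then show "t = t'" using qu[of t t] qu[of t t'] by (auto split: if_splits)
  qed
  have uT: "u ` T \<subseteq> E" using uE by auto
  have indep: "independent (u ` T)"
  proof (rule real_vector.independent_if_scalars_zero)
    fix f x assume *: "(\<Sum>x\<in>u ` T. f x *\<^sub>R x) = 0" "x \<in> u ` T"
    then obtain t where t: "t \<in> T" "x = u t" by auto
    have "s (\<lambda>t. f (u t)) = 0" using * inj unfolding s_def by (simp add: sum.reindex)
    then have "f (u t) = Q 0 t" using Qs[OF t(1), of "\<lambda>t. f (u t)"] by simp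
    then show "f x = 0" using t by (simp add: Q_def linear_0[OF bounded_linear.linear[OF q]])
  qed (use T in auto)
  obtain L L' where L: "bounded_linear L" "bounded_linear L'"
    "L ` E \<subseteq> Rn ?N" "L' ` Rn ?N \<subseteq> E"
    "\<And>y. y \<in> E \<Longrightarrow> L' (L y) = y" "\<And>z. z \<in> Rn ?N \<Longrightarrow> L (L' z) = z"
    "L ` ?S = Rn (card T)" and le: "card T \<le> ?N"
    using slice_isomorphism[OF fr E T uT indep inj] by (metis (no_types, lifting))
  show "card T \<le> ?N" by (rule le)
  have sm_s: "Cinf_on E U (\<lambda>y. s (a y))" if "\<And>t. t \<in> T \<Longrightarrow> Cinf_on E U (\<lambda>y. a y t)" for a U
    unfolding s_def using that by (intro Cinf_on_sum Cinf_on_scaleR_const)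
  have sm_\<pi>: "Cinf_on E U (\<lambda>y. \<pi> (a y))" if "Cinf_on E U a" for a U
    unfolding \<pi>_def using that q
    by (intro Cinf_on_diff sm_s) (auto simp: Q_def intro: Cinf_on_postcompose)
  have sm_id: "Cinf_on E U (\<lambda>y. y)" for U by (rule Cinf_on_linear[OF bounded_linear_ident])
  have sm_\<phi>: "Cinf_on E \<Omega> \<phi>"
    unfolding \<phi>_def by (intro Cinf_on_add sm_s sm_\<pi> Cinf_on_diff sm_g sm_Fg sm_id)
  have sm_FQ: "Cinf_on E V (\<lambda>w. F (Q w))"
    unfolding Q_def by (rule Cinf_on_subset[OF sm_Fq]) (auto simp: V_def)
  have sm_\<psi>: "Cinf_on E V \<psi>"
    unfolding \<psi>_def using sm_p
    by (intro Cinf_on_add sm_s sm_\<pi> sm_FQ sm_id) (auto simp: V_def Q_def)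
  let ?\<Phi> = "\<lambda>y. L (\<phi> y)" and ?\<Psi> = "\<lambda>z. \<psi> (L' z)" and ?W = "{z \<in> Rn ?N. L' z \<in> V}"
  have bij: "bij_betw ?\<Phi> \<Omega> ?W"
    by (rule bij_betw_byWitness[where f' = ?\<Psi>])
      (use \<phi>E \<phi>V \<psi>\<phi> \<phi>\<psi> \<psi>\<Omega> L in \<open>auto simp: V_def\<close>)
  have "openin (top_of_set (Rn ?N)) ?W"
  proof -
    have "continuous_on (Rn ?N) L'" by (rule linear_continuous_on[OF L(2)])
    then have "continuous_on (Rn ?N) (\<lambda>z. L' z + F (\<lambda>t. q t (L' z)))"
      using continuous_on_add continuous_on_compose2[OF Cinf_on_continuous[OF sm_Fq] _ L(4)] by blast
    moreover have "(\<lambda>z. L' z + F (\<lambda>t. q t (L' z))) \<in> Rn ?N \<rightarrow> E"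
      using L(4) FE E by (auto intro!: real_vector.subspace_add)
    ultimately have "openin (top_of_set (Rn ?N)) (Rn ?N \<inter> (\<lambda>z. L' z + F (\<lambda>t. q t (L' z))) -` \<Omega>)"
      using \<Omega> by (rule continuous_openin_preimage)
    moreover have "Rn ?N \<inter> (\<lambda>z. L' z + F (\<lambda>t. q t (L' z))) -` \<Omega> = ?W"
      using L(4) by (auto simp: V_def Q_def)
    ultimately show ?thesis by simp
  qed
  moreover have "Cinf_on (Rn ?N) ?W (inv_into \<Omega> ?\<Phi>)"
  proof (rule Cinf_on_cong)
    show "Cinf_on (Rn ?N) ?W ?\<Psi>"
      by (rule Cinf_on_precompose[OF L(2) L(4) _ sm_\<psi>]) auto
    fix z assume z: "z \<in> ?W"
    then have "?\<Psi> z \<in> \<Omega>" "?\<Phi> (?\<Psi> z) = z" using \<psi>\<Omega>[of "L' z"] \<phi>\<psi>[of "L' z"] L(6)[of z] by auto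
    then show "?\<Psi> z = inv_into \<Omega> ?\<Phi> z"
      by (intro inv_into_f_eq[OF bij_betw_imp_inj_on[OF bij], symmetric])
  qed
  ultimately have "diffeomorphism E \<Omega> (Rn ?N) ?W ?\<Phi>"
    unfolding diffeomorphism_def smooth_on_iff using bij \<Omega> Cinf_on_postcompose[OF L(1) sm_\<phi>] by simp
  moreover have "?\<Phi> ` (M \<inter> \<Omega>) = ?W \<inter> Rn (card T)"
  proof (intro equalityI subsetI)
    fix z assume "z \<in> ?\<Phi> ` (M \<inter> \<Omega>)"
    then obtain y where y: "y \<in> M" "y \<in> \<Omega>" "z = ?\<Phi> y" by auto
    then have "\<phi> y \<in> ?S" using M_iff by auto
    then show "z \<in> ?W \<inter> Rn (card T)" using y bij_betwE[OF bij] L(7) by auto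
  next
    fix z assume z: "z \<in> ?W \<inter> Rn (card T)"
    then obtain w where w: "w \<in> ?S" "z = L w" using L(7) by auto
    then have "L' z = w" "w \<in> V" using z L(5) SE by auto
    then have "\<psi> w \<in> \<Omega>" "\<phi> (\<psi> w) = w" using \<psi>\<Omega> \<phi>\<psi> by auto
    then have "\<psi> w \<in> M \<inter> \<Omega>" "?\<Phi> (\<psi> w) = z" using M_iff w by auto
    then show "z \<in> ?\<Phi> ` (M \<inter> \<Omega>)" by blast
  qed
  ultimately show "\<exists>V \<phi>. diffeomorphism E \<Omega> (Rn ?N) V \<phi> \<and> \<phi> ` (M \<inter> \<Omega>) = V \<inter> Rn (card T)"
    by blast
qed

section \<open>Quotients by the fibres of a map with local sections\<close>

text \<open>Through every point runs a whole straight line in \<open>U\<close> along which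
  \<open>f\<close> is affine with prescribed velocity \<open>v\<close>. The chain rule on this line
  shows that \<open>v\<close> is a value of the derivative, which need not be computed.\<close>

lemma submersion_directional:
  assumes m: "Cinf_on E U f" "openin (top_of_set E) U" "f ` U \<subseteq> Rn m"
    and dir: "\<And>x v. x \<in> U \<Longrightarrow> v \<in> Rn m \<Longrightarrow>
      \<exists>w\<in>E. \<forall>\<tau>. x + \<tau> *\<^sub>R w \<in> U \<and> f (x + \<tau> *\<^sub>R w) = f x + \<tau> *\<^sub>R v"
  shows "submersion E U (Rn m) f"
  unfolding submersion_def smooth_on_iff
proof (intro conjI ballI m)
  fix x assume x: "x \<in> U"
  define P :: "(nat \<Rightarrow>\<^sub>0 real) \<Rightarrow> nat \<Rightarrow>\<^sub>0 real"
    where "P = (\<lambda>z. \<Sum>i<m. lookup z i *\<^sub>R Poly_Mapping.single i 1)"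
  have blP: "bounded_linear P"
    unfolding P_def by (intro bounded_linear_sum_scaleR bounded_linear_lookup)
  have P: "P z = z" if "z \<in> Rn m" for z
    unfolding P_def using coord_space_expand[OF _ that] by simp
  have P_in: "P z \<in> Rn m" for z
    unfolding P_def
    by (intro real_vector.subspace_sum[OF subspace_coord_space]
        real_vector.subspace_scale[OF subspace_coord_space]) (auto simp: coord_space_def)
  obtain D where D: "(f has_derivative D) (at x within U)"
    using Cinf_on_differentiable[OF m(1) x] by blast
  \<comment> \<open>\<open>P\<close> fixes the values of \<open>f\<close>, so composing with it
    yields again a derivative of \<open>f\<close>, now with range in \<open>Rn m\<close> as the
    definition of a submersion demands.\<close>
  have "((\<lambda>x. P (f x)) has_derivative (\<lambda>v. P (D v))) (at x within U)"
    by (rule bounded_linear.has_derivative[OF blP D])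
  then have PD: "(f has_derivative (\<lambda>v. P (D v))) (at x within U)"
    by (rule has_derivative_transform[OF x, rotated]) (use P m(3) in auto)
  have "v \<in> (\<lambda>v. P (D v)) ` E" if v: "v \<in> Rn m" for v
  proof -
    obtain w where w: "w \<in> E" "\<And>\<tau>. x + \<tau> *\<^sub>R w \<in> U" "\<And>\<tau>. f (x + \<tau> *\<^sub>R w) = f x + \<tau> *\<^sub>R v"
      using dir[OF x v] by blast
    have 1: "((\<lambda>\<tau>. x + \<tau> *\<^sub>R w) has_derivative (\<lambda>\<tau>. \<tau> *\<^sub>R w)) (at (0::real))"
      by (auto intro!: derivative_eq_intros)
    have 2: "(f has_derivative (\<lambda>v. P (D v))) (at (x + 0 *\<^sub>R w) within range (\<lambda>\<tau>. x + \<tau> *\<^sub>R w))"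
      using PD w(2) by (auto intro: has_derivative_subset)
    have "((\<lambda>\<tau>. f (x + \<tau> *\<^sub>R w)) has_derivative (\<lambda>\<tau>. P (D (\<tau> *\<^sub>R w)))) (at 0)"
      by (rule has_derivative_in_compose[OF 1 2])
    moreover have "((\<lambda>\<tau>. f (x + \<tau> *\<^sub>R w)) has_derivative (\<lambda>\<tau>. \<tau> *\<^sub>R v)) (at (0::real))"
      unfolding w(3) by (auto intro!: derivative_eq_intros)
    ultimately have "(\<lambda>\<tau>::real. P (D (\<tau> *\<^sub>R w))) = (\<lambda>\<tau>. \<tau> *\<^sub>R v)"
      by (rule has_derivative_unique)
    from fun_cong[OF this, of 1] show ?thesis using w(1) by auto
  qed
  then show "\<exists>D. (f has_derivative D) (at x within U) \<and> D ` E = Rn m"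
    using PD P_in by (intro exI[of _ "\<lambda>v. P (D v)"]) auto
qed

text \<open>A continuous map with continuous local sections is a quotient map onto its image, so the
  set of fibres may be identified with \<open>M\<close> and given the charts \<open>g j\<close>.
  Each chart maps onto all of \<open>Rn m\<close>, the domain of \<open>\<sigma> j\<close>. The
  straight lines in \<open>dir\<close> yield the submersion property.\<close>

lemma quotient_manifold_sections:
  fixes F :: "'a::real_normed_vector \<Rightarrow> 'b::real_normed_vector" and E S m
  defines "R \<equiv> {(x, y). x \<in> S \<and> y \<in> S \<and> F x = F y}" and "M \<equiv> F ` S"
  assumes E: "real_vector.subspace E" and S: "openin (top_of_set E) S"
    and sc: "second_countable (top_of_set M)" and cF: "continuous_on S F"
    and W: "\<And>j. j \<in> J \<Longrightarrow> openin (top_of_set M) (W j)" and cover: "M = (\<Union>j\<in>J. W j)"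
    and cg: "\<And>j. j \<in> J \<Longrightarrow> continuous_on (W j) (g j)"
    and g: "\<And>j y. j \<in> J \<Longrightarrow> y \<in> W j \<Longrightarrow> g j y \<in> Rn m"
    and c\<sigma>: "\<And>j. j \<in> J \<Longrightarrow> continuous_on (Rn m) (\<sigma> j)"
    and \<sigma>S: "\<And>j t. j \<in> J \<Longrightarrow> t \<in> Rn m \<Longrightarrow> \<sigma> j t \<in> S"
    and \<sigma>W: "\<And>j t. j \<in> J \<Longrightarrow> t \<in> Rn m \<Longrightarrow> F (\<sigma> j t) \<in> W j"
    and g\<sigma>: "\<And>j t. j \<in> J \<Longrightarrow> t \<in> Rn m \<Longrightarrow> g j (F (\<sigma> j t)) = t"
    and \<sigma>g: "\<And>j y. j \<in> J \<Longrightarrow> y \<in> W j \<Longrightarrow> F (\<sigma> j (g j y)) = y"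
    and sm: "\<And>j. j \<in> J \<Longrightarrow> Cinf_on E {x \<in> S. F x \<in> W j} (\<lambda>x. g j (F x))"
    and trans: "\<And>j j'. j \<in> J \<Longrightarrow> j' \<in> J \<Longrightarrow>
      Cinf_on (Rn m) {t \<in> Rn m. F (\<sigma> j t) \<in> W j'} (\<lambda>t. g j' (F (\<sigma> j t)))"
    and dir: "\<And>j x v. j \<in> J \<Longrightarrow> x \<in> S \<Longrightarrow> F x \<in> W j \<Longrightarrow> v \<in> Rn m \<Longrightarrow>
      \<exists>w\<in>E. \<forall>\<tau>. x + \<tau> *\<^sub>R w \<in> S \<and> F (x + \<tau> *\<^sub>R w) \<in> W j \<and>
        g j (F (x + \<tau> *\<^sub>R w)) = g j (F x) + \<tau> *\<^sub>R v"
  shows "quotient_manifold E S R m"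
proof -
  \<comment> \<open>\<open>G\<close> sends a point of \<open>M\<close> to its fibre and
    \<open>Fb\<close>, which evaluates \<open>F\<close> at some representative, is the inverse. The
    topology of \<open>M\<close> is transported along \<open>Fb\<close>.\<close>
  define G where "G = (\<lambda>y. {x \<in> S. F x = y})"
  define Fb where "Fb = (\<lambda>C. F (SOME x. x \<in> C))"
  define X where "X = pullback_topology (S // R) Fb (top_of_set M)"
  have equivR: "equiv S R"
    by (auto simp: equiv_def refl_on_def sym_def trans_def R_def)
  have cls: "R `` {x} = G (F x)" if "x \<in> S" for x
    using that by (auto simp: R_def G_def)
  have quot: "S // R = G ` M"
    unfolding quotient_def M_def using cls by auto
  have FbG: "Fb (G y) = y" if "y \<in> M" for y
  proof -
    have "\<exists>x. x \<in> G y" using that by (auto simp: G_def M_def)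
    then have "(SOME x. x \<in> G y) \<in> G y" by (rule someI_ex)
    then show ?thesis by (auto simp: Fb_def G_def)
  qed
  have GFb: "G (Fb C) = C" if "C \<in> S // R" for C
    using that FbG unfolding quot by auto
  have FbM: "Fb ` (S // R) = M" unfolding quot using FbG by (force simp: image_image)
  have WM: "W j \<subseteq> M" if "j \<in> J" for j using W[OF that] openin_imp_subset by blast
  have topX: "topspace X = S // R"
    unfolding X_def topspace_pullback_topology using FbM by auto
  have hom: "homeomorphic_map X (top_of_set M) Fb"
    unfolding homeomorphic_map_def quotient_map_def
  proof (intro conjI allI impI)
    show "inj_on Fb (topspace X)" unfolding topX using GFb by (rule inj_on_inverseI)
    show "Fb ` topspace X = topspace (top_of_set M)" using FbM topX by simp
    fix U assume U: "U \<subseteq> topspace (top_of_set M)"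
    have "openin X {C \<in> topspace X. Fb C \<in> U} \<longleftrightarrow>
        (\<exists>V. openin (top_of_set M) V \<and> {C \<in> S // R. Fb C \<in> U} = Fb -` V \<inter> S // R)"
      unfolding topX unfolding X_def openin_pullback_topology ..
    also have "\<dots> \<longleftrightarrow> openin (top_of_set M) U"
    proof
      assume "\<exists>V. openin (top_of_set M) V \<and> {C \<in> S // R. Fb C \<in> U} = Fb -` V \<inter> S // R"
      then show "openin (top_of_set M) U"
      proof (elim exE conjE)
        fix V assume V: "openin (top_of_set M) V" "{C \<in> S // R. Fb C \<in> U} = Fb -` V \<inter> S // R"
        have "y \<in> U \<longleftrightarrow> y \<in> V" if "y \<in> M" for y
          using arg_cong[OF V(2), of "\<lambda>A. G y \<in> A"] that FbG[OF that] by (simp add: quot)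
        then have "U = V" using U openin_imp_subset[OF V(1)] by auto
        then show "openin (top_of_set M) U" using V by simp
      qed
    qed auto
    finally show "openin X {x \<in> topspace X. Fb x \<in> U} = openin (top_of_set M) U" .
  qed
  have homG: "homeomorphic_map (top_of_set M) X G"
  proof -
    obtain h where h: "homeomorphic_maps X (top_of_set M) Fb h"
      using hom unfolding homeomorphic_map_maps by blast
    then have "homeomorphic_map (top_of_set M) X h" "\<And>C. C \<in> S // R \<Longrightarrow> h (Fb C) = C"
      unfolding homeomorphic_maps_map topX by auto
    moreover have "h y = G y" if "y \<in> M" for y
      using calculation(2)[of "G y"] FbG that by (simp add: quot)
    ultimately show ?thesis by (auto intro: homeomorphic_map_eq)
  qed
  have cFW: "openin (top_of_set S) {x \<in> S. F x \<in> U}" if "openin (top_of_set M) U" for U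
  proof -
    have "openin (top_of_set S) (S \<inter> F -` U)"
      using that cF by (intro continuous_openin_preimage[where T = M]) (auto simp: M_def)
    moreover have "S \<inter> F -` U = {x \<in> S. F x \<in> U}" by auto
    ultimately show ?thesis by simp
  qed
  have qF: "quotient_map (top_of_set S) (top_of_set M) F"
    unfolding quotient_map_def
  proof (intro conjI allI impI iffI)
    show "F ` topspace (top_of_set S) = topspace (top_of_set M)" by (simp add: M_def)
    fix U assume U: "U \<subseteq> topspace (top_of_set M)"
    { assume "openin (top_of_set M) U"
      then show "openin (top_of_set S) {x \<in> topspace (top_of_set S). F x \<in> U}" using cFW by simp }
    assume op: "openin (top_of_set S) {x \<in> topspace (top_of_set S). F x \<in> U}"
    \<comment> \<open>On \<open>W j\<close> the map \<open>\<sigma> j (g j y)\<close> is a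
      continuous section of \<open>F\<close>, and \<open>U \<inter> W j\<close> is its preimage of
      the open set of those \<open>x\<close> with \<open>F x \<in> U\<close>.\<close>
    have "openin (top_of_set M) (U \<inter> W j)" if j: "j \<in> J" for j
    proof -
      have "continuous_on (W j) (\<lambda>y. \<sigma> j (g j y))"
        by (rule continuous_on_compose2[OF c\<sigma>[OF j] cg[OF j]]) (use g[OF j] in auto)
      moreover have "(\<lambda>y. \<sigma> j (g j y)) \<in> W j \<rightarrow> S" using \<sigma>S[OF j] g[OF j] by auto
      ultimately have "openin (top_of_set (W j)) (W j \<inter> (\<lambda>y. \<sigma> j (g j y)) -` {x \<in> S. F x \<in> U})"
        using op by (intro continuous_openin_preimage[where T = S]) auto
      moreover have "W j \<inter> (\<lambda>y. \<sigma> j (g j y)) -` {x \<in> S. F x \<in> U} = U \<inter> W j"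
        using \<sigma>g[OF j] \<sigma>S[OF j] g[OF j] by auto
      ultimately show ?thesis using W[OF j] openin_trans by auto
    qed
    then have "openin (top_of_set M) (\<Union>j\<in>J. U \<inter> W j)" by blast
    moreover have "(\<Union>j\<in>J. U \<inter> W j) = U" using U cover by auto
    ultimately show "openin (top_of_set M) U" by simp
  qed
  have "quotient_map (top_of_set S) X (G \<circ> F)"
    using qF homG unfolding homeomorphic_map_def by (auto intro: quotient_map_compose)
  then have quo: "quotient_map (top_of_set S) X (\<lambda>x. R `` {x})"
    by (rule quotient_map_eq) (simp add: cls)
  define Wc where "Wc = (\<lambda>j. {C \<in> S // R. Fb C \<in> W j})"
  define \<phi> where "\<phi> = (\<lambda>j C. g j (Fb C))"
  have WcG: "Wc j = G ` W j" if "j \<in> J" for j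
    unfolding Wc_def quot using FbG WM[OF that] by auto
  have gW: "g j ` W j = Rn m" if j: "j \<in> J" for j
    using g[OF j] g\<sigma>[OF j] \<sigma>W[OF j] by (force simp: image_iff)
  have \<phi>Wc: "\<phi> j ` Wc j = Rn m" if j: "j \<in> J" for j
    unfolding WcG[OF j] \<phi>_def gW[OF j, symmetric] image_image
    using FbG WM[OF j] by (intro image_cong) auto
  have inv\<phi>: "inv_into (Wc j) (\<phi> j) t = G (F (\<sigma> j t))" if j: "j \<in> J" and t: "t \<in> Rn m" for j t
  proof (rule inv_into_f_eq)
    show "inj_on (\<phi> j) (Wc j)"
    proof (rule inj_on_inverseI)
      fix C assume "C \<in> Wc j"
      then show "G (F (\<sigma> j (\<phi> j C))) = C"
        unfolding \<phi>_def Wc_def using \<sigma>g[OF j] GFb by auto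
    qed
    show "G (F (\<sigma> j t)) \<in> Wc j" using \<sigma>W[OF j t] WcG[OF j] by auto
    show "\<phi> j (G (F (\<sigma> j t))) = t"
      using \<sigma>W[OF j t] WM[OF j] FbG g\<sigma>[OF j t] by (auto simp: \<phi>_def)
  qed
  have \<phi>_hom: "homeomorphic_map (subtopology X (Wc j)) (top_of_set (Rn m)) (\<phi> j)" if j: "j \<in> J" for j
  proof -
    have "homeomorphic_map (subtopology X (Wc j)) (subtopology (top_of_set M) (W j)) Fb"
    proof (rule homeomorphic_map_subtopologies[OF hom])
      have "topspace X \<inter> Wc j = G ` W j" using WcG[OF j] WM[OF j] by (auto simp: topX quot)
      then have "Fb ` (topspace X \<inter> Wc j) = (\<lambda>y. y) ` W j"
        using FbG WM[OF j] by (simp add: image_image subset_iff cong: image_cong)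
      then show "Fb ` (topspace X \<inter> Wc j) = topspace (top_of_set M) \<inter> W j"
        using WM[OF j] by auto
    qed
    moreover have "subtopology (top_of_set M) (W j) = top_of_set (W j)"
      using WM[OF j] by (simp add: subtopology_subtopology Int_absorb1)
    moreover have "homeomorphic_maps (top_of_set (W j)) (top_of_set (Rn m)) (g j) (\<lambda>t. F (\<sigma> j t))"
      unfolding homeomorphic_maps_def
      using cg[OF j] g[OF j] \<sigma>g[OF j] g\<sigma>[OF j] \<sigma>W[OF j] \<sigma>S[OF j]
      by (auto intro!: continuous_on_compose2[OF cF c\<sigma>[OF j]])
    ultimately have "homeomorphic_map (subtopology X (Wc j)) (top_of_set (Rn m)) (g j \<circ> Fb)"
      by (metis homeomorphic_map_compose homeomorphic_maps_imp_map)
    then show ?thesis by (simp add: \<phi>_def comp_def)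
  qed
  have \<phi>_trans: "smooth_on (Rn m) (\<phi> j ` (Wc j \<inter> Wc j')) (\<phi> j' \<circ> inv_into (Wc j) (\<phi> j))"
    if j: "j \<in> J" and j': "j' \<in> J" for j j'
  proof -
    have eq: "\<phi> j ` (Wc j \<inter> Wc j') = {t \<in> Rn m. F (\<sigma> j t) \<in> W j'}" (is "_ = ?T")
    proof (intro equalityI subsetI)
      fix t assume "t \<in> \<phi> j ` (Wc j \<inter> Wc j')"
      then obtain C where C: "C \<in> S // R" "Fb C \<in> W j" "Fb C \<in> W j'" "t = g j (Fb C)"
        by (auto simp: Wc_def \<phi>_def)
      then show "t \<in> {t \<in> Rn m. F (\<sigma> j t) \<in> W j'}" using g[OF j] \<sigma>g[OF j] by auto
    next
      fix t assume t: "t \<in> {t \<in> Rn m. F (\<sigma> j t) \<in> W j'}"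
      then have t': "t \<in> Rn m" "F (\<sigma> j t) \<in> W j'" by auto
      have "F (\<sigma> j t) \<in> W j" "Fb (G (F (\<sigma> j t))) = F (\<sigma> j t)"
        using \<sigma>W[OF j t'(1)] WM[OF j] FbG by auto
      then have "G (F (\<sigma> j t)) \<in> Wc j \<inter> Wc j'" "\<phi> j (G (F (\<sigma> j t))) = t"
        using t' g\<sigma>[OF j t'(1)] WcG[OF j] WcG[OF j'] by (auto simp: \<phi>_def)
      then show "t \<in> \<phi> j ` (Wc j \<inter> Wc j')" by (metis imageI)
    qed
    have "continuous_on (Rn m) (\<lambda>t. F (\<sigma> j t))"
      by (rule continuous_on_compose2[OF cF c\<sigma>[OF j]]) (use \<sigma>S[OF j] in auto)
    then have "openin (top_of_set (Rn m)) (Rn m \<inter> (\<lambda>t. F (\<sigma> j t)) -` W j')"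
      using W[OF j'] \<sigma>W[OF j] WM[OF j] by (intro continuous_openin_preimage[where T = M]) auto
    moreover have "Rn m \<inter> (\<lambda>t. F (\<sigma> j t)) -` W j' = ?T" by auto
    moreover have "Cinf_on (Rn m) ?T (\<phi> j' \<circ> inv_into (Wc j) (\<phi> j))"
    proof (rule Cinf_on_cong[OF _ trans[OF j j']])
      fix t assume "t \<in> ?T"
      then show "g j' (F (\<sigma> j t)) = (\<phi> j' \<circ> inv_into (Wc j) (\<phi> j)) t"
        using inv\<phi>[OF j] FbG WM[OF j'] by (auto simp: \<phi>_def)
    qed
    ultimately show ?thesis unfolding eq smooth_on_iff by simp
  qed
  have sub: "submersion E {x \<in> S. R `` {x} \<in> Wc j} (Rn m) (\<lambda>x. \<phi> j (R `` {x}))" if j: "j \<in> J" for j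
  proof -
    have FM: "F x \<in> M" if "x \<in> S" for x using that by (auto simp: M_def)
    have set: "{x \<in> S. R `` {x} \<in> Wc j} = {x \<in> S. F x \<in> W j}"
      using FbG FM cls by (auto simp: Wc_def quot)
    have val: "g j (F x) = \<phi> j (R `` {x})" if "x \<in> S" for x
      using FbG[OF FM[OF that]] cls[OF that] by (simp add: \<phi>_def)
    show ?thesis
      unfolding set
    proof (rule submersion_directional)
      show "Cinf_on E {x \<in> S. F x \<in> W j} (\<lambda>x. \<phi> j (R `` {x}))"
        by (rule Cinf_on_cong[OF _ sm[OF j]]) (use val in auto)
      show "openin (top_of_set E) {x \<in> S. F x \<in> W j}"
        using cFW[OF W[OF j]] S openin_trans by blast
      show "(\<lambda>x. \<phi> j (R `` {x})) ` {x \<in> S. F x \<in> W j} \<subseteq> Rn m"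
        using g[OF j] val by force
      fix x v assume x: "x \<in> {x \<in> S. F x \<in> W j}" and v: "v \<in> Rn m"
      then obtain w where "w \<in> E" "\<forall>\<tau>. x + \<tau> *\<^sub>R w \<in> S \<and> F (x + \<tau> *\<^sub>R w) \<in> W j \<and>
        g j (F (x + \<tau> *\<^sub>R w)) = g j (F x) + \<tau> *\<^sub>R v"
        using dir[OF j _ _ v] by blast
      then show "\<exists>w\<in>E. \<forall>\<tau>. x + \<tau> *\<^sub>R w \<in> {x \<in> S. F x \<in> W j} \<and>
          \<phi> j (R `` {x + \<tau> *\<^sub>R w}) = \<phi> j (R `` {x}) + \<tau> *\<^sub>R v"
        using x by (intro bexI[of _ w]) (simp_all flip: val)
    qed
  qed
  have "smooth_manifold X m ((\<lambda>j. (Wc j, \<phi> j)) ` J)"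
    unfolding smooth_manifold_def
  proof (intro conjI)
    have hs: "X homeomorphic_space top_of_set M"
      using hom homeomorphic_map_imp_homeomorphic_space by blast
    show "Hausdorff_space X"
      using homeomorphic_Hausdorff_space[OF hs] Hausdorff_space_subtopology[OF Hausdorff_space_euclidean] by simp
    show "second_countable X"
      using homeomorphic_space_second_countability[OF hs] sc by simp
    show "(\<Union>(W, \<phi>)\<in>(\<lambda>j. (Wc j, \<phi> j)) ` J. W) = topspace X"
      unfolding topX quot cover using WcG by auto
    show "\<forall>(W, \<phi>)\<in>(\<lambda>j. (Wc j, \<phi> j)) ` J. openin X W \<and> openin (top_of_set (Rn m)) (\<phi> ` W) \<and>
        homeomorphic_map (subtopology X W) (top_of_set (\<phi> ` W)) \<phi>"
    proof safe
      fix j assume j: "j \<in> J"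
      have "Wc j = Fb -` W j \<inter> S // R" by (auto simp: Wc_def)
      then show "openin X (Wc j)"
        unfolding X_def openin_pullback_topology using W[OF j] by blast
    qed (use \<phi>Wc \<phi>_hom in auto)
    show "\<forall>(W, f)\<in>(\<lambda>j. (Wc j, \<phi> j)) ` J. \<forall>(W', f')\<in>(\<lambda>j. (Wc j, \<phi> j)) ` J.
        smooth_on (Rn m) (f ` (W \<inter> W')) (f' \<circ> inv_into W f)"
      using \<phi>_trans by auto
  qed
  then show ?thesis
    unfolding quotient_manifold_def using E S equivR quo sub
    by (intro conjI exI[of _ X] exI[of _ "(\<lambda>j. (Wc j, \<phi> j)) ` J"]) auto
qed

section \<open>Full row rank\<close>

text \<open>A maximal independent set of columns has \<open>rank M\<close> elements and forms an
  invertible square matrix. Listing this set without repetition forces the chosen column numbers to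
  be distinct.\<close>

lemma (in vec_space) full_rank_imp_minor:
  assumes M: "M \<in> carrier_mat n nc" and rk: "rank M = n"
  obtains f where "inj_on f {..<n}" "f ` {..<n} \<subseteq> {..<nc}"
    "det (mat n n (\<lambda>(a, b). M $$ (a, f b))) \<noteq> 0"
proof -
  obtain S where S: "finite S" "maximal S (\<lambda>T. T \<subseteq> set (cols M) \<and> lin_indpt T)"
    using maximal_exists_superset[of "set (cols M)" "\<lambda>T. T \<subseteq> set (cols M) \<and> lin_indpt T" "{}"]
    by (auto simp: lin_dep_def)
  have cS: "card S = n" using rank_card_indpt[OF M S(2)] rk by simp
  have S': "S \<subseteq> set (cols M)" "lin_indpt S" using S(2) unfolding maximal_def by auto
  obtain xs where xs: "set xs = S" "distinct xs" using finite_distinct_list[OF S(1)] by blast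
  have len: "length xs = n" using xs cS distinct_card by fastforce
  have xsd: "set xs \<subseteq> carrier_vec n" using S'(1) xs cols_dim[of M] M by auto
  define B where "B = mat_of_cols n xs"
  have B: "B \<in> carrier_mat n n" using mat_of_cols_carrier(1)[of n xs] len by (simp add: B_def)
  have cB: "cols B = xs" unfolding B_def using xsd by (simp add: cols_mat_of_cols)
  have "det B \<noteq> 0"
    unfolding det_rank_iff[OF B] using lin_indpt_full_rank[OF B] cB xs S'(2) by simp
  have "\<forall>b<n. \<exists>c<nc. col M c = xs ! b"
  proof (intro allI impI)
    fix b assume "b < n"
    then have "xs ! b \<in> set (cols M)" using S'(1) xs len by auto
    then show "\<exists>c<nc. col M c = xs ! b" using M by (auto simp: cols_def)
  qed
  then obtain f where f: "\<And>b. b < n \<Longrightarrow> f b < nc" "\<And>b. b < n \<Longrightarrow> col M (f b) = xs ! b" by metis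
  have "mat n n (\<lambda>(a, b). M $$ (a, f b)) = B"
  proof (rule eq_matI)
    fix a b assume "a < dim_row B" "b < dim_col B"
    then have ab: "a < n" "b < n" using B by auto
    then have "B $$ (a, b) = vec_index (xs ! b) a" unfolding B_def using len by (simp add: mat_of_cols_index)
    then show "mat n n (\<lambda>(a, b). M $$ (a, f b)) $$ (a, b) = B $$ (a, b)"
      using ab f(1)[of b] M by (simp flip: f(2)[OF ab(2)])
  qed (use B in auto)
  moreover have "inj_on f {..<n}"
  proof (rule inj_onI)
    fix a b assume "a \<in> {..<n}" "b \<in> {..<n}" "f a = f b"
    then have "xs ! a = xs ! b" "a < length xs" "b < length xs" using f(2) len by (simp_all flip: f(2))
    then show "a = b" using xs(2) nth_eq_iff_index_eq by blast
  qed
  ultimately show thesis using that[of f] f(1) \<open>det B \<noteq> 0\<close> by auto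
qed

text \<open>If \<open>C\<close> is a right inverse of \<open>M * B\<close>, every vector
  \<open>v\<close> equals \<open>M\<close> applied to \<open>B (C v)\<close>, so the columns of
  \<open>M\<close> span.\<close>

lemma (in vec_space) full_rankI:
  assumes M: "M \<in> carrier_mat n nc" and B: "B \<in> carrier_mat nc n" and d: "det (M * B) \<noteq> 0"
  shows "rank M = n"
proof -
  have MB: "M * B \<in> carrier_mat n n" using M B by simp
  obtain C where C: "C \<in> carrier_mat n n" "(M * B) * C = 1\<^sub>m n"
    using det_non_zero_imp_unit[OF MB d, of "()"] unfolding Units_def ring_mat_def by auto
  have "carrier_vec n \<subseteq> span (set (cols M))"
  proof
    fix v :: "'a Matrix.vec" assume v: "v \<in> carrier_vec n"
    have "M *\<^sub>v (B *\<^sub>v (C *\<^sub>v v)) = v"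
      using assoc_mult_mat_vec[OF M B, of "C *\<^sub>v v"] assoc_mult_mat_vec[OF MB C(1) v] C v by simp
    moreover have "B *\<^sub>v (C *\<^sub>v v) \<in> carrier_vec nc" using B C v by auto
    ultimately have "v \<in> col_space M" unfolding col_space_eq[OF M] using v M by auto
    then show "v \<in> span (set (cols M))" by (simp add: col_space_def)
  qed
  moreover have "set (cols M) \<subseteq> carrier_vec n" using cols_dim[of M] M by auto
  ultimately have "span (set (cols M)) = carrier_vec n" using span_closed by auto
  moreover have "vs (carrier_vec n) = V" by (simp add: module_vec_def)
  ultimately show ?thesis by (simp only: rank_def dim_is_n)
qed

text \<open>The scalar product of \<open>M v\<close> with itself can be moved to one of
  \<open>v\<close> with \<open>M\<^sup>T M v\<close>, which is zero, and over the reals a vanishing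
  sum of squares vanishes termwise.\<close>

lemma sum_square_mult_mat_vec:
  fixes M :: "real mat"
  assumes M: "M \<in> carrier_mat nr nc" and v: "v \<in> carrier_vec nc" and z: "(M\<^sup>T * M) *\<^sub>v v = 0\<^sub>v nc"
  shows "M *\<^sub>v v = 0\<^sub>v nr"
proof -
  define u where "u = M *\<^sub>v v"
  have u: "u \<in> carrier_vec nr" using M v by (simp add: u_def)
  have "M\<^sup>T *\<^sub>v u = 0\<^sub>v nc" using z M v by (simp add: u_def assoc_mult_mat_vec)
  then have "scalar_prod u u = 0"
    using transpose_vec_mult_scalar[OF M v u] v by (simp add: u_def)
  then have "vec_index u a = 0" if "a < nr" for a
    using u that by (auto simp: scalar_prod_def sum_nonneg_eq_0_iff)
  then have "u = 0\<^sub>v nr" using u by (intro eq_vecI) auto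
  then show ?thesis by (simp add: u_def)
qed

lemma det_gram_nonzero:
  fixes M :: "real mat"
  assumes M: "M \<in> carrier_mat nr nc"
    and inj: "\<And>v. v \<in> carrier_vec nc \<Longrightarrow> M *\<^sub>v v = 0\<^sub>v nr \<Longrightarrow> v = 0\<^sub>v nc"
  shows "det (M\<^sup>T * M) \<noteq> 0"
proof
  have MM: "M\<^sup>T * M \<in> carrier_mat nc nc" using M by simp
  assume "det (M\<^sup>T * M) = 0"
  then obtain v where v: "v \<in> carrier_vec nc" "v \<noteq> 0\<^sub>v nc" "(M\<^sup>T * M) *\<^sub>v v = 0\<^sub>v nc"
    unfolding det_0_iff_vec_prod_zero_field[OF MM] by blast
  then show False using inj[OF v(1) sum_square_mult_mat_vec[OF M v(1,3)]] by blast
qed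

lemma det_nonzero_row_indep:
  fixes A :: "real mat"
  assumes A: "A \<in> carrier_mat m m" and d: "det A \<noteq> 0"
    and w: "\<And>b. b < m \<Longrightarrow> (\<Sum>a<m. w a * A $$ (a, b)) = 0" and a: "a < m"
  shows "w a = (0::real)"
proof -
  have "A\<^sup>T *\<^sub>v Matrix.vec m w = 0\<^sub>v m"
  proof (rule eq_vecI)
    fix b assume "b < dim_vec (0\<^sub>v m)"
    then show "vec_index (A\<^sup>T *\<^sub>v Matrix.vec m w) b = vec_index (0\<^sub>v m) b"
      using A w[of b] by (simp add: scalar_prod_def mult.commute atLeast0LessThan)
  qed (use A in auto)
  moreover have "det A\<^sup>T \<noteq> 0" using d det_transpose[OF A] by simp
  moreover have AT: "A\<^sup>T \<in> carrier_mat m m" using A by simp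
  ultimately have "Matrix.vec m w = 0\<^sub>v m"
    unfolding det_0_iff_vec_prod_zero_field[OF AT] using vec_carrier[of m w] by blast
  then show ?thesis using a index_vec[of a m w] index_zero_vec(1)[of a m] by simp
qed

lemma full_row_rank_iff:
  fixes M :: "real mat"
  assumes M: "M \<in> carrier_mat nr nc"
  shows "vec_space.rank nr M = nr \<longleftrightarrow>
    (\<forall>w. (\<forall>c<nc. (\<Sum>a<nr. w a * M $$ (a, c)) = 0) \<longrightarrow> (\<forall>a<nr. w a = 0))"
proof
  assume "vec_space.rank nr M = nr"
  then obtain f where "inj_on f {..<nr}" and f: "f ` {..<nr} \<subseteq> {..<nc}"
    "det (mat nr nr (\<lambda>(a, b). M $$ (a, f b))) \<noteq> 0"
    by (rule vec_space.full_rank_imp_minor[OF M])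
  show "\<forall>w. (\<forall>c<nc. (\<Sum>a<nr. w a * M $$ (a, c)) = 0) \<longrightarrow> (\<forall>a<nr. w a = 0)"
  proof (intro allI impI)
    fix w a assume w: "\<forall>c<nc. (\<Sum>a<nr. w a * M $$ (a, c)) = 0" and a: "a < nr"
    show "w a = 0"
      by (rule det_nonzero_row_indep[OF _ f(2) _ a]) (use w f(1) in auto)
  qed
next
  assume ind: "\<forall>w. (\<forall>c<nc. (\<Sum>a<nr. w a * M $$ (a, c)) = 0) \<longrightarrow> (\<forall>a<nr. w a = 0)"
  \<comment> \<open>The Gram matrix of the transpose is \<open>M * M\<^sup>T\<close>; once it is
    invertible, \<open>M\<^sup>T\<close> can play the role of \<open>B\<close> in
    \<open>full_rankI\<close>.\<close>
  have "det (M\<^sup>T\<^sup>T * M\<^sup>T) \<noteq> 0"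
  proof (rule det_gram_nonzero)
    fix v assume v: "v \<in> carrier_vec nr" and z: "M\<^sup>T *\<^sub>v v = 0\<^sub>v nc"
    have "(\<Sum>a<nr. vec_index v a * M $$ (a, c)) = 0" if "c < nc" for c
      using arg_cong[OF z, of "\<lambda>u. vec_index u c"] that M v
      by (simp add: scalar_prod_def mult.commute atLeast0LessThan)
    then have "\<forall>a<nr. vec_index v a = 0" using ind[rule_format, of "vec_index v"] by blast
    then show "v = 0\<^sub>v nr" using v by (intro eq_vecI) auto
  qed (use M in auto)
  then show "vec_space.rank nr M = nr"
    using vec_space.full_rankI[OF M, of "M\<^sup>T"] M by simp
qed

lemma row_indep_imp_minor:
  fixes M :: "nat \<Rightarrow> nat \<Rightarrow> real"
  assumes "\<And>w. (\<And>c. c < nc \<Longrightarrow> (\<Sum>a<nr. w a * M a c) = 0) \<Longrightarrow> \<forall>a<nr. w a = 0"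
  obtains f where "inj_on f {..<nr}" "f ` {..<nr} \<subseteq> {..<nc}"
    "det (mat nr nr (\<lambda>(a, b). M a (f b))) \<noteq> 0"
proof -
  let ?M = "mat nr nc (\<lambda>(a, c). M a c)"
  have M: "?M \<in> carrier_mat nr nc" by simp
  have "vec_space.rank nr ?M = nr"
    unfolding full_row_rank_iff[OF M]
  proof (intro allI impI)
    fix w a assume h: "\<forall>c<nc. (\<Sum>a<nr. w a * ?M $$ (a, c)) = 0" and a: "a < nr"
    have "(\<Sum>a<nr. w a * M a c) = 0" if "c < nc" for c using h that by simp
    from assms[OF this] show "w a = 0" using a by blast
  qed
  then obtain f where f: "inj_on f {..<nr}" "f ` {..<nr} \<subseteq> {..<nc}"
    "det (mat nr nr (\<lambda>(a, b). ?M $$ (a, f b))) \<noteq> 0"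
    by (rule vec_space.full_rank_imp_minor[OF M])
  moreover have "mat nr nr (\<lambda>(a, b). ?M $$ (a, f b)) = mat nr nr (\<lambda>(a, b). M a (f b))"
    using f(2) by (intro eq_matI) auto
  ultimately show thesis using that by simp
qed

section \<open>Projections onto column spaces\<close>

lemma mat_cancel_left:
  fixes A :: "'a::comm_ring_1 mat"
  assumes "A \<in> carrier_mat m k" "B \<in> carrier_mat k m" "Z \<in> carrier_mat m l" "A * B = 1\<^sub>m m"
  shows "A * (B * Z) = Z"
  using assoc_mult_mat[OF assms(1-3)] assms by simp

lemma mult_index_sum:
  assumes "A \<in> carrier_mat l m" "B \<in> carrier_mat m k" "i < l" "j < k"
  shows "(A * B) $$ (i, j) = (\<Sum>c<m. A $$ (i, c) * B $$ (c, j))"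
  using assms by (simp add: scalar_prod_def atLeast0LessThan)

lemma det_minv_nonzero:
  fixes A :: "real mat"
  assumes A: "A \<in> carrier_mat m m" and d: "det A \<noteq> 0"
  shows "det (minv A) \<noteq> 0"
proof -
  have "det A * det (minv A) = 1"
    using det_mult[OF A minv_mat(1)[OF A d]] minv_mat(2)[OF A d] by simp
  then show ?thesis by auto
qed

lemma invertible_mat_det:
  fixes A :: "real mat"
  assumes A: "A \<in> carrier_mat m m"
  shows "invertible_mat A \<longleftrightarrow> det A \<noteq> 0"
proof
  assume "invertible_mat A"
  then obtain B where B: "A * B = 1\<^sub>m m" "B * A = 1\<^sub>m (dim_row B)"
    using A by (auto simp: invertible_mat_def inverts_mat_def)
  have "dim_col B = m" using arg_cong[OF B(1), of dim_col] by simp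
  moreover have "dim_row B = m" using arg_cong[OF B(2), of dim_col] A by simp
  ultimately have "B \<in> carrier_mat m m" by auto
  then have "det A * det B = 1" using det_mult[OF A, of B] B(1) by simp
  then show "det A \<noteq> 0" by auto
next
  assume "det A \<noteq> 0"
  from minv_mat[OF A this] show "invertible_mat A"
    using A by (auto simp: invertible_mat_def inverts_mat_def intro!: exI[of _ "minv A"])
qed

lemma minv_minv:
  fixes A :: "real mat"
  assumes A: "A \<in> carrier_mat m m" and d: "det A \<noteq> 0"
  shows "minv (minv A) = A"
  by (rule minv_eqI[OF minv_mat(1)[OF A d] A minv_mat(3)[OF A d]])

lemma minv_mult:
  fixes A B :: "real mat"
  assumes A: "A \<in> carrier_mat m m" "det A \<noteq> 0"
    and B: "B \<in> carrier_mat m m" "det B \<noteq> 0"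
  shows "minv (A * B) = minv B * minv A"
proof (rule minv_eqI[of _ m])
  note iA = minv_mat[OF A] and iB = minv_mat[OF B]
  have "(A * B) * (minv B * minv A) = A * (B * (minv B * minv A))"
    using A B iA iB by (intro assoc_mult_mat) auto
  also have "B * (minv B * minv A) = minv A"
    using iA iB B by (intro mat_cancel_left) auto
  finally show "(A * B) * (minv B * minv A) = 1\<^sub>m m" using iA by simp
qed (use A B minv_mat(1)[OF A] minv_mat(1)[OF B] in auto)

lemma minv_transpose:
  fixes A :: "real mat"
  assumes A: "A \<in> carrier_mat m m" "det A \<noteq> 0"
  shows "minv (A\<^sup>T) = (minv A)\<^sup>T"
proof (rule minv_eqI[of _ m])
  have "A\<^sup>T * (minv A)\<^sup>T = (minv A * A)\<^sup>T"
    using A minv_mat(1)[OF A] by (simp add: transpose_mult)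
  then show "A\<^sup>T * (minv A)\<^sup>T = 1\<^sub>m m" using minv_mat(3)[OF A] by simp
qed (use A minv_mat(1)[OF A] in auto)

lemma minv_one: "minv (1\<^sub>m m) = (1\<^sub>m m :: real mat)"
  by (rule minv_eqI) auto

text \<open>Replacing the basis \<open>X\<close> by \<open>X B\<close> turns the Gram matrix
  \<open>H\<close> into \<open>B\<^sup>T H B\<close>, with inverse \<open>C G C\<^sup>T\<close>, and
  all factors \<open>B\<close> and \<open>C\<close> cancel: the projector depends on the column
  space only.\<close>

lemma projection_right_mult:
  fixes X B :: "real mat"
  assumes X: "X \<in> carrier_mat N m" and B: "B \<in> carrier_mat m m" and dB: "det B \<noteq> 0"
    and dH: "det (X\<^sup>T * X) \<noteq> 0"
  shows "(X * B) * minv ((X * B)\<^sup>T * (X * B)) * (X * B)\<^sup>T = X * minv (X\<^sup>T * X) * X\<^sup>T"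
proof -
  define H G C where "H = X\<^sup>T * X" and "G = minv H" and "C = minv B"
  define Z where "Z = G * C\<^sup>T"
  have H: "H \<in> carrier_mat m m" using X by (simp add: H_def)
  have G: "G \<in> carrier_mat m m" "H * G = 1\<^sub>m m" using minv_mat[OF H] dH by (auto simp: G_def H_def)
  have C: "C \<in> carrier_mat m m" "B * C = 1\<^sub>m m" "C * B = 1\<^sub>m m" using minv_mat[OF B dB] by (auto simp: C_def)
  have Z: "Z \<in> carrier_mat m m" using G C by (simp add: Z_def)
  have t: "(X * B)\<^sup>T = B\<^sup>T * X\<^sup>T" using X B by (rule transpose_mult)
  have BC: "B\<^sup>T * C\<^sup>T = 1\<^sub>m m" "C\<^sup>T * B\<^sup>T = 1\<^sub>m m"
    by (simp_all only: transpose_mult[OF C(1) B, symmetric] transpose_mult[OF B C(1), symmetric]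
        C(2,3) transpose_one)
  have gram: "(X * B)\<^sup>T * (X * B) = B\<^sup>T * (H * B)"
  proof -
    have "(B\<^sup>T * X\<^sup>T) * (X * B) = B\<^sup>T * (X\<^sup>T * (X * B))" using X B by (intro assoc_mult_mat) auto
    also have "X\<^sup>T * (X * B) = H * B" unfolding H_def using X B by (intro assoc_mult_mat[symmetric]) auto
    finally show ?thesis by (simp add: t)
  qed
  have "(B\<^sup>T * (H * B)) * (C * Z) = B\<^sup>T * ((H * B) * (C * Z))"
    using B H C Z by (intro assoc_mult_mat) auto
  also have "(H * B) * (C * Z) = H * (B * (C * Z))" using B H C Z by (intro assoc_mult_mat) auto
  also have "B * (C * Z) = Z" using B C Z by (intro mat_cancel_left) auto
  also have "H * Z = C\<^sup>T" unfolding Z_def using H G C by (intro mat_cancel_left) auto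
  finally have "minv ((X * B)\<^sup>T * (X * B)) = C * Z"
    unfolding gram using B H C Z BC by (intro minv_eqI[of _ m]) auto
  then have "(X * B) * minv ((X * B)\<^sup>T * (X * B)) = (X * B) * (C * Z)" by simp
  also have "\<dots> = X * (B * (C * Z))" using X B C Z by (intro assoc_mult_mat) auto
  also have "B * (C * Z) = Z" using B C Z by (intro mat_cancel_left) auto
  finally have "(X * B) * minv ((X * B)\<^sup>T * (X * B)) * (X * B)\<^sup>T = (X * Z) * (B\<^sup>T * X\<^sup>T)" by (simp add: t)
  also have "\<dots> = X * (Z * (B\<^sup>T * X\<^sup>T))" using X B Z by (intro assoc_mult_mat) auto
  also have "Z * (B\<^sup>T * X\<^sup>T) = G * (C\<^sup>T * (B\<^sup>T * X\<^sup>T))"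
    unfolding Z_def using G C B X by (intro assoc_mult_mat) auto
  also have "C\<^sup>T * (B\<^sup>T * X\<^sup>T) = X\<^sup>T" using C B X BC by (intro mat_cancel_left) auto
  also have "X * (G * X\<^sup>T) = X * G * X\<^sup>T" using X G by (intro assoc_mult_mat[symmetric]) auto
  finally show ?thesis by (simp add: G_def H_def)
qed

lemma det_gram_nonzero_rows:
  fixes X :: "real mat"
  assumes X: "X \<in> carrier_mat N m" and \<rho>: "\<And>a. a < m \<Longrightarrow> \<rho> a < N"
    and A: "det (mat m m (\<lambda>(a, b). X $$ (\<rho> b, a))) \<noteq> 0"
  shows "det (X\<^sup>T * X) \<noteq> 0"
proof (rule det_gram_nonzero[OF X])
  fix v assume v: "v \<in> carrier_vec m" and z: "X *\<^sub>v v = 0\<^sub>v N"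
  have "vec_index v a = 0" if "a < m" for a
  proof (rule det_nonzero_row_indep[OF _ A _ that])
    fix b assume b: "b < m"
    show "(\<Sum>a<m. vec_index v a * mat m m (\<lambda>(a, b). X $$ (\<rho> b, a)) $$ (a, b)) = 0"
      using arg_cong[OF z, of "\<lambda>u. vec_index u (\<rho> b)"] X v b \<rho>[OF b]
      by (simp add: scalar_prod_def mult.commute atLeast0LessThan)
  qed simp
  then show "v = 0\<^sub>v m" using v by (intro eq_vecI) auto
qed

text \<open>
  The orthogonal projector onto the column space of \<open>X\<close> determines the basis of that space whose
  rows \<open>\<rho>\<close> form the identity matrix.
\<close>

lemma projection_rows:
  fixes X :: "real mat" and \<rho> :: "nat \<Rightarrow> nat"
  defines "P \<equiv> 1\<^sub>m (dim_row X) - X * minv (X\<^sup>T * X) * X\<^sup>T"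
    and "A \<equiv> mat (dim_col X) (dim_col X) (\<lambda>(a, b). X $$ (\<rho> b, a))"
  assumes X: "X \<in> carrier_mat N m" and \<rho>: "\<And>a. a < m \<Longrightarrow> \<rho> a < N" "inj_on \<rho> {..<m}"
    and dH: "det (X\<^sup>T * X) \<noteq> 0"
  defines "Q \<equiv> mat m m (\<lambda>(a, b). (if a = b then 1 else 0) - P $$ (\<rho> a, \<rho> b))"
  shows "det Q \<noteq> 0 \<longleftrightarrow> det A \<noteq> 0"
    and "det A \<noteq> 0 \<Longrightarrow> p < N \<Longrightarrow> a < m \<Longrightarrow>
      (\<Sum>b<m. ((if p = \<rho> b then 1 else 0) - P $$ (p, \<rho> b)) * minv Q $$ (b, a)) =
      (\<Sum>c<m. minv A $$ (a, c) * X $$ (p, c))"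
proof -
  define G where "G = minv (X\<^sup>T * X)"
  have H: "X\<^sup>T * X \<in> carrier_mat m m" using X by simp
  have G: "G \<in> carrier_mat m m" using minv_mat(1)[OF H dH] by (simp add: G_def)
  have A: "A \<in> carrier_mat m m" using X by (simp add: A_def)
  have AT: "A\<^sup>T \<in> carrier_mat m m" using A by simp
  have GA: "G * A \<in> carrier_mat m m" using G A by simp
  have XGA: "X * (G * A) \<in> carrier_mat N m" using X GA by simp
  \<comment> \<open>The columns of \<open>X G X\<^sup>T\<close> at the selected positions are those
    of \<open>X G A\<close>, because \<open>A\<close> collects the selected rows of
    \<open>X\<close>, transposed.\<close>
  have key: "(if p = \<rho> b then 1 else 0) - P $$ (p, \<rho> b) = (X * (G * A)) $$ (p, b)"
    if p: "p < N" and b: "b < m" for p b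
  proof -
    have "(X * G * X\<^sup>T) $$ (p, \<rho> b) = (\<Sum>c<m. (X * G) $$ (p, c) * X\<^sup>T $$ (c, \<rho> b))"
      using X G p \<rho>(1)[OF b] by (intro mult_index_sum) auto
    also have "\<dots> = (\<Sum>c<m. (X * G) $$ (p, c) * A $$ (c, b))"
      using X b \<rho>(1)[OF b] by (intro sum.cong) (auto simp: A_def)
    also have "\<dots> = (X * G * A) $$ (p, b)"
      using X G A p b by (intro mult_index_sum[symmetric]) auto
    also have "X * G * A = X * (G * A)" using X G A by (rule assoc_mult_mat)
    finally show ?thesis using X G p \<rho>(1)[OF b] by (auto simp: P_def simp flip: G_def)
  qed
  have Q: "Q = A\<^sup>T * (G * A)"
  proof (rule eq_matI)
    fix a b assume "a < dim_row (A\<^sup>T * (G * A))" "b < dim_col (A\<^sup>T * (G * A))"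
    then have ab: "a < m" "b < m" using A by auto
    \<comment> \<open>Injectivity of \<open>\<rho>\<close> matters here: it turns the identity entry
      at \<open>(a, b)\<close> into the one at \<open>(\<rho> a, \<rho> b)\<close>.\<close>
    then have "Q $$ (a, b) = (if \<rho> a = \<rho> b then 1 else 0) - P $$ (\<rho> a, \<rho> b)"
      using \<rho>(2) by (auto simp: Q_def inj_on_def)
    also have "\<dots> = (X * (G * A)) $$ (\<rho> a, b)" by (rule key[OF \<rho>(1)[OF ab(1)] ab(2)])
    also have "\<dots> = (\<Sum>c<m. X $$ (\<rho> a, c) * (G * A) $$ (c, b))"
      by (rule mult_index_sum[OF X GA \<rho>(1)[OF ab(1)] ab(2)])
    also have "\<dots> = (\<Sum>c<m. A\<^sup>T $$ (a, c) * (G * A) $$ (c, b))"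
      using X ab by (intro sum.cong) (auto simp: A_def)
    also have "\<dots> = (A\<^sup>T * (G * A)) $$ (a, b)"
      by (rule mult_index_sum[OF AT GA ab, symmetric])
    finally show "Q $$ (a, b) = (A\<^sup>T * (G * A)) $$ (a, b)" .
  qed (use A in \<open>auto simp: Q_def\<close>)
  have dG: "det G \<noteq> 0" unfolding G_def by (rule det_minv_nonzero[OF H dH])
  have "det Q = det A * (det G * det A)"
    unfolding Q det_mult[OF AT GA] det_mult[OF G A] det_transpose[OF A] ..
  then show dQ: "det Q \<noteq> 0 \<longleftrightarrow> det A \<noteq> 0" using dG by auto
  assume dA: "det A \<noteq> 0" and p: "p < N" and a: "a < m"
  have Qc: "Q \<in> carrier_mat m m" by (simp add: Q_def)
  have dQ': "det Q \<noteq> 0" using dQ dA by simp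
  note iQ = minv_mat[OF Qc dQ'] and iA = minv_mat[OF A dA]
  have dAT: "det A\<^sup>T \<noteq> 0" using dA det_transpose[OF A] by simp
  note iAT = minv_mat[OF AT dAT]
  \<comment> \<open>Cancelling \<open>A\<^sup>T\<close> in \<open>Q = A\<^sup>T G A\<close> avoids
    inverting \<open>G\<close>: multiplied by the inverse of \<open>Q\<close>, the factor
    \<open>G A\<close> becomes the inverse of \<open>A\<^sup>T\<close>.\<close>
  have "minv A\<^sup>T * Q = G * A"
    unfolding Q using iAT AT GA by (intro mat_cancel_left) auto
  then have "(G * A) * minv Q = minv A\<^sup>T * Q * minv Q" by simp
  also have "\<dots> = minv A\<^sup>T * (Q * minv Q)" using iAT iQ Qc by (intro assoc_mult_mat) auto
  finally have GAQ: "(G * A) * minv Q = (minv A)\<^sup>T" using iQ iAT minv_transpose[OF A dA] by simp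
  have "(\<Sum>b<m. ((if p = \<rho> b then 1 else 0) - P $$ (p, \<rho> b)) * minv Q $$ (b, a)) =
      (\<Sum>b<m. (X * (G * A)) $$ (p, b) * minv Q $$ (b, a))"
    using key[OF p] by (intro sum.cong) auto
  also have "\<dots> = ((X * (G * A)) * minv Q) $$ (p, a)"
    by (rule mult_index_sum[OF XGA iQ(1) p a, symmetric])
  also have "(X * (G * A)) * minv Q = X * ((G * A) * minv Q)" by (rule assoc_mult_mat[OF X GA iQ(1)])
  also have "\<dots> = X * (minv A)\<^sup>T" by (simp add: GAQ)
  also have "\<dots> $$ (p, a) = (\<Sum>c<m. X $$ (p, c) * (minv A)\<^sup>T $$ (c, a))"
    using iA by (intro mult_index_sum[OF X _ p a]) auto
  also have "\<dots> = (\<Sum>c<m. minv A $$ (a, c) * X $$ (p, c))"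
    using iA a by (intro sum.cong) auto
  finally show "(\<Sum>b<m. ((if p = \<rho> b then 1 else 0) - P $$ (p, \<rho> b)) * minv Q $$ (b, a)) =
      (\<Sum>c<m. minv A $$ (a, c) * X $$ (p, c))" .
qed

lemma projection_symmetric:
  fixes X :: "real mat"
  assumes X: "X \<in> carrier_mat N m" and dH: "det (X\<^sup>T * X) \<noteq> 0"
  shows "(X * minv (X\<^sup>T * X) * X\<^sup>T)\<^sup>T = X * minv (X\<^sup>T * X) * X\<^sup>T"
proof -
  have H: "X\<^sup>T * X \<in> carrier_mat m m" using X by simp
  note G = minv_mat(1)[OF H dH]
  have "(X\<^sup>T * X)\<^sup>T = X\<^sup>T * X" using X by (simp add: transpose_mult[of _ m N])
  then have GT: "(minv (X\<^sup>T * X))\<^sup>T = minv (X\<^sup>T * X)" using minv_transpose[OF H dH] by simp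
  have XG: "X * minv (X\<^sup>T * X) \<in> carrier_mat N m" and XT: "X\<^sup>T \<in> carrier_mat m N" using X G by auto
  have "(X * minv (X\<^sup>T * X) * X\<^sup>T)\<^sup>T = X * (minv (X\<^sup>T * X) * X\<^sup>T)"
    unfolding transpose_mult[OF XG XT] transpose_mult[OF X G] GT by simp
  also have "\<dots> = X * minv (X\<^sup>T * X) * X\<^sup>T" by (rule assoc_mult_mat[OF X G XT, symmetric])
  finally show ?thesis .
qed

section \<open>Interface vectors\<close>

locale tt_format =
  fixes d :: nat and n r :: "nat \<Rightarrow> nat"
  assumes d2: "2 \<le> d" and n_pos: "\<And>k. k \<in> {1..d} \<Longrightarrow> 0 < n k"
    and r0: "r 0 = 1" and rd: "r d = 1"
begin

abbreviation "entry U k a i b \<equiv> lookup (U :: cores) (k, a, i, b)"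

definition core_idx :: "(nat \<times> nat \<times> nat \<times> nat) set" where
  "core_idx = {(k, a, i, b). k \<in> {1..d} \<and> a < r (k - 1) \<and> i < n k \<and> b < r k}"

lemma finite_core_idx: "finite core_idx"
proof (rule finite_subset)
  show "core_idx \<subseteq> {1..d} \<times> (\<Union>k\<in>{1..d}. {..<r (k - 1)}) \<times> (\<Union>k\<in>{1..d}. {..<n k}) \<times> (\<Union>k\<in>{1..d}. {..<r k})"
    by (auto simp: core_idx_def)
qed auto

lemma core_space_eq: "core_space d n r = coord_space core_idx"
  by (simp add: core_space_def core_idx_def)

text \<open>The row of the \<open>k\<close>-th interface matrix at \<open>i\<close>, indexed so that
  it involves the cores after \<open>k\<close>. At \<open>k = 0\<close> it is an entry of the tensor
  and at \<open>k = d\<close> the constant 1, so tensor and interfaces share one recursion.\<close>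

definition ivec :: "cores \<Rightarrow> nat \<Rightarrow> (nat \<Rightarrow> nat) \<Rightarrow> nat \<Rightarrow> real" where
  "ivec U k i b = slice_prod d r U (Suc k) i $$ (b, 0)"

lemma slice_carrier: "slice r U k i \<in> carrier_mat (r (k - 1)) (r k)"
  by (simp add: slice_def)

lemma slice_index: "a < r (k - 1) \<Longrightarrow> b < r k \<Longrightarrow> slice r U k i $$ (a, b) = entry U k a i b"
  by (simp add: slice_def)

lemma slice_prod_step:
  "k \<le> d \<Longrightarrow> slice_prod d r U k i = slice r U k (i k) * slice_prod d r U (Suc k) i"
  by (simp add: slice_prod_def upt_rec[of k])

lemma slice_prod_end: "slice_prod d r U (Suc d) i = 1\<^sub>m 1"
  by (simp add: slice_prod_def rd)

lemma slice_prod_carrier: "k \<le> d \<Longrightarrow> slice_prod d r U (Suc k) i \<in> carrier_mat (r k) 1"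
proof (induction k rule: inc_induct)
  case base
  show ?case by (simp add: slice_prod_end rd)
next
  case (step k)
  then show ?case using slice_carrier[of U "Suc k" "i (Suc k)"] by (simp add: slice_prod_step[of "Suc k"])
qed

lemma ivec_end: "ivec U d i 0 = 1"
  by (simp add: ivec_def slice_prod_end)

lemma ivec_step:
  assumes "k < d" "b < r k"
  shows "ivec U k i b = (\<Sum>c<r (Suc k). entry U (Suc k) b (i (Suc k)) c * ivec U (Suc k) i c)"
proof -
  have "ivec U k i b = (\<Sum>c<r (Suc k). slice r U (Suc k) (i (Suc k)) $$ (b, c) *
      slice_prod d r U (Suc (Suc k)) i $$ (c, 0))"
    unfolding ivec_def slice_prod_step[of "Suc k", OF Suc_leI[OF assms(1)]]
    using slice_carrier[of U "Suc k"] slice_prod_carrier[of "Suc k"] assms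
    by (intro mult_index_sum) auto
  also have "\<dots> = (\<Sum>c<r (Suc k). entry U (Suc k) b (i (Suc k)) c * ivec U (Suc k) i c)"
    using assms by (intro sum.cong) (auto simp: slice_index ivec_def)
  finally show ?thesis .
qed

lemma slice_prod_cong:
  assumes "\<And>j. j \<in> {k..d} \<Longrightarrow> i j = i' j"
  shows "slice_prod d r U k i = slice_prod d r U k i'"
  unfolding slice_prod_def using assms by (intro foldr_cong) auto

lemma ivec_cong: "(\<And>j. j \<in> {Suc k..d} \<Longrightarrow> i j = i' j) \<Longrightarrow> ivec U k i b = ivec U k i' b"
  unfolding ivec_def using slice_prod_cong[of "Suc k" i i' U] by simp

lemma tt_tensor_lookup:
  "i \<in> multi_indices d n 1 \<Longrightarrow> lookup (tt_tensor d n r U) i = ivec U 0 i 0"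
  by (simp add: tt_tensor_def lookup_tabulate finite_multi_indices ivec_def)

lemma interface_carrier: "interface d n r U k \<in> carrier_mat (tail_size d n k) (r k)"
  by (simp add: interface_def)

lemma row_number_less: "i \<in> multi_indices d n (Suc k) \<Longrightarrow> row_number d n k i < tail_size d n k"
  using bij_betwE[OF row_number_bij[of d n k]] by auto

lemma row_number_inj: "inj_on (row_number d n k) (multi_indices d n (Suc k))"
  using bij_betw_imp_inj_on[OF row_number_bij[of d n k]] by simp

lemma interface_index:
  assumes "i \<in> multi_indices d n (Suc k)" "b < r k"
  shows "interface d n r U k $$ (row_number d n k i, b) = ivec U k i b"
  using assms row_number_less[OF assms(1)] inv_into_f_f[OF row_number_inj assms(1)]
  by (simp add: interface_def ivec_def)

lemma row_number_surj:
  assumes "p < tail_size d n k" obtains i where "i \<in> multi_indices d n (Suc k)" "p = row_number d n k i"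
  using bij_betw_imp_surj_on[OF row_number_bij[of d n k]] assms by (auto simp: image_iff set_eq_iff)

section \<open>The gauge group\<close>

definition gauge_mats :: "(nat \<Rightarrow> real mat) \<Rightarrow> bool" where
  "gauge_mats A \<longleftrightarrow> A 0 = 1\<^sub>m 1 \<and> A d = 1\<^sub>m 1 \<and>
     (\<forall>k\<le>d. A k \<in> carrier_mat (r k) (r k) \<and> det (A k) \<noteq> 0)"

text \<open>A relation, as in the description of the orbits; \<open>gauge\<close> is its solution in
  the core space, unique by \<open>gauged_unique\<close>.\<close>

definition gauged :: "(nat \<Rightarrow> real mat) \<Rightarrow> cores \<Rightarrow> cores \<Rightarrow> bool" where
  "gauged A U V \<longleftrightarrow> (\<forall>k\<in>{1..d}. \<forall>i<n k. slice r V k i = minv (A (k - 1)) * slice r U k i * A k)"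

definition gauge :: "(nat \<Rightarrow> real mat) \<Rightarrow> cores \<Rightarrow> cores" where
  "gauge A U = tabulate core_idx (\<lambda>(k, a, i, b). (minv (A (k - 1)) * slice r U k i * A k) $$ (a, b))"

lemma gauge_matsD:
  assumes "gauge_mats A" "k \<le> d"
  shows "A k \<in> carrier_mat (r k) (r k)" "det (A k) \<noteq> 0"
    "minv (A k) \<in> carrier_mat (r k) (r k)" "A k * minv (A k) = 1\<^sub>m (r k)" "minv (A k) * A k = 1\<^sub>m (r k)"
  using assms minv_mat[of "A k" "r k"] by (auto simp: gauge_mats_def)

lemma gauge_mats_minv:
  assumes "gauge_mats A" shows "gauge_mats (\<lambda>k. minv (A k))"
  unfolding gauge_mats_def
proof (intro conjI allI impI)
  show "minv (A 0) = 1\<^sub>m 1" "minv (A d) = 1\<^sub>m 1"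
    using assms by (simp_all add: gauge_mats_def minv_one)
  fix k assume k: "k \<le> d"
  show "minv (A k) \<in> carrier_mat (r k) (r k)" by (rule gauge_matsD(3)[OF assms k])
  show "det (minv (A k)) \<noteq> 0" by (rule det_minv_nonzero[OF gauge_matsD(1,2)[OF assms k]])
qed

lemma gauge_in: "gauge A U \<in> core_space d n r"
  unfolding core_space_eq gauge_def by (rule tabulate_in[OF finite_core_idx])

lemma slice_eqI:
  assumes "M \<in> carrier_mat (r (k - 1)) (r k)"
    and "\<And>a b. a < r (k - 1) \<Longrightarrow> b < r k \<Longrightarrow> entry U k a i b = M $$ (a, b)"
  shows "slice r U k i = M"
  using assms by (intro eq_matI) (auto simp: slice_def)

lemma gauge_gauged:
  assumes "gauge_mats A" shows "gauged A U (gauge A U)"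
  unfolding gauged_def
proof (intro ballI allI impI slice_eqI)
  fix k i assume k: "k \<in> {1..d}" "i < n k"
  then have k': "k \<le> d" "k - 1 \<le> d" by auto
  show "minv (A (k - 1)) * slice r U k i * A k \<in> carrier_mat (r (k - 1)) (r k)"
    by (intro mult_carrier_mat[OF mult_carrier_mat[OF gauge_matsD(3)[OF assms k'(2)] slice_carrier]]
        gauge_matsD(1)[OF assms k'(1)])
  fix a b assume "a < r (k - 1)" "b < r k"
  then have "(k, a, i, b) \<in> core_idx" using k by (simp add: core_idx_def)
  then show "entry (gauge A U) k a i b = (minv (A (k - 1)) * slice r U k i * A k) $$ (a, b)"
    by (simp add: gauge_def lookup_tabulate finite_core_idx)
qed

lemma gauged_unique:
  assumes "gauged A U V" "V \<in> core_space d n r" shows "V = gauge A U"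
proof (rule poly_mapping_eqI)
  fix s :: "nat \<times> nat \<times> nat \<times> nat"
  obtain k a i b where s: "s = (k, a, i, b)" by (cases s)
  show "lookup V s = lookup (gauge A U) s"
  proof (cases "s \<in> core_idx")
    case True
    then have "k \<in> {1..d}" "a < r (k - 1)" "i < n k" "b < r k" by (auto simp: s core_idx_def)
    then show ?thesis using assms(1) True slice_index[of a k b V i]
      by (simp add: gauged_def gauge_def lookup_tabulate finite_core_idx s)
  next
    case False
    then have "lookup V s = 0"
      using assms(2) unfolding core_space_eq coord_space_iff by blast
    then show ?thesis using False by (simp add: gauge_def lookup_tabulate finite_core_idx)
  qed
qed

lemma gauged_inverse:
  assumes A: "gauge_mats A" and g: "gauged A U V"
  shows "gauged (\<lambda>k. minv (A k)) V U"
  unfolding gauged_def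
proof (intro ballI allI impI)
  fix k i assume k: "k \<in> {1..d}" "i < n k"
  then have k': "k \<le> d" "k - 1 \<le> d" by auto
  note D = gauge_matsD[OF A k'(1)] and D' = gauge_matsD[OF A k'(2)]
  note S = slice_carrier[of U k i]
  have "A (k - 1) * (minv (A (k - 1)) * slice r U k i * A k) * minv (A k) = slice r U k i"
  proof -
    have 1: "minv (A (k - 1)) * slice r U k i * A k = minv (A (k - 1)) * (slice r U k i * A k)"
      by (rule assoc_mult_mat[OF D'(3) S D(1)])
    have 2: "A (k - 1) * (minv (A (k - 1)) * (slice r U k i * A k)) = slice r U k i * A k"
      using D D' S by (intro mat_cancel_left) auto
    have "slice r U k i * A k * minv (A k) = slice r U k i * (A k * minv (A k))"
      by (rule assoc_mult_mat[OF S D(1,3)])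
    then show ?thesis unfolding 1 2 using D S by simp
  qed
  then show "slice r U k i = minv (minv (A (k - 1))) * slice r V k i * minv (A k)"
    using g k minv_minv[OF D'(1,2)] by (simp add: gauged_def)
qed

text \<open>Each inner \<open>A j\<close> meets its inverse and cancels. At the right end
  \<open>A d\<close> is trivial, so only the inverse of \<open>A k\<close> survives, on the
  left.\<close>

lemma slice_prod_gauged:
  assumes A: "gauge_mats A" and g: "gauged A U V" and k: "k \<le> d"
    and i: "\<And>j. j \<in> {Suc k..d} \<Longrightarrow> i j < n j"
  shows "slice_prod d r V (Suc k) i = minv (A k) * slice_prod d r U (Suc k) i"
  using k i
proof (induction k rule: inc_induct)
  case base
  have "A d = 1\<^sub>m 1" using A by (simp add: gauge_mats_def)
  then show ?case by (simp add: slice_prod_end minv_one)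
next
  case (step k)
  then have k: "Suc k \<le> d" "k \<le> d" by auto
  note D = gauge_matsD[OF A k(1)] and D' = gauge_matsD[OF A k(2)]
  let ?S = "slice r U (Suc k) (i (Suc k))" and ?P = "slice_prod d r U (Suc (Suc k)) i"
  have S: "?S \<in> carrier_mat (r k) (r (Suc k))" using slice_carrier[of U "Suc k"] by simp
  have P: "?P \<in> carrier_mat (r (Suc k)) 1" by (rule slice_prod_carrier[OF k(1)])
  have "slice_prod d r V (Suc k) i = (minv (A k) * ?S * A (Suc k)) * (minv (A (Suc k)) * ?P)"
    using g k step by (simp add: slice_prod_step[of "Suc k"] gauged_def)
  also have "\<dots> = (minv (A k) * ?S) * (A (Suc k) * (minv (A (Suc k)) * ?P))"
    using D D' S P by (intro assoc_mult_mat) auto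
  also have "A (Suc k) * (minv (A (Suc k)) * ?P) = ?P"
    using D P by (intro mat_cancel_left) auto
  also have "(minv (A k) * ?S) * ?P = minv (A k) * (?S * ?P)" by (rule assoc_mult_mat[OF D'(3) S P])
  also have "?S * ?P = slice_prod d r U (Suc k) i" using k by (simp add: slice_prod_step[of "Suc k"])
  finally show ?case .
qed

lemma ivec_gauged:
  assumes A: "gauge_mats A" and g: "gauged A U V" and k: "k \<le> d" and b: "b < r k"
    and i: "i \<in> multi_indices d n (Suc k)"
  shows "ivec V k i b = (\<Sum>c<r k. minv (A k) $$ (b, c) * ivec U k i c)"
proof -
  have "slice_prod d r V (Suc k) i = minv (A k) * slice_prod d r U (Suc k) i"
    using i by (intro slice_prod_gauged[OF A g k]) (auto simp: multi_indices_def)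
  then show ?thesis
    unfolding ivec_def using mult_index_sum[OF gauge_matsD(3)[OF A k] slice_prod_carrier[OF k] b, of 0] by simp
qed

lemma tensor_gauged:
  assumes A: "gauge_mats A" and g: "gauged A U V"
  shows "tt_tensor d n r V = tt_tensor d n r U"
proof -
  have "ivec V 0 i 0 = ivec U 0 i 0" if "i \<in> multi_indices d n 1" for i
    using ivec_gauged[OF A g, of 0 0 i] that A r0 by (simp add: gauge_mats_def minv_one)
  then show ?thesis
    unfolding tt_tensor_def by (intro tabulate_cong finite_multi_indices) (simp add: ivec_def)
qed

text \<open>The gauge acts on tail products from the left, but these form the rows of the interface
  matrix, hence the transposed factor on the right.\<close>

lemma interface_gauged:
  assumes A: "gauge_mats A" and g: "gauged A U V" and k: "k \<le> d"
  shows "interface d n r V k = interface d n r U k * (minv (A k))\<^sup>T"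
proof (rule eq_matI)
  note D = gauge_matsD[OF A k]
  fix p b assume "p < dim_row (interface d n r U k * (minv (A k))\<^sup>T)" "b < dim_col (interface d n r U k * (minv (A k))\<^sup>T)"
  then have pb: "p < tail_size d n k" "b < r k" using interface_carrier[of U k] D by auto
  obtain i where i: "i \<in> multi_indices d n (Suc k)" "p = row_number d n k i"
    using row_number_surj[OF pb(1)] by blast
  have "(interface d n r U k * (minv (A k))\<^sup>T) $$ (p, b) =
      (\<Sum>c<r k. interface d n r U k $$ (p, c) * (minv (A k))\<^sup>T $$ (c, b))"
    using D interface_carrier pb by (intro mult_index_sum) auto
  also have "\<dots> = (\<Sum>c<r k. minv (A k) $$ (b, c) * ivec U k i c)"
    using D pb i by (intro sum.cong) (auto simp: interface_index)
  finally show "interface d n r V k $$ (p, b) = (interface d n r U k * (minv (A k))\<^sup>T) $$ (p, b)"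
    using ivec_gauged[OF A g k pb(2) i(1)] interface_index[OF i(1) pb(2), of V] i(2) by simp
qed (use interface_carrier gauge_matsD[OF A k] in \<open>auto simp: interface_def\<close>)

lemma interface_proj_gauged:
  assumes A: "gauge_mats A" and g: "gauged A U V" and k: "k \<le> d"
    and gram: "det ((interface d n r U k)\<^sup>T * interface d n r U k) \<noteq> 0"
  shows "interface_proj d n r V k = interface_proj d n r U k"
proof -
  note D = gauge_matsD[OF A k]
  have 1: "(minv (A k))\<^sup>T \<in> carrier_mat (r k) (r k)" using D by simp
  have 2: "det ((minv (A k))\<^sup>T) \<noteq> 0"
    using det_transpose[OF D(3)] det_minv_nonzero[OF D(1,2)] by simp
  show ?thesis
    unfolding interface_proj_def Let_def interface_gauged[OF A g k]
      projection_right_mult[OF interface_carrier 1 2 gram] ..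
qed

section \<open>Column selections\<close>

text \<open>
  For \<open>1 \<le> k < d\<close>, the columns \<open>J k 0, \<dots>, J k (r k - 1)\<close> of the right unfolding of core \<open>k + 1\<close>
  are selected; a column is a pair of a mode index and a rank index. Composing the selections gives
  the nested multi-indices \<open>mi J k a\<close>, which number rows of the \<open>k\<close>-th interface matrix.
\<close>

type_synonym selection = "nat \<Rightarrow> nat \<Rightarrow> nat \<times> nat"

definition valid_sel :: "selection \<Rightarrow> bool" where
  "valid_sel J \<longleftrightarrow> (\<forall>k\<in>{1..<d}. inj_on (J k) {..<r k} \<and>
     (\<forall>a<r k. fst (J k a) < n (Suc k) \<and> snd (J k a) < r (Suc k)))"

text \<open>The recursion runs on the number of cores behind level \<open>k\<close>: at
  \<open>Suc e\<close> the level is \<open>k = d - Suc e\<close>, and the new index belongs to core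
  \<open>k + 1 = d - e\<close>. The value \<open>undefined\<close> elsewhere makes the result
  extensional, as \<open>multi_indices\<close> demands.\<close>

primrec mi_aux :: "selection \<Rightarrow> nat \<Rightarrow> nat \<Rightarrow> nat \<Rightarrow> nat" where
  "mi_aux J 0 a = (\<lambda>_. undefined)"
| "mi_aux J (Suc e) a = (mi_aux J e (snd (J (d - Suc e) a)))(d - e := fst (J (d - Suc e) a))"

definition mi :: "selection \<Rightarrow> nat \<Rightarrow> nat \<Rightarrow> nat \<Rightarrow> nat" where
  "mi J k = mi_aux J (d - k)"

lemma mi_end: "mi J d a = (\<lambda>_. undefined)"
  by (simp add: mi_def)

lemma mi_step:
  assumes "k < d" shows "mi J k a = (mi J (Suc k) (snd (J k a)))(Suc k := fst (J k a))"
proof -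
  have "d - k = Suc (d - Suc k)" "d - Suc (d - Suc k) = k" "d - (d - Suc k) = Suc k" using assms by auto
  then show ?thesis by (simp add: mi_def)
qed

lemma multi_indices_upd:
  assumes "k \<in> {1..d}" "i \<in> multi_indices d n (Suc k)" "j < n k"
  shows "i(k := j) \<in> multi_indices d n k"
  using assms by (auto simp: multi_indices_def PiE_iff extensional_def)

text \<open>Position \<open>k\<close> lies outside the domain of \<open>i\<close> and
  \<open>i'\<close>, where both are \<open>undefined\<close>, so overwriting it loses no
  information.\<close>

lemma multi_indices_upd_inj:
  assumes "i \<in> multi_indices d n (Suc k)" "i' \<in> multi_indices d n (Suc k)" "i(k := j) = i'(k := j')"
  shows "i = i' \<and> j = j'"
proof -
  have "i k = undefined" "i' k = undefined" using assms(1,2) by (auto simp: multi_indices_def PiE_iff extensional_def)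
  moreover have "j = j'" using fun_cong[OF assms(3), of k] by simp
  moreover have "i l = i' l" if "l \<noteq> k" for l using fun_cong[OF assms(3), of l] that by simp
  ultimately show ?thesis by (metis ext)
qed

lemma mi_in:
  assumes J: "valid_sel J"
  shows "k \<le> d \<Longrightarrow> 1 \<le> k \<Longrightarrow> a < r k \<Longrightarrow> mi J k a \<in> multi_indices d n (Suc k)"
proof (induction k arbitrary: a rule: inc_induct)
  case base
  show ?case by (simp add: mi_end multi_indices_def PiE_def extensional_def)
next
  case (step k)
  then have "fst (J k a) < n (Suc k)" "snd (J k a) < r (Suc k)" using J by (auto simp: valid_sel_def)
  then show ?case unfolding mi_step[OF step.hyps(2)] using step by (intro multi_indices_upd) auto
qed

text \<open>The leading mode index and the tail can be recovered from the multi-index. By induction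
  the tail determines the rank index, and a valid selection repeats no pair.\<close>

lemma mi_inj:
  assumes J: "valid_sel J"
  shows "k \<le> d \<Longrightarrow> 1 \<le> k \<Longrightarrow> inj_on (mi J k) {..<r k}"
proof (induction k rule: inc_induct)
  case base
  show ?case by (auto simp: rd intro: inj_onI)
next
  case (step k)
  have k: "k \<in> {1..<d}" using step by auto
  show ?case
  proof (rule inj_onI)
    fix a a' assume a: "a \<in> {..<r k}" "a' \<in> {..<r k}" "mi J k a = mi J k a'"
    have s: "snd (J k a) < r (Suc k)" "snd (J k a') < r (Suc k)" using J k a by (auto simp: valid_sel_def)
    have "mi J (Suc k) (snd (J k a)) = mi J (Suc k) (snd (J k a')) \<and> fst (J k a) = fst (J k a')"
      using a(3) k mi_in[OF J, of "Suc k"] s by (intro multi_indices_upd_inj) (auto simp: mi_step)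
    then have "J k a = J k a'" using step s by (auto simp: prod_eq_iff inj_on_def)
    then show "a = a'" using J k a by (auto simp: valid_sel_def inj_on_def)
  qed
qed

text \<open>The rows at level \<open>k\<close> depend on the levels from \<open>k\<close> on only,
  so a selection can be extended to a lower level without disturbing the blocks already
  chosen.\<close>

lemma mi_cong: "k \<le> d \<Longrightarrow> (\<And>l. k \<le> l \<Longrightarrow> J l = J' l) \<Longrightarrow> mi J k a = mi J' k a"
proof (induction k arbitrary: a rule: inc_induct)
  case base
  show ?case by (simp add: mi_end)
next
  case (step k)
  then show ?case by (simp add: mi_step)
qed

definition ri :: "selection \<Rightarrow> nat \<Rightarrow> nat \<Rightarrow> nat" where
  "ri J k a = row_number d n k (mi J k a)"

lemma ri_less: "valid_sel J \<Longrightarrow> k \<in> {1..<d} \<Longrightarrow> a < r k \<Longrightarrow> ri J k a < tail_size d n k"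
  unfolding ri_def by (intro row_number_less mi_in) auto

lemma ri_inj: "valid_sel J \<Longrightarrow> k \<in> {1..<d} \<Longrightarrow> inj_on (ri J k) {..<r k}"
  unfolding ri_def using comp_inj_on[OF mi_inj inj_on_subset[OF row_number_inj], of J k k] mi_in[of J k]
  by (force simp: comp_def)

text \<open>The selected rows of the interface matrix, transposed.\<close>

definition amat :: "selection \<Rightarrow> cores \<Rightarrow> nat \<Rightarrow> real mat" where
  "amat J U k = (if k = 0 then 1\<^sub>m 1 else mat (r k) (r k) (\<lambda>(a, b). ivec U k (mi J k b) a))"

definition good :: "selection \<Rightarrow> cores \<Rightarrow> bool" where
  "good J U \<longleftrightarrow> (\<forall>k\<in>{1..<d}. det (amat J U k) \<noteq> 0)"

lemma amat_carrier: "amat J U k \<in> carrier_mat (r k) (r k)"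
  by (simp add: amat_def r0)

lemma amat_d: "amat J U d = 1\<^sub>m 1"
  using d2 by (intro eq_matI) (auto simp: amat_def rd ivec_end)

lemma gauge_mats_amat:
  assumes "good J U" shows "gauge_mats (amat J U)"
  unfolding gauge_mats_def
proof (intro conjI allI impI amat_carrier amat_d)
  show "amat J U 0 = 1\<^sub>m 1" by (simp add: amat_def)
  fix k assume "k \<le> d"
  then consider "k = 0" | "k = d" | "k \<in> {1..<d}" by force
  then show "det (amat J U k) \<noteq> 0"
  proof cases
    case 1 then show ?thesis by (simp add: amat_def)
  next
    case 2 then show ?thesis by (simp add: amat_d)
  next
    case 3 then show ?thesis using assms by (simp add: good_def)
  qed
qed

lemma ivec_upd:
  assumes "1 \<le> k" "k \<le> d" "a < r (k - 1)" "b < r k"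
  shows "ivec U (k - 1) ((mi J k b)(k := i)) a = (\<Sum>c<r k. entry U k a i c * amat J U k $$ (c, b))"
proof -
  have "ivec U (k - 1) ((mi J k b)(k := i)) a =
      (\<Sum>c<r k. entry U k a i c * ivec U k ((mi J k b)(k := i)) c)"
    using ivec_step[of "k - 1" a U "(mi J k b)(k := i)"] assms by simp
  also have "\<dots> = (\<Sum>c<r k. entry U k a i c * amat J U k $$ (c, b))"
    using assms ivec_cong[of k "(mi J k b)(k := i)" "mi J k b" U]
    by (intro sum.cong) (auto simp: amat_def)
  finally show ?thesis .
qed

lemma slice_amat_index:
  assumes "1 \<le> k" "k \<le> d" "a < r (k - 1)" "b < r k"
  shows "(slice r U k i * amat J U k) $$ (a, b) = ivec U (k - 1) ((mi J k b)(k := i)) a"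
  unfolding ivec_upd[OF assms]
  using mult_index_sum[OF slice_carrier amat_carrier assms(3,4)] assms slice_index[of a k] by simp

text \<open>The selected columns of the multiplied slices \<open>U_k(i) A_k\<close> are the columns
  of \<open>A_(k-1)\<close>. Multiplying by the inverse of \<open>A_(k-1)\<close> therefore turns
  them into the identity matrix.\<close>

lemma amat_step:
  assumes J: "valid_sel J" and k: "2 \<le> k" "k \<le> d" and ab: "a < r (k - 1)" "b < r (k - 1)"
  shows "amat J U (k - 1) $$ (a, b) = (slice r U k (fst (J (k - 1) b)) * amat J U k) $$ (a, snd (J (k - 1) b))"
proof -
  have s: "snd (J (k - 1) b) < r k" using J k ab by (auto simp: valid_sel_def dest!: bspec[of _ _ "k - 1"])
  have "mi J (k - 1) b = (mi J k (snd (J (k - 1) b)))(k := fst (J (k - 1) b))"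
    using mi_step[of "k - 1" J b] k by simp
  then have "(slice r U k (fst (J (k - 1) b)) * amat J U k) $$ (a, snd (J (k - 1) b)) =
      ivec U (k - 1) (mi J (k - 1) b) a"
    using slice_amat_index[OF _ k(2) ab(1) s, where U = U and J = J and i = "fst (J (k - 1) b)"] k(1) by simp
  then show ?thesis using k ab by (simp add: amat_def)
qed

lemma amat_cong: "k \<le> d \<Longrightarrow> (\<And>l. k \<le> l \<Longrightarrow> J l = J' l) \<Longrightarrow> amat J U k = amat J' U k"
  using mi_cong[of k J J'] by (intro eq_matI) (auto simp: amat_def)

lemma amat_step_sum:
  assumes J: "valid_sel J" and k: "2 \<le> k" "k \<le> d" and ab: "a < r (k - 1)" "b < r (k - 1)"
  shows "amat J U (k - 1) $$ (a, b) =
    (\<Sum>c<r k. entry U k a (fst (J (k - 1) b)) c * amat J U k $$ (c, snd (J (k - 1) b)))"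
proof -
  have s: "snd (J (k - 1) b) < r k" using J k ab by (auto simp: valid_sel_def dest!: bspec[of _ _ "k - 1"])
  show ?thesis
    unfolding amat_step[OF assms] mult_index_sum[OF slice_carrier amat_carrier ab(1) s]
    using ab by (intro sum.cong) (simp_all add: slice_index)
qed

lemma valid_selD:
  assumes "valid_sel J" "2 \<le> k" "k \<le> d"
  shows "inj_on (J (k - 1)) {..<r (k - 1)}"
    "a < r (k - 1) \<Longrightarrow> fst (J (k - 1) a) < n k" "a < r (k - 1) \<Longrightarrow> snd (J (k - 1) a) < r k"
  using assms by (auto simp: valid_sel_def dest!: bspec[of _ _ "k - 1"])

text \<open>Full row rank as independence of rows, which removes the numbering of the columns: mode
  index \<open>i\<close> and rank index \<open>b\<close> belong to column
  \<open>i + n k * b\<close>.\<close>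

lemma tt_params_iff:
  "U \<in> tt_params d n r \<longleftrightarrow> U \<in> core_space d n r \<and>
    (\<forall>k\<in>{2..d}. \<forall>w. (\<forall>i<n k. \<forall>b<r k. (\<Sum>a<r (k - 1). w a * entry U k a i b) = 0) \<longrightarrow>
      (\<forall>a<r (k - 1). w a = 0))"
proof -
  have "vec_space.rank (r (k - 1)) (right_unfolding n r U k) = r (k - 1) \<longleftrightarrow>
     (\<forall>w. (\<forall>i<n k. \<forall>b<r k. (\<Sum>a<r (k - 1). w a * entry U k a i b) = 0) \<longrightarrow> (\<forall>a<r (k - 1). w a = 0))"
    if k: "k \<in> {2..d}" for k
  proof -
    have R: "right_unfolding n r U k \<in> carrier_mat (r (k - 1)) (n k * r k)"
      by (simp add: right_unfolding_def)
    have nk: "0 < n k" using k n_pos[of k] by auto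
    have "(\<forall>c<n k * r k. (\<Sum>a<r (k - 1). w a * right_unfolding n r U k $$ (a, c)) = 0) \<longleftrightarrow>
        (\<forall>i<n k. \<forall>b<r k. (\<Sum>a<r (k - 1). w a * entry U k a i b) = 0)" for w
    proof (intro iffI allI impI)
      fix i b assume h: "\<forall>c<n k * r k. (\<Sum>a<r (k - 1). w a * right_unfolding n r U k $$ (a, c)) = 0"
        and i: "i < n k" and b: "b < r k"
      have "i + n k * b < n k * Suc b" using i by simp
      also have "\<dots> \<le> n k * r k" using b by (intro mult_le_mono2) simp
      finally have c: "i + n k * b < n k * r k" .
      show "(\<Sum>a<r (k - 1). w a * entry U k a i b) = 0"
        using h[rule_format, OF c] c i by (simp add: right_unfolding_def)
    next
      fix c assume h: "\<forall>i<n k. \<forall>b<r k. (\<Sum>a<r (k - 1). w a * entry U k a i b) = 0" and c: "c < n k * r k"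
      have "c div n k < r k" using c by (simp add: less_mult_imp_div_less mult.commute)
      then show "(\<Sum>a<r (k - 1). w a * right_unfolding n r U k $$ (a, c)) = 0"
        using h nk c by (simp add: right_unfolding_def)
    qed
    then show ?thesis unfolding full_row_rank_iff[OF R] by simp
  qed
  then show ?thesis by (simp add: tt_params_def)
qed

text \<open>A linear relation between the rows of core \<open>k\<close>, summed against columns of
  \<open>A_k\<close>, becomes a relation between the rows of \<open>A_(k-1)\<close>, which is
  invertible.\<close>

lemma good_imp_params:
  assumes J: "valid_sel J" and U: "U \<in> core_space d n r" and g: "good J U"
  shows "U \<in> tt_params d n r"
  unfolding tt_params_iff
proof (intro conjI ballI allI impI U)
  fix k w a
  assume k: "k \<in> {2..d}" and w: "\<forall>i<n k. \<forall>b<r k. (\<Sum>a<r (k - 1). w a * entry U k a i b) = 0"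
    and a: "a < r (k - 1)"
  then have k': "2 \<le> k" "k \<le> d" by auto
  have det: "det (amat J U (k - 1)) \<noteq> 0"
    using gauge_matsD(2)[OF gauge_mats_amat[OF g], of "k - 1"] k' by simp
  show "w a = 0"
  proof (rule det_nonzero_row_indep[OF amat_carrier det _ a])
    fix b assume b: "b < r (k - 1)"
    let ?i = "fst (J (k - 1) b)" and ?b = "snd (J (k - 1) b)"
    have "(\<Sum>a<r (k - 1). w a * amat J U (k - 1) $$ (a, b)) =
        (\<Sum>a<r (k - 1). \<Sum>c<r k. w a * entry U k a ?i c * amat J U k $$ (c, ?b))"
      using amat_step_sum[OF J k' _ b, of _ U] by (simp add: sum_distrib_left mult.assoc)
    also have "\<dots> = (\<Sum>c<r k. (\<Sum>a<r (k - 1). w a * entry U k a ?i c) * amat J U k $$ (c, ?b))"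
      by (subst sum.swap) (simp add: sum_distrib_right)
    also have "\<dots> = 0" using w valid_selD(2)[OF J k' b] by (intro sum.neutral) auto
    finally show "(\<Sum>a<r (k - 1). w a * amat J U (k - 1) $$ (a, b)) = 0" .
  qed
qed

text \<open>Levels are chosen from the last core backwards. As \<open>A_(k+1)\<close> is already
  invertible, multiplying the slices of core \<open>k + 1\<close> by it keeps the rows independent,
  and \<open>r k\<close> columns of the product then form an invertible \<open>A_k\<close>.\<close>

lemma params_imp_good:
  assumes U: "U \<in> tt_params d n r" obtains J where "valid_sel J" "good J U"
proof -
  let ?P = "\<lambda>J l. det (amat J U l) \<noteq> 0 \<and>
      inj_on (J l) {..<r l} \<and> (\<forall>a<r l. fst (J l a) < n (Suc l) \<and> snd (J l a) < r (Suc l))"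
  have "k \<le> d \<Longrightarrow> 1 \<le> k \<Longrightarrow> \<exists>J. \<forall>l\<in>{k..<d}. ?P J l" for k
  proof (induction k rule: inc_induct)
    case base
    show ?case by simp
  next
    case (step k)
    then have "\<exists>J. \<forall>l\<in>{Suc k..<d}. ?P J l" by simp
    then obtain J where J0: "\<forall>l\<in>{Suc k..<d}. ?P J l" by (elim exE)
    note J = bspec[OF J0]
    have k: "Suc k \<in> {2..d}" using step by auto
    have det: "det (amat J U (Suc k)) \<noteq> 0"
    proof (cases "Suc k = d")
      case True
      then show ?thesis by (simp add: amat_d)
    next
      case False
      then show ?thesis using J[of "Suc k"] k by auto
    qed
    let ?n = "n (Suc k)" and ?A = "amat J U (Suc k)"
    \<comment> \<open>The right unfolding of core \<open>k + 1\<close> after multiplying each slice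
      by \<open>?A\<close>; column \<open>c\<close> stands for mode index \<open>c mod ?n\<close>
      and rank index \<open>c div ?n\<close>.\<close>
    define M where "M = (\<lambda>a c. \<Sum>e<r (Suc k). entry U (Suc k) a (c mod ?n) e * ?A $$ (e, c div ?n))"
    have n0: "0 < ?n" using n_pos[of "Suc k"] k by auto
    obtain f where f: "inj_on f {..<r k}" "f ` {..<r k} \<subseteq> {..<?n * r (Suc k)}"
      "det (mat (r k) (r k) (\<lambda>(a, b). M a (f b))) \<noteq> 0"
    proof (rule row_indep_imp_minor[where nc = "?n * r (Suc k)" and nr = "r k" and M = M])
      fix w assume w: "\<And>c. c < ?n * r (Suc k) \<Longrightarrow> (\<Sum>a<r k. w a * M a c) = 0"
      have "(\<Sum>a<r k. w a * entry U (Suc k) a i e) = 0" if i: "i < ?n" and e: "e < r (Suc k)" for i e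
      proof (rule det_nonzero_row_indep[OF amat_carrier det _ e])
        fix b assume b: "b < r (Suc k)"
        have "i + ?n * b < ?n * Suc b" using i by simp
        also have "\<dots> \<le> ?n * r (Suc k)" using b by (intro mult_le_mono2) simp
        finally have c: "i + ?n * b < ?n * r (Suc k)" .
        have "(\<Sum>e<r (Suc k). (\<Sum>a<r k. w a * entry U (Suc k) a i e) * ?A $$ (e, b)) =
            (\<Sum>a<r k. \<Sum>e<r (Suc k). w a * entry U (Suc k) a i e * ?A $$ (e, b))"
          by (subst sum.swap) (simp add: sum_distrib_right)
        also have "\<dots> = (\<Sum>a<r k. w a * M a (i + ?n * b))"
          using i by (simp add: M_def sum_distrib_left mult.assoc)
        finally show "(\<Sum>e<r (Suc k). (\<Sum>a<r k. w a * entry U (Suc k) a i e) * ?A $$ (e, b)) = 0"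
          using w[OF c] by simp
      qed
      then have "\<forall>i<?n. \<forall>b<r (Suc k). (\<Sum>a<r (Suc k - 1). w a * entry U (Suc k) a i b) = 0" by simp
      from mp[OF spec[OF bspec[OF conjunct2[OF U[unfolded tt_params_iff]] k]] this]
      show "\<forall>a<r k. w a = 0" by simp
    qed
    define J' where "J' = J(k := \<lambda>a. (f a mod ?n, f a div ?n))"
    have J'J: "J' l = J l" if "Suc k \<le> l" for l using that by (simp add: J'_def)
    have amat': "amat J' U l = amat J U l" if "Suc k \<le> l" "l \<le> d" for l
      by (rule amat_cong[OF that(2)]) (use that J'J in auto)
    have bnd: "fst (J' k a) < ?n \<and> snd (J' k a) < r (Suc k)" if "a < r k" for a
    proof -
      have "f a < ?n * r (Suc k)" using f(2) that by auto
      then show ?thesis using n0 by (simp add: J'_def less_mult_imp_div_less mult.commute)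
    qed
    have injk: "inj_on (J' k) {..<r k}"
    proof (rule inj_onI)
      fix a b assume ab: "a \<in> {..<r k}" "b \<in> {..<r k}" "J' k a = J' k b"
      then have "f a mod ?n = f b mod ?n" "f a div ?n = f b div ?n" by (auto simp: J'_def)
      then have "f a = f b" by (metis div_mult_mod_eq)
      then show "a = b" using f(1) ab by (auto simp: inj_on_def)
    qed
    have amatk: "amat J' U k = mat (r k) (r k) (\<lambda>(a, b). M a (f b))"
    proof (rule eq_matI)
      fix a b assume "a < dim_row (mat (r k) (r k) (\<lambda>(a, b). M a (f b)))" "b < dim_col (mat (r k) (r k) (\<lambda>(a, b). M a (f b)))"
      then have ab: "a < r k" "b < r k" by auto
      have "amat J' U k $$ (a, b) = ivec U k ((mi J' (Suc k) (snd (J' k b)))(Suc k := fst (J' k b))) a"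
        using ab step mi_step[of k J' b] by (simp add: amat_def)
      also have "\<dots> = (\<Sum>e<r (Suc k). entry U (Suc k) a (fst (J' k b)) e * amat J' U (Suc k) $$ (e, snd (J' k b)))"
        using ivec_upd[of "Suc k" a "snd (J' k b)" U J'] ab bnd step by simp
      also have "\<dots> = M a (f b)"
        using amat'[of "Suc k"] k by (simp add: M_def J'_def)
      finally show "amat J' U k $$ (a, b) = mat (r k) (r k) (\<lambda>(a, b). M a (f b)) $$ (a, b)" using ab by simp
    qed (use amat_carrier[of J' U k] in auto)
    have "?P J' l" if "l \<in> {k..<d}" for l
    proof (cases "l = k")
      case True
      then show ?thesis using injk amatk f(3) bnd by simp
    next
      case False
      then have "l \<in> {Suc k..<d}" using that by auto
      then show ?thesis using J[of l] amat'[of l] J'J[of l] by simp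
    qed
    then show ?case by blast
  qed
  from this[of 1] obtain J where "\<forall>l\<in>{1..<d}. ?P J l"
    using d2 by auto
  then show thesis using that[of J] by (auto simp: valid_sel_def good_def)
qed

section \<open>The desingularisation map\<close>

definition ttF :: "cores \<Rightarrow> tt_point" where
  "ttF U = (tt_tensor d n r U, tabulate (proj_indices d n) (\<lambda>(k, a, b). interface_proj d n r U k $$ (a, b)))"

lemma tt_manifold_eq: "tt_manifold d n r = ttF ` tt_params d n r"
  by (auto simp: tt_manifold_def ttF_def)

lemma interface_ri:
  assumes "valid_sel J" "k \<in> {1..<d}"
  shows "mat (r k) (r k) (\<lambda>(a, b). interface d n r U k $$ (ri J k b, a)) = amat J U k"
  using assms mi_in[OF assms(1), of k] interface_index[of _ k _ U]
  by (intro eq_matI) (auto simp: amat_def ri_def)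

text \<open>Some selected block of the interface matrix is invertible, so its kernel is trivial; the
  inverse in \<open>interface_proj\<close> is then a true one.\<close>

lemma gram_nonzero:
  assumes U: "U \<in> tt_params d n r" and k: "k \<in> {1..<d}"
  shows "det ((interface d n r U k)\<^sup>T * interface d n r U k) \<noteq> 0"
proof -
  obtain J where J: "valid_sel J" "good J U" using params_imp_good[OF U] .
  show ?thesis
  proof (rule det_gram_nonzero_rows[OF interface_carrier ri_less[OF J(1) k]])
    show "det (mat (r k) (r k) (\<lambda>(a, b). interface d n r U k $$ (ri J k b, a))) \<noteq> 0"
      unfolding interface_ri[OF J(1) k] using J(2) k by (simp add: good_def)
  qed
qed

lemma ttF_gauged:
  assumes A: "gauge_mats A" and g: "gauged A U V" and U: "U \<in> tt_params d n r"
  shows "ttF V = ttF U"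
proof -
  have "interface_proj d n r V k = interface_proj d n r U k" if "k \<in> {1..<d}" for k
    using that by (intro interface_proj_gauged[OF A g] gram_nonzero[OF U]) auto
  then have "tabulate (proj_indices d n) (\<lambda>(k, a, b). interface_proj d n r V k $$ (a, b)) =
      tabulate (proj_indices d n) (\<lambda>(k, a, b). interface_proj d n r U k $$ (a, b))"
    by (intro tabulate_cong[OF finite_proj_indices]) (auto simp: proj_indices_def)
  then show ?thesis unfolding ttF_def tensor_gauged[OF A g] by simp
qed

lemma amat_gauged:
  assumes A: "gauge_mats A" and g: "gauged A U V" and J: "valid_sel J" and k: "k \<in> {1..<d}"
  shows "amat J V k = minv (A k) * amat J U k"
proof (rule eq_matI)
  have D: "minv (A k) \<in> carrier_mat (r k) (r k)" using gauge_matsD(3)[OF A, of k] k by simp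
  fix a b assume "a < dim_row (minv (A k) * amat J U k)" "b < dim_col (minv (A k) * amat J U k)"
  then have ab: "a < r k" "b < r k" using D amat_carrier[of J U k] by auto
  have "ivec V k (mi J k b) a = (\<Sum>c<r k. minv (A k) $$ (a, c) * ivec U k (mi J k b) c)"
    using k ab by (intro ivec_gauged[OF A g] mi_in[OF J]) auto
  then show "amat J V k $$ (a, b) = (minv (A k) * amat J U k) $$ (a, b)"
    unfolding mult_index_sum[OF D amat_carrier ab] using ab k by (simp add: amat_def)
qed (use gauge_matsD(3)[OF A, of k] k amat_carrier[of J U k] amat_carrier[of J V k] in auto)

text \<open>A gauge transformation multiplies each block by an invertible matrix, so being good for
  \<open>J\<close> is a property of the whole orbit.\<close>

lemma good_gauged:
  assumes A: "gauge_mats A" and g: "gauged A U V" and J: "valid_sel J" and U: "good J U"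
  shows "good J V"
  unfolding good_def
proof
  fix k assume k: "k \<in> {1..<d}"
  note D = gauge_matsD[OF A, of k]
  have k': "k \<le> d" using k by simp
  have "det (amat J V k) = det (minv (A k)) * det (amat J U k)"
    unfolding amat_gauged[OF A g J k] by (rule det_mult[OF D(3)[OF k'] amat_carrier])
  then show "det (amat J V k) \<noteq> 0"
    using det_minv_nonzero[OF D(1)[OF k'] D(2)[OF k']] U k by (simp add: good_def)
qed

lemma params_gauged:
  assumes A: "gauge_mats A" and g: "gauged A U V" and U: "U \<in> tt_params d n r" and V: "V \<in> core_space d n r"
  shows "V \<in> tt_params d n r"
proof -
  obtain J where J: "valid_sel J" "good J U" using params_imp_good[OF U] .
  show ?thesis by (rule good_imp_params[OF J(1) V good_gauged[OF A g J]])
qed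

section \<open>Charts\<close>

text \<open>The block \<open>Q(S,S)\<close> of \<open>Q = I - P_k\<close>. It is defined at every
  point of the ambient space, because the slice charts need it on a neighbourhood of the
  image.\<close>

definition qsub :: "selection \<Rightarrow> tt_point \<Rightarrow> nat \<Rightarrow> real mat" where
  "qsub J y k = mat (r k) (r k) (\<lambda>(a, b). (if a = b then 1 else 0) - lookup (snd y) (k, ri J k a, ri J k b))"

definition row_of :: "selection \<Rightarrow> nat \<Rightarrow> nat \<Rightarrow> nat \<Rightarrow> nat" where
  "row_of J k i b = row_number d n (k - 1) ((mi J k b)(k := i))"

text \<open>Core 1 has no gauge factor on its left, so all of its entries remain free.\<close>

definition free :: "selection \<Rightarrow> (nat \<times> nat \<times> nat \<times> nat) set" where
  "free J = {(k, a, i, b). k \<in> {1..d} \<and> a < r (k - 1) \<and> i < n k \<and> b < r k \<and>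
     (2 \<le> k \<longrightarrow> (i, b) \<notin> J (k - 1) ` {..<r (k - 1)})}"

text \<open>Entries of the point itself, hence linear functions. For a free index with
  \<open>k \<ge> 2\<close> the position pairs an unselected row with a selected one.\<close>

fun slc :: "selection \<Rightarrow> nat \<times> nat \<times> nat \<times> nat \<Rightarrow> tt_point \<Rightarrow> real" where
  "slc J (k, a, i, b) y = (if k = 1 then lookup (fst y) ((mi J 1 b)(1 := i))
     else lookup (snd y) (k - 1, row_of J k i b, ri J (k - 1) a))"

text \<open>An entry of \<open>Q(:,S) Q(S,S)\<^sup>-\<^sup>1\<close> in the row
  \<open>row_of J k i b\<close>. For free indices this row is unselected, so the identity
  contributes nothing to \<open>Q = I - P\<close> and only a minus sign remains.\<close>

fun chart :: "selection \<Rightarrow> tt_point \<Rightarrow> nat \<times> nat \<times> nat \<times> nat \<Rightarrow> real" where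
  "chart J y (k, a, i, b) = (if k = 1 then slc J (k, a, i, b) y
     else - (\<Sum>c<r (k - 1). slc J (k, c, i, b) y * minv (qsub J y (k - 1)) $$ (c, a)))"

text \<open>Solves the same relation the other way: the normalised entries \<open>w\<close> and
  \<open>Q(S,S)\<close> give back the slice coordinates. The point \<open>y\<close> enters only
  through \<open>Q(S,S)\<close>.\<close>

fun unchart :: "selection \<Rightarrow> (nat \<times> nat \<times> nat \<times> nat \<Rightarrow> real) \<Rightarrow> tt_point \<Rightarrow> nat \<times> nat \<times> nat \<times> nat \<Rightarrow> real" where
  "unchart J w y (k, a, i, b) = (if k = 1 then w (k, a, i, b)
     else - (\<Sum>c<r (k - 1). w (k, c, i, b) * qsub J y (k - 1) $$ (c, a)))"

text \<open>The normal form with free entries \<open>w\<close>: the \<open>a\<close>-th selected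
  column of a core is the \<open>a\<close>-th unit vector.\<close>

definition core_of :: "selection \<Rightarrow> (nat \<times> nat \<times> nat \<times> nat \<Rightarrow> real) \<Rightarrow> cores" where
  "core_of J w = tabulate core_idx (\<lambda>(k, a, i, b). if (k, a, i, b) \<in> free J then w (k, a, i, b)
     else if J (k - 1) a = (i, b) then 1 else 0)"

definition norm_cores :: "selection \<Rightarrow> cores \<Rightarrow> cores" where
  "norm_cores J U = gauge (amat J U) U"

lemma qsub_carrier: "qsub J y k \<in> carrier_mat (r k) (r k)"
  by (simp add: qsub_def)

lemma free_subset: "free J \<subseteq> core_idx"
  by (auto simp: free_def core_idx_def)

lemma finite_free: "finite (free J)"
  by (rule finite_subset[OF free_subset finite_core_idx])

lemma proj_lookup:
  assumes "k \<in> {1..<d}" "p < tail_size d n k" "q < tail_size d n k"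
  shows "lookup (snd (ttF U)) (k, p, q) = interface_proj d n r U k $$ (p, q)"
proof -
  have "(k, p, q) \<in> proj_indices d n" using assms by (simp add: proj_indices_def)
  then show ?thesis by (simp add: ttF_def lookup_tabulate finite_proj_indices)
qed

lemma qsub_ttF:
  assumes J: "valid_sel J" and U: "U \<in> tt_params d n r" and k: "k \<in> {1..<d}"
  shows "det (qsub J (ttF U) k) \<noteq> 0 \<longleftrightarrow> det (amat J U k) \<noteq> 0"
    and "det (amat J U k) \<noteq> 0 \<Longrightarrow> p < tail_size d n k \<Longrightarrow> a < r k \<Longrightarrow>
      (\<Sum>b<r k. ((if p = ri J k b then 1 else 0) - lookup (snd (ttF U)) (k, p, ri J k b)) *
        minv (qsub J (ttF U) k) $$ (b, a)) =
      (\<Sum>c<r k. minv (amat J U k) $$ (a, c) * interface d n r U k $$ (p, c))"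
proof -
  let ?X = "interface d n r U k"
  have dims: "dim_row ?X = tail_size d n k" "dim_col ?X = r k" by (auto simp: interface_def)
  have P: "1\<^sub>m (tail_size d n k) - ?X * minv (?X\<^sup>T * ?X) * ?X\<^sup>T = interface_proj d n r U k"
    by (simp add: interface_proj_def Let_def)
  have Q: "mat (r k) (r k) (\<lambda>(a, b). (if a = b then 1 else 0) -
      interface_proj d n r U k $$ (ri J k a, ri J k b)) = qsub J (ttF U) k"
    unfolding qsub_def by (intro eq_matI) (auto simp: proj_lookup[OF k] ri_less[OF J k])
  note pr = projection_rows[OF interface_carrier ri_less[OF J k] ri_inj[OF J k] gram_nonzero[OF U k],
      unfolded P Q dims interface_ri[OF J k]]
  show "det (qsub J (ttF U) k) \<noteq> 0 \<longleftrightarrow> det (amat J U k) \<noteq> 0"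
    by (rule pr(1))
  assume *: "det (amat J U k) \<noteq> 0" "p < tail_size d n k" "a < r k"
  have "(\<Sum>b<r k. ((if p = ri J k b then 1 else 0) - lookup (snd (ttF U)) (k, p, ri J k b)) *
        minv (qsub J (ttF U) k) $$ (b, a)) =
      (\<Sum>b<r k. ((if p = ri J k b then 1 else 0) - interface_proj d n r U k $$ (p, ri J k b)) *
        minv (qsub J (ttF U) k) $$ (b, a))"
    by (intro sum.cong) (auto simp: proj_lookup[OF k *(2)] ri_less[OF J k])
  also have "\<dots> = (\<Sum>c<r k. minv (amat J U k) $$ (a, c) * ?X $$ (p, c))"
    by (rule pr(2)[OF _ *])
  finally show "(\<Sum>b<r k. ((if p = ri J k b then 1 else 0) - lookup (snd (ttF U)) (k, p, ri J k b)) *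
        minv (qsub J (ttF U) k) $$ (b, a)) =
      (\<Sum>c<r k. minv (amat J U k) $$ (a, c) * ?X $$ (p, c))" .
qed

lemma freeD:
  assumes "(k, a, i, b) \<in> free J"
  shows "1 \<le> k" "k \<le> d" "a < r (k - 1)" "i < n k" "b < r k" "2 \<le> k \<Longrightarrow> c < r (k - 1) \<Longrightarrow> J (k - 1) c \<noteq> (i, b)"
    "c < r (k - 1) \<Longrightarrow> (k, c, i, b) \<in> free J"
proof -
  show "J (k - 1) c \<noteq> (i, b)" if "2 \<le> k" "c < r (k - 1)"
  proof
    assume "J (k - 1) c = (i, b)"
    moreover have "J (k - 1) c \<in> J (k - 1) ` {..<r (k - 1)}" using that(2) by (intro imageI) simp
    ultimately show False using assms that(1) by (simp add: free_def)
  qed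
qed (use assms in \<open>auto simp: free_def\<close>)

lemma upd_in:
  assumes "valid_sel J" "1 \<le> k" "k \<le> d" "i < n k" "b < r k"
  shows "(mi J k b)(k := i) \<in> multi_indices d n k"
  using assms by (intro multi_indices_upd mi_in) auto

lemma row_of_less:
  assumes "valid_sel J" "2 \<le> k" "k \<le> d" "i < n k" "b < r k"
  shows "row_of J k i b < tail_size d n (k - 1)"
  unfolding row_of_def using upd_in[OF assms(1) _ assms(3-5)] assms(2)
  by (intro row_number_less) auto

lemma row_of_inj:
  assumes "valid_sel J" "2 \<le> k" "k \<le> d" "i < n k" "b < r k" "i' < n k" "b' < r k"
    and "row_of J k i b = row_of J k i' b'"
  shows "i = i' \<and> b = b'"
proof -
  have k: "Suc (k - 1) = k" "1 \<le> k" using assms(2) by auto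
  have "(mi J k b)(k := i) = (mi J k b')(k := i')"
  proof (rule inj_onD[OF row_number_inj[of "k - 1"]])
    show "row_number d n (k - 1) ((mi J k b)(k := i)) = row_number d n (k - 1) ((mi J k b')(k := i'))"
      using assms(8) by (simp add: row_of_def)
  qed (use upd_in[OF assms(1) k(2) assms(3)] assms(4-7) k(1) in simp_all)
  from multi_indices_upd_inj[OF _ _ this] show ?thesis
    using mi_in[OF assms(1,3) k(2)] mi_inj[OF assms(1,3) k(2)] assms(5,7) by (auto simp: inj_on_def)
qed

lemma ri_eq_row_of:
  assumes "2 \<le> k" "k \<le> d"
  shows "ri J (k - 1) c = row_of J k (fst (J (k - 1) c)) (snd (J (k - 1) c))"
  using mi_step[of "k - 1" J c] assms by (simp add: ri_def row_of_def)

text \<open>A row number determines its leading pair, and the pair of a free entry is not selected.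
  Both the formula for \<open>chart\<close> and the independence of \<open>Q(S,S)\<close> from the
  slice coordinates rest on this.\<close>

lemma row_of_not_ri:
  assumes J: "valid_sel J" and t: "(k, a, i, b) \<in> free J" and k: "2 \<le> k" and c: "c < r (k - 1)"
  shows "row_of J k i b \<noteq> ri J (k - 1) c"
proof
  assume eq: "row_of J k i b = ri J (k - 1) c"
  note f = freeD[OF t]
  have "i = fst (J (k - 1) c) \<and> b = snd (J (k - 1) c)"
    using eq ri_eq_row_of[OF k f(2)] valid_selD(2,3)[OF J k f(2) c] f
    by (intro row_of_inj[OF J k f(2)]) auto
  then show False using f(6)[OF k c] by (simp add: prod_eq_iff)
qed

lemma norm_cores_entry:
  assumes "1 \<le> k" "k \<le> d" "a < r (k - 1)" "i < n k" "b < r k" and g: "good J U"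
  shows "entry (norm_cores J U) k a i b =
    (\<Sum>c<r (k - 1). minv (amat J U (k - 1)) $$ (a, c) * (slice r U k i * amat J U k) $$ (c, b))"
proof -
  have D: "minv (amat J U (k - 1)) \<in> carrier_mat (r (k - 1)) (r (k - 1))"
    using gauge_matsD(3)[OF gauge_mats_amat[OF g], of "k - 1"] assms by simp
  have SA: "slice r U k i * amat J U k \<in> carrier_mat (r (k - 1)) (r k)"
    using slice_carrier amat_carrier by (rule mult_carrier_mat)
  have mem: "(k, a, i, b) \<in> core_idx" using assms by (simp add: core_idx_def)
  have "entry (norm_cores J U) k a i b = (minv (amat J U (k - 1)) * slice r U k i * amat J U k) $$ (a, b)"
    using mem by (simp add: norm_cores_def gauge_def lookup_tabulate finite_core_idx)
  also have "minv (amat J U (k - 1)) * slice r U k i * amat J U k =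
      minv (amat J U (k - 1)) * (slice r U k i * amat J U k)"
    by (rule assoc_mult_mat[OF D slice_carrier amat_carrier])
  finally show ?thesis unfolding mult_index_sum[OF D SA assms(3,5)] .
qed

lemma chart_ttF:
  assumes J: "valid_sel J" and U: "U \<in> tt_params d n r" and g: "good J U" and t: "t \<in> free J"
  shows "chart J (ttF U) t = lookup (norm_cores J U) t"
proof -
  obtain k a i b where teq: "t = (k, a, i, b)" by (cases t)
  note f = freeD[OF t[unfolded teq]]
  show ?thesis
  proof (cases "k = 1")
    case True
    have a: "a = 0" using f(3) True r0 by simp
    have "(mi J 1 b)(1 := i) \<in> multi_indices d n 1"
      using upd_in[OF J f(1,2,4,5)] unfolding True .
    then have "chart J (ttF U) t = ivec U 0 ((mi J 1 b)(1 := i)) 0"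
      using True tt_tensor_lookup[of "(mi J 1 b)(1 := i)" U] by (simp add: teq ttF_def)
    moreover have "entry (norm_cores J U) k a i b = (slice r U 1 i * amat J U 1) $$ (0, b)"
      using norm_cores_entry[OF f(1-5) g] True a by (simp add: r0 amat_def[of J U 0] minv_one)
    moreover have "(slice r U 1 i * amat J U 1) $$ (0, b) = ivec U 0 ((mi J 1 b)(1 := i)) 0"
      using slice_amat_index[of 1 0 b U i J] f True d2 r0 by simp
    ultimately show ?thesis by (simp add: teq)
  next
    case False
    then have k: "2 \<le> k" "k - 1 \<in> {1..<d}" using f(1,2) by auto
    note nr = row_of_not_ri[OF J t[unfolded teq] k(1)]
    have lt: "row_of J k i b < tail_size d n (k - 1)" by (rule row_of_less[OF J k(1) f(2,4,5)])
    have det: "det (amat J U (k - 1)) \<noteq> 0" using g k by (simp add: good_def)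
    \<comment> \<open>The identity term is zero in an unselected row; it is inserted to reach the
      form of \<open>qsub_ttF\<close>.\<close>
    have "chart J (ttF U) t = (\<Sum>c<r (k - 1). ((if row_of J k i b = ri J (k - 1) c then 1 else 0) -
        lookup (snd (ttF U)) (k - 1, row_of J k i b, ri J (k - 1) c)) *
        minv (qsub J (ttF U) (k - 1)) $$ (c, a))"
      using False nr by (simp add: teq sum_negf)
    also have "\<dots> = (\<Sum>c<r (k - 1). minv (amat J U (k - 1)) $$ (a, c) * interface d n r U (k - 1) $$ (row_of J k i b, c))"
      by (rule qsub_ttF(2)[OF J U k(2) det lt f(3)])
    also have "\<dots> = (\<Sum>c<r (k - 1). minv (amat J U (k - 1)) $$ (a, c) * (slice r U k i * amat J U k) $$ (c, b))"
    proof (intro sum.cong refl)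
      fix c assume "c \<in> {..<r (k - 1)}"
      then have c: "c < r (k - 1)" by simp
      have "interface d n r U (k - 1) $$ (row_of J k i b, c) = ivec U (k - 1) ((mi J k b)(k := i)) c"
        unfolding row_of_def using upd_in[OF J f(1,2,4,5)] k c by (intro interface_index) auto
      then show "minv (amat J U (k - 1)) $$ (a, c) * interface d n r U (k - 1) $$ (row_of J k i b, c) =
          minv (amat J U (k - 1)) $$ (a, c) * (slice r U k i * amat J U k) $$ (c, b)"
        using slice_amat_index[OF f(1,2) c f(5)] by simp
    qed
    finally show ?thesis using norm_cores_entry[OF f(1-5) g] by (simp add: teq)
  qed
qed

lemma core_of_cong: "(\<And>t. t \<in> free J \<Longrightarrow> w t = w' t) \<Longrightarrow> core_of J w = core_of J w'"
  unfolding core_of_def by (intro tabulate_cong finite_core_idx) auto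

lemma core_of_in: "core_of J w \<in> core_space d n r"
  unfolding core_space_eq core_of_def by (rule tabulate_in[OF finite_core_idx])

lemma entry_core_of:
  "(k, a, i, b) \<in> core_idx \<Longrightarrow> entry (core_of J w) k a i b =
     (if (k, a, i, b) \<in> free J then w (k, a, i, b) else if J (k - 1) a = (i, b) then 1 else 0)"
  by (simp add: core_of_def lookup_tabulate finite_core_idx)

text \<open>By \<open>amat_step\<close> the selected columns of the normalised core are those of
  \<open>A_(k-1)\<^sup>-\<^sup>1 A_(k-1)\<close>, the identity; all other entries are free.\<close>

lemma norm_cores_eq:
  assumes J: "valid_sel J" and g: "good J U"
  shows "norm_cores J U = core_of J (lookup (norm_cores J U))"
proof (rule poly_mapping_eqI)
  fix t :: "nat \<times> nat \<times> nat \<times> nat"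
  obtain k a i b where teq: "t = (k, a, i, b)" by (cases t)
  show "lookup (norm_cores J U) t = lookup (core_of J (lookup (norm_cores J U))) t"
  proof (cases "t \<in> core_idx \<and> t \<notin> free J")
    case False
    then show ?thesis
      using entry_core_of[of k a i b J] core_of_in gauge_in[of "amat J U" U]
      unfolding core_space_eq coord_space_iff norm_cores_def teq by metis
  next
    case True
    then have c: "1 \<le> k" "k \<le> d" "a < r (k - 1)" "i < n k" "b < r k" by (auto simp: core_idx_def teq)
    obtain a' where k: "2 \<le> k" and a': "a' < r (k - 1)" "J (k - 1) a' = (i, b)"
      using True c by (auto simp: teq free_def)
    have D: "minv (amat J U (k - 1)) \<in> carrier_mat (r (k - 1)) (r (k - 1))"
      "minv (amat J U (k - 1)) * amat J U (k - 1) = 1\<^sub>m (r (k - 1))"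
      using gauge_matsD(3,5)[OF gauge_mats_amat[OF g], of "k - 1"] c by simp_all
    have "entry (norm_cores J U) k a i b =
        (\<Sum>c<r (k - 1). minv (amat J U (k - 1)) $$ (a, c) * amat J U (k - 1) $$ (c, a'))"
      unfolding norm_cores_entry[OF c g]
      using amat_step[OF J k c(2) _ a'(1), of _ U] a'(2) by (intro sum.cong) auto
    also have "\<dots> = (1\<^sub>m (r (k - 1)) :: real mat) $$ (a, a')"
      unfolding mult_index_sum[OF D(1) amat_carrier c(3) a'(1), symmetric] D(2) ..
    also have "\<dots> = (if J (k - 1) a = (i, b) then 1 else 0)"
      using c(3) a' valid_selD(1)[OF J k c(2)] by (auto simp: inj_on_def)
    finally show ?thesis using True entry_core_of[of k a i b J] by (simp add: teq)
  qed
qed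

text \<open>Backwards induction: if \<open>A_(k+1)\<close> is the identity, then \<open>A_k\<close>
  consists of the selected columns of core \<open>k + 1\<close> themselves, which are unit vectors.
  So every choice of \<open>w\<close> gives a good tuple.\<close>

lemma amat_core_of:
  assumes J: "valid_sel J"
  shows "k \<le> d \<Longrightarrow> 1 \<le> k \<Longrightarrow> amat J (core_of J w) k = 1\<^sub>m (r k)"
proof (induction k rule: inc_induct)
  case base
  show ?case by (simp add: amat_d rd)
next
  case (step k)
  then have k: "2 \<le> Suc k" "Suc k \<le> d" by auto
  show ?case
  proof (rule eq_matI)
    fix a b assume "a < dim_row (1\<^sub>m (r k) :: real mat)" "b < dim_col (1\<^sub>m (r k) :: real mat)"
    then have ab: "a < r k" "b < r k" by auto
    obtain i e where ie: "J k b = (i, e)" by (cases "J k b")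
    then have b: "i < n (Suc k)" "e < r (Suc k)" using valid_selD(2,3)[OF J k, of b] ab by auto
    have "amat J (core_of J w) k $$ (a, b) =
        (\<Sum>c<r (Suc k). entry (core_of J w) (Suc k) a i c * (1\<^sub>m (r (Suc k)) :: real mat) $$ (c, e))"
      using amat_step_sum[OF J k, of a b "core_of J w"] ab ie step by simp
    also have "\<dots> = (\<Sum>c<r (Suc k). if c = e then entry (core_of J w) (Suc k) a i c else 0)"
      using b by (intro sum.cong) auto
    also have "\<dots> = entry (core_of J w) (Suc k) a i e" using b by simp
    finally have "amat J (core_of J w) k $$ (a, b) = entry (core_of J w) (Suc k) a i e" .
    moreover have "(Suc k, a, i, e) \<in> core_idx" using ab b k by (simp add: core_idx_def)
    moreover have "(Suc k, a, i, e) \<notin> free J"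
      using freeD(6)[of "Suc k" a i e J b] ab ie k by auto
    ultimately have "amat J (core_of J w) k $$ (a, b) = (if J k a = J k b then 1 else 0)"
      using ie by (simp add: entry_core_of)
    also have "\<dots> = (1\<^sub>m (r k) :: real mat) $$ (a, b)"
      using ab valid_selD(1)[OF J k] by (auto simp: inj_on_def)
    finally show "amat J (core_of J w) k $$ (a, b) = (1\<^sub>m (r k) :: real mat) $$ (a, b)" .
  qed (use amat_carrier[of J "core_of J w" k] in auto)
qed

lemma good_core_of: "valid_sel J \<Longrightarrow> good J (core_of J w)"
  unfolding good_def using amat_core_of[of J _ w] by auto

lemma core_of_params: "valid_sel J \<Longrightarrow> core_of J w \<in> tt_params d n r"
  by (rule good_imp_params[OF _ core_of_in good_core_of])

lemma norm_core_of:
  assumes J: "valid_sel J" shows "norm_cores J (core_of J w) = core_of J w"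
proof -
  have *: "amat J (core_of J w) k = 1\<^sub>m (r k)" if "k \<le> d" for k
    using amat_core_of[OF J that] by (cases "k = 0") (auto simp: amat_def r0)
  have "gauged (amat J (core_of J w)) (core_of J w) (core_of J w)"
    unfolding gauged_def
  proof (intro ballI allI impI)
    fix k i assume "k \<in> {1..d}"
    then have k': "k \<le> d" "k - 1 \<le> d" by auto
    have "1\<^sub>m (r (k - 1)) * slice r (core_of J w) k i * 1\<^sub>m (r k) = slice r (core_of J w) k i"
      by (simp only: left_mult_one_mat[OF slice_carrier] right_mult_one_mat[OF slice_carrier])
    then show "slice r (core_of J w) k i = minv (amat J (core_of J w) (k - 1)) *
        slice r (core_of J w) k i * amat J (core_of J w) k"
      unfolding *[OF k'(1)] *[OF k'(2)] minv_one by (rule sym)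
  qed
  from gauged_unique[OF this core_of_in] show ?thesis by (simp add: norm_cores_def)
qed

lemma chart_core_of: "valid_sel J \<Longrightarrow> t \<in> free J \<Longrightarrow> chart J (ttF (core_of J w)) t = w t"
  using chart_ttF[OF _ core_of_params good_core_of, of J t w] free_subset[of J]
  by (cases t) (auto simp: norm_core_of entry_core_of)

lemma core_of_chart:
  assumes "valid_sel J" "U \<in> tt_params d n r" "good J U"
  shows "core_of J (chart J (ttF U)) = norm_cores J U"
  using norm_cores_eq[OF assms(1,3)] core_of_cong[of J "chart J (ttF U)"] chart_ttF[OF assms] by simp

lemma norm_gauged: "good J U \<Longrightarrow> gauged (amat J U) U (norm_cores J U)"
  unfolding norm_cores_def by (intro gauge_gauged gauge_mats_amat)

lemma ttF_core_of_chart: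
  assumes "valid_sel J" "U \<in> tt_params d n r" "good J U"
  shows "ttF (core_of J (chart J (ttF U))) = ttF U"
  unfolding core_of_chart[OF assms]
  by (rule ttF_gauged[OF gauge_mats_amat[OF assms(3)] norm_gauged[OF assms(3)] assms(2)])

text \<open>Which selections work for \<open>U\<close> can be recognised from \<open>ttF U\<close>
  alone, so tuples with equal image can be compared through one selection.\<close>

lemma good_iff_qsub:
  assumes "valid_sel J" "U \<in> tt_params d n r"
  shows "good J U \<longleftrightarrow> (\<forall>k\<in>{1..<d}. det (qsub J (ttF U) k) \<noteq> 0)"
  using qsub_ttF(1)[OF assms] by (simp add: good_def)

section \<open>Gauge orbits as fibres of the desingularisation map\<close>

lemma tt_equiv_gauge:
  "tt_equiv d n r = {(U, V). U \<in> tt_params d n r \<and> V \<in> tt_params d n r \<and> (\<exists>A. gauge_mats A \<and> gauged A U V)}"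
proof -
  let ?P = "\<lambda>A :: nat \<Rightarrow> real mat. A 0 = 1\<^sub>m 1 \<and> A d = 1\<^sub>m 1 \<and> (\<forall>k\<in>{1..<d}. A k \<in> carrier_mat (r k) (r k) \<and> invertible_mat (A k))"
  have "?P A \<longleftrightarrow>
      gauge_mats A" for A :: "nat \<Rightarrow> real mat"
  proof
    assume A: "?P A"
    have "A k \<in> carrier_mat (r k) (r k) \<and> det (A k) \<noteq> 0" if "k \<le> d" for k
    proof -
      have "k = 0 \<or> k = d \<or> k \<in> {1..<d}" using that by auto
      then show ?thesis using A invertible_mat_det[of "A k" "r k"] by (auto simp: r0 rd)
    qed
    then show "gauge_mats A" using A by (simp add: gauge_mats_def)
  next
    assume A: "gauge_mats A"
    have "A k \<in> carrier_mat (r k) (r k) \<and> invertible_mat (A k)" if "k \<in> {1..<d}" for k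
      using gauge_matsD(1,2)[OF A, of k] invertible_mat_det[of "A k" "r k"] that by auto
    then show "?P A"
      using A by (simp add: gauge_mats_def)
  qed
  then have "(A 0 = 1\<^sub>m 1 \<and> A d = 1\<^sub>m 1 \<and> (\<forall>k\<in>{1..<d}. A k \<in> carrier_mat (r k) (r k) \<and> invertible_mat (A k)) \<and>
      (\<forall>k\<in>{1..d}. \<forall>i<n k. slice r V k i = minv (A (k - 1)) * slice r U k i * A k)) \<longleftrightarrow>
      gauge_mats A \<and> gauged A U V" for A :: "nat \<Rightarrow> real mat" and U V
    unfolding gauged_def by (metis (no_types))
  then show ?thesis unfolding tt_equiv_def by simp
qed

lemma gauged_trans:
  assumes A: "gauge_mats A" and B: "gauge_mats B" and UV: "gauged A U V" and VW: "gauged B V W"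
  shows "gauge_mats (\<lambda>k. A k * B k)" "gauged (\<lambda>k. A k * B k) U W"
proof -
  show "gauge_mats (\<lambda>k. A k * B k)"
    unfolding gauge_mats_def
  proof (intro conjI allI impI)
    show "A 0 * B 0 = 1\<^sub>m 1" "A d * B d = 1\<^sub>m 1" using A B by (auto simp: gauge_mats_def)
    fix k assume k: "k \<le> d"
    note a = gauge_matsD[OF A k] and b = gauge_matsD[OF B k]
    show "A k * B k \<in> carrier_mat (r k) (r k)" by (rule mult_carrier_mat[OF a(1) b(1)])
    show "det (A k * B k) \<noteq> 0" unfolding det_mult[OF a(1) b(1)] using a(2) b(2) by simp
  qed
  show "gauged (\<lambda>k. A k * B k) U W"
    unfolding gauged_def
  proof (intro ballI allI impI)
    fix k i assume k: "k \<in> {1..d}" "i < n k"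
    then have k': "k \<le> d" "k - 1 \<le> d" by auto
    note a = gauge_matsD[OF A k'(1)] and b = gauge_matsD[OF B k'(1)]
    note a' = gauge_matsD[OF A k'(2)] and b' = gauge_matsD[OF B k'(2)]
    let ?S = "slice r U k i"
    note S = slice_carrier[of U k i]
    have aS: "minv (A (k - 1)) * ?S \<in> carrier_mat (r (k - 1)) (r k)" by (rule mult_carrier_mat[OF a'(3) S])
    have "slice r W k i = minv (B (k - 1)) * (minv (A (k - 1)) * ?S * A k) * B k"
      using UV VW k by (simp add: gauged_def)
    also have "\<dots> = minv (B (k - 1)) * (minv (A (k - 1)) * ?S * A k * B k)"
      by (rule assoc_mult_mat[OF b'(3) mult_carrier_mat[OF aS a(1)] b(1)])
    also have "minv (A (k - 1)) * ?S * A k * B k = minv (A (k - 1)) * ?S * (A k * B k)"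
      by (rule assoc_mult_mat[OF aS a(1) b(1)])
    also have "minv (B (k - 1)) * (minv (A (k - 1)) * ?S * (A k * B k)) =
        minv (B (k - 1)) * (minv (A (k - 1)) * ?S) * (A k * B k)"
      by (rule assoc_mult_mat[OF b'(3) aS mult_carrier_mat[OF a(1) b(1)], symmetric])
    also have "minv (B (k - 1)) * (minv (A (k - 1)) * ?S) = minv (B (k - 1)) * minv (A (k - 1)) * ?S"
      by (rule assoc_mult_mat[OF b'(3) a'(3) S, symmetric])
    also have "minv (B (k - 1)) * minv (A (k - 1)) = minv (A (k - 1) * B (k - 1))"
      by (rule minv_mult[OF a'(1,2) b'(1,2), symmetric])
    finally show "slice r W k i = minv (A (k - 1) * B (k - 1)) * ?S * (A k * B k)" .
  qed
qed

text \<open>Tuples with equal image have a common good selection and equal charts, hence the same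
  normal form. Passing from \<open>U\<close> to it and back to \<open>V\<close> is the required
  gauge transformation.\<close>

lemma tt_equiv_eq:
  "tt_equiv d n r = {(U, V). U \<in> tt_params d n r \<and> V \<in> tt_params d n r \<and> ttF U = ttF V}"
proof -
  have "(\<exists>A. gauge_mats A \<and> gauged A U V) \<longleftrightarrow> ttF U = ttF V"
    if U: "U \<in> tt_params d n r" and V: "V \<in> tt_params d n r" for U V
  proof
    assume "\<exists>A. gauge_mats A \<and> gauged A U V"
    then show "ttF U = ttF V" using ttF_gauged[OF _ _ U] by auto
  next
    assume eq: "ttF U = ttF V"
    obtain J where J: "valid_sel J" and gU: "good J U" using params_imp_good[OF U] .
    have gV: "good J V" using gU good_iff_qsub[OF J] U V eq by simp
    have "norm_cores J U = norm_cores J V"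
      using core_of_chart[OF J U gU] core_of_chart[OF J V gV] eq by simp
    then have "gauged (amat J U) U (norm_cores J V)" using norm_gauged[OF gU] by simp
    moreover have "gauged (\<lambda>k. minv (amat J V k)) (norm_cores J V) V"
      by (rule gauged_inverse[OF gauge_mats_amat[OF gV] norm_gauged[OF gV]])
    ultimately show "\<exists>A. gauge_mats A \<and> gauged A U V"
      using gauged_trans[OF gauge_mats_amat[OF gU] gauge_mats_minv[OF gauge_mats_amat[OF gV]]] by blast
  qed
  then show ?thesis unfolding tt_equiv_gauge by auto
qed

text \<open>Core \<open>k\<close> has \<open>n k * r k\<close> columns of height
  \<open>r (k - 1)\<close>, and for \<open>k \<ge> 2\<close> an injective selection fixes exactly
  \<open>r (k - 1)\<close> of them, so the square of each inner rank is lost once.\<close>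

lemma card_free:
  assumes J: "valid_sel J"
  shows "int (card (free J)) = (\<Sum>k=1..d. int (r (k - 1) * n k * r k)) - (\<Sum>k=1..<d. (int (r k))\<^sup>2)"
proof -
  define B where "B = (\<lambda>k. {..<n k} \<times> {..<r k} - (if 2 \<le> k then J (k - 1) ` {..<r (k - 1)} else {}))"
  have "free J = (SIGMA k:{1..d}. {..<r (k - 1)} \<times> B k)"
    by (auto simp: free_def B_def split: if_splits)
  then have "card (free J) = (\<Sum>k=1..d. r (k - 1) * card (B k))"
    by (simp add: card_cartesian_product B_def)
  then have "int (card (free J)) = (\<Sum>k=1..d. int (r (k - 1)) * int (card (B k)))" by simp
  also have "\<dots> = (\<Sum>k=1..d. int (r (k - 1) * n k * r k) - (if 2 \<le> k then (int (r (k - 1)))\<^sup>2 else 0))"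
  proof (rule sum.cong[OF refl])
    fix k assume k: "k \<in> {1..d}"
    show "int (r (k - 1)) * int (card (B k)) = int (r (k - 1) * n k * r k) - (if 2 \<le> k then (int (r (k - 1)))\<^sup>2 else 0)"
    proof (cases "2 \<le> k")
      case True
      note v = valid_selD[OF J True, of] 
      have k': "k \<le> d" using k by simp
      have sub: "J (k - 1) ` {..<r (k - 1)} \<subseteq> {..<n k} \<times> {..<r k}"
      proof (rule image_subsetI)
        fix x assume "x \<in> {..<r (k - 1)}"
        then show "J (k - 1) x \<in> {..<n k} \<times> {..<r k}"
          using v(2,3)[OF k', of x] by (simp add: mem_Times_iff)
      qed
      have "card (J (k - 1) ` {..<r (k - 1)}) = r (k - 1)" using card_image[OF v(1)[OF k']] by simp
      then have "card (B k) + r (k - 1) = n k * r k"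
        using True sub card_mono[OF _ sub] by (simp add: B_def card_Diff_subset card_cartesian_product)
      then have e: "int (card (B k)) = int (n k * r k) - int (r (k - 1))" by linarith
      show ?thesis unfolding e using True by (simp add: algebra_simps power2_eq_square)
    next
      case False
      then show ?thesis by (simp add: B_def card_cartesian_product)
    qed
  qed
  also have "\<dots> = (\<Sum>k=1..d. int (r (k - 1) * n k * r k)) - (\<Sum>k=1..d. if 2 \<le> k then (int (r (k - 1)))\<^sup>2 else 0)"
    by (rule sum_subtractf)
  also have "(\<Sum>k=1..d. if 2 \<le> k then (int (r (k - 1)))\<^sup>2 else 0) = (\<Sum>k\<in>{2..d}. (int (r (k - 1)))\<^sup>2)"
    by (rule sum.mono_neutral_cong_right) auto
  also have "\<dots> = (\<Sum>k=1..<d. (int (r k))\<^sup>2)"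
    by (rule sum.reindex_bij_witness[of _ "\<lambda>k. k + 1" "\<lambda>k. k - 1"]) auto
  finally show ?thesis .
qed

section \<open>The ambient space\<close>

lemma subspace_ambient: "real_vector.subspace (tt_ambient d n)"
  using subspace_coord_space[of "multi_indices d n 1"] subspace_coord_space[of "proj_indices d n"]
  unfolding real_vector.subspace_def tt_ambient_def zero_prod_def
  by (simp add: split_beta lookup_add lookup_scaleR del: One_nat_def)

lemma ambientD:
  assumes "y \<in> tt_ambient d n"
  shows "fst y \<in> coord_space (multi_indices d n 1)" "snd y \<in> coord_space (proj_indices d n)"
    "lookup (snd y) (k, a, b) = lookup (snd y) (k, b, a)"
  using assms by (auto simp: tt_ambient_def)

lemma ambientI:
  assumes "x \<in> coord_space (multi_indices d n 1)" "p \<in> coord_space (proj_indices d n)"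
    "\<And>k a b. lookup p (k, a, b) = lookup p (k, b, a)"
  shows "(x, p) \<in> tt_ambient d n"
  using assms by (auto simp: tt_ambient_def)

fun amb_coord :: "(nat \<Rightarrow> nat) + nat \<times> nat \<times> nat \<Rightarrow> tt_point \<Rightarrow> real" where
  "amb_coord (Inl i) y = lookup (fst y) i"
| "amb_coord (Inr s) y = lookup (snd y) s"

definition sym_unit :: "nat \<Rightarrow> nat \<Rightarrow> nat \<Rightarrow> nat \<times> nat \<times> nat \<Rightarrow>\<^sub>0 real" where
  "sym_unit k a b = Poly_Mapping.single (k, a, b) 1 + Poly_Mapping.single (k, b, a) 1"

text \<open>All ordered pairs \<open>(a, b)\<close> are used, so an off-diagonal symmetric unit
  occurs twice, while on the diagonal \<open>sym_unit\<close> has the entry 2. The factor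
  \<open>1 / 2\<close> corrects both.\<close>

fun amb_vec :: "(nat \<Rightarrow> nat) + nat \<times> nat \<times> nat \<Rightarrow> tt_point" where
  "amb_vec (Inl i) = (Poly_Mapping.single i 1, 0)"
| "amb_vec (Inr (k, a, b)) = (0, (1 / 2) *\<^sub>R sym_unit k a b)"

lemma lookup_sym_unit:
  "lookup (sym_unit k a b) s = (if s = (k, a, b) then 1 else 0) + (if s = (k, b, a) then 1 else 0)"
  unfolding sym_unit_def lookup_add lookup_single when_def by (simp only: eq_commute[of s])

lemma sym_unit_in:
  assumes "(k, a, b) \<in> proj_indices d n" shows "(0, c *\<^sub>R sym_unit k a b) \<in> tt_ambient d n"
proof (rule ambientI)
  show "0 \<in> coord_space (multi_indices d n 1)" by (simp add: coord_space_iff)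
  have "(k, b, a) \<in> proj_indices d n" using assms by (simp add: proj_indices_def)
  then have "s \<noteq> (k, a, b) \<and> s \<noteq> (k, b, a)" if "s \<notin> proj_indices d n" for s
    using that assms by metis
  then have z: "lookup (c *\<^sub>R sym_unit k a b) s = 0" if "s \<notin> proj_indices d n" for s
    using that unfolding lookup_scaleR lookup_sym_unit by simp
  show "c *\<^sub>R sym_unit k a b \<in> coord_space (proj_indices d n)"
    unfolding coord_space_iff by (intro allI impI z)
  show "lookup (c *\<^sub>R sym_unit k a b) (k', a', b') = lookup (c *\<^sub>R sym_unit k a b) (k', b', a')"
    for k' a' b'
  proof -
    have e: "(k', a', b') = (k, a, b) \<longleftrightarrow> (k', b', a') = (k, b, a)"
      "(k', a', b') = (k, b, a) \<longleftrightarrow> (k', b', a') = (k, a, b)" by auto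
    show ?thesis unfolding lookup_scaleR lookup_sym_unit e by (simp only: add.commute)
  qed
qed

lemma single_in:
  assumes "i \<in> multi_indices d n 1" shows "(Poly_Mapping.single i 1, 0) \<in> tt_ambient d n"
proof (rule ambientI)
  show "Poly_Mapping.single i 1 \<in> coord_space (multi_indices d n 1)"
    unfolding coord_space_iff lookup_single when_def using assms by metis
  show "0 \<in> coord_space (proj_indices d n)" by (simp add: coord_space_def)
qed simp

lemma frame_ambient: "frame (tt_ambient d n) (multi_indices d n 1 <+> proj_indices d n) amb_coord amb_vec"
  unfolding frame_def
proof (intro conjI ballI)
  show "finite (multi_indices d n 1 <+> proj_indices d n)"
    by (simp add: finite_multi_indices finite_proj_indices)
  fix i :: "(nat \<Rightarrow> nat) + nat \<times> nat \<times> nat"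
  show "bounded_linear (amb_coord i)"
  proof (cases i)
    case (Inl a)
    then have "amb_coord i = (\<lambda>y. lookup (fst y) a)" by (simp add: fun_eq_iff)
    then show ?thesis using bounded_linear_compose[OF bounded_linear_lookup bounded_linear_fst] by simp
  next
    case (Inr s)
    then have "amb_coord i = (\<lambda>y. lookup (snd y) s)" by (simp add: fun_eq_iff)
    then show ?thesis using bounded_linear_compose[OF bounded_linear_lookup bounded_linear_snd] by simp
  qed
  assume "i \<in> multi_indices d n 1 <+> proj_indices d n"
  then show "amb_vec i \<in> tt_ambient d n"
    by (cases i rule: amb_vec.cases) (auto intro: single_in sym_unit_in)
next
  fix y assume y: "y \<in> tt_ambient d n"
  note D = ambientD[OF y]
  have 1: "(\<Sum>i\<in>multi_indices d n 1. amb_coord (Inl i) y *\<^sub>R amb_vec (Inl i)) = (fst y, 0)"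
    using coord_space_expand[OF finite_multi_indices D(1)] by (simp add: sum_Pair flip: One_nat_def)
  have "(\<Sum>s\<in>proj_indices d n. lookup (snd y) s *\<^sub>R ((1 / 2) *\<^sub>R (case s of (k, a, b) \<Rightarrow> sym_unit k a b))) = snd y"
    (is "?P = _")
  proof (rule poly_mapping_eqI)
    fix s :: "nat \<times> nat \<times> nat"
    obtain k a b where s: "s = (k, a, b)" by (cases s)
    have half: "u *\<^sub>R ((1 / 2) *\<^sub>R ((if A then 1 else 0) + (if B then 1 else 0))) =
        (if A then u / 2 else 0) + (if B then u / 2 else (0::real))" for A B u
      by (cases A; cases B) simp_all
    have "lookup ?P s = (\<Sum>t\<in>proj_indices d n.
        (if t = (k, a, b) then lookup (snd y) t / 2 else 0) +
        (if t = (k, b, a) then lookup (snd y) t / 2 else 0))"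
      unfolding lookup_sum s
    proof (rule sum.cong[OF refl])
      fix t :: "nat \<times> nat \<times> nat"
      obtain l p q where t: "t = (l, p, q)" by (cases t)
      have e: "(k, a, b) = (l, p, q) \<longleftrightarrow> t = (k, a, b)" "(k, a, b) = (l, q, p) \<longleftrightarrow> t = (k, b, a)"
        unfolding t by auto
      have "lookup (lookup (snd y) t *\<^sub>R ((1 / 2) *\<^sub>R sym_unit l p q)) (k, a, b) =
          (if t = (k, a, b) then lookup (snd y) t / 2 else 0) +
          (if t = (k, b, a) then lookup (snd y) t / 2 else 0)"
        unfolding lookup_scaleR lookup_sym_unit e by (rule half)
      moreover have "(case t of (k, a, b) \<Rightarrow> sym_unit k a b) = sym_unit l p q" by (simp add: t)
      ultimately show "lookup (lookup (snd y) t *\<^sub>R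
          ((1 / 2) *\<^sub>R (case t of (k, a, b) \<Rightarrow> sym_unit k a b))) (k, a, b) =
          (if t = (k, a, b) then lookup (snd y) t / 2 else 0) +
          (if t = (k, b, a) then lookup (snd y) t / 2 else 0)" by (simp only:)
    qed
    also have "\<dots> = lookup (snd y) (k, a, b) / 2 + lookup (snd y) (k, b, a) / 2"
    proof -
      have c: "lookup (snd y) u = 0" if "u \<notin> proj_indices d n" for u
        by (rule mp[OF spec[OF D(2)[unfolded coord_space_iff]] that])
      have "(\<Sum>t\<in>proj_indices d n. if t = u then lookup (snd y) t / 2 else 0) =
          lookup (snd y) u / 2" for u
        unfolding sum.delta'[OF finite_proj_indices] sum.delta[OF finite_proj_indices] using c[of u] by simp
      then show ?thesis unfolding sum.distrib by (simp only:)
    qed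
    also have "\<dots> = lookup (snd y) s"
      unfolding s using D(3)[of k a b] by simp
    finally show "lookup ?P s = lookup (snd y) s" .
  qed
  moreover have "amb_vec (Inr s) = (0, (1 / 2) *\<^sub>R (case s of (k, a, b) \<Rightarrow> sym_unit k a b))" for s
    by (cases s) simp
  ultimately have 2: "(\<Sum>s\<in>proj_indices d n. amb_coord (Inr s) y *\<^sub>R amb_vec (Inr s)) = (0, snd y)"
    by (simp add: sum_Pair)
  have "(\<Sum>i\<in>multi_indices d n 1 <+> proj_indices d n. amb_coord i y *\<^sub>R amb_vec i) = (fst y, 0) + (0, snd y)"
    by (simp only: sum.Plus[OF finite_multi_indices finite_proj_indices] 1 2 comp_def)
  then show "y = (\<Sum>i\<in>multi_indices d n 1 <+> proj_indices d n. amb_coord i y *\<^sub>R amb_vec i)" by simp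
qed

lemma ttF_in: assumes U: "U \<in> tt_params d n r" shows "ttF U \<in> tt_ambient d n"
proof -
  let ?T = "tabulate (proj_indices d n) (\<lambda>(k, a, b). interface_proj d n r U k $$ (a, b))"
  show ?thesis
    unfolding ttF_def
  proof (rule ambientI)
    show "tt_tensor d n r U \<in> coord_space (multi_indices d n 1)"
      unfolding tt_tensor_def by (rule tabulate_in[OF finite_multi_indices])
    show "?T \<in> coord_space (proj_indices d n)"
      by (rule tabulate_in[OF finite_proj_indices])
    fix k a b
    show "lookup (?T) (k, a, b) =
        lookup (?T) (k, b, a)"
    proof (cases "(k, a, b) \<in> proj_indices d n")
      case True
      then have k: "k \<in> {1..<d}" "a < tail_size d n k" "b < tail_size d n k" and sw: "(k, b, a) \<in> proj_indices d n"
        by (auto simp: proj_indices_def)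
      let ?X = "interface d n r U k"
      define Q where "Q = ?X * minv (?X\<^sup>T * ?X) * ?X\<^sup>T"
      have Q: "Q\<^sup>T = Q" "dim_row Q = tail_size d n k" "dim_col Q = tail_size d n k"
        using projection_symmetric[OF interface_carrier gram_nonzero[OF U k(1)]] interface_carrier[of U k]
        by (auto simp: Q_def)
      have "Q $$ (a, b) = Q $$ (b, a)"
        using arg_cong[OF Q(1), of "\<lambda>M. M $$ (a, b)"] Q(2,3) k by simp
      then show ?thesis
        using True sw k Q by (simp add: lookup_tabulate finite_proj_indices interface_proj_def Let_def flip: Q_def)
    next
      case False
      then have "(k, b, a) \<notin> proj_indices d n" by (auto simp: proj_indices_def)
      then show ?thesis using False by (simp add: lookup_tabulate finite_proj_indices)
    qed
  qed
qed

section \<open>Linear slices\<close>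

text \<open>The dual vectors to \<open>slc\<close>. No factor \<open>1 / 2\<close> occurs: for free
  indices the position is off the diagonal, where \<open>sym_unit\<close> has the entry 1.\<close>

fun svec :: "selection \<Rightarrow> nat \<times> nat \<times> nat \<times> nat \<Rightarrow> tt_point" where
  "svec J (k, a, i, b) = (if k = 1 then (Poly_Mapping.single ((mi J 1 b)(1 := i)) 1, 0)
     else (0, sym_unit (k - 1) (row_of J k i b) (ri J (k - 1) a)))"

lemma bounded_linear_slc: "bounded_linear (slc J t)"
proof -
  obtain k a i b where t: "t = (k, a, i, b)" by (cases t)
  show ?thesis
  proof (cases "k = 1")
    case True
    then have "slc J t = (\<lambda>y. lookup (fst y) ((mi J 1 b)(1 := i)))" by (simp add: t fun_eq_iff)
    then show ?thesis
      using bounded_linear_compose[OF bounded_linear_lookup bounded_linear_fst] by simp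
  next
    case False
    then have "slc J t = (\<lambda>y. lookup (snd y) (k - 1, row_of J k i b, ri J (k - 1) a))"
      by (simp add: t fun_eq_iff)
    then show ?thesis
      using bounded_linear_compose[OF bounded_linear_lookup bounded_linear_snd] by simp
  qed
qed

lemma svec_in:
  assumes J: "valid_sel J" and t: "t \<in> free J" shows "svec J t \<in> tt_ambient d n"
proof -
  obtain k a i b where teq: "t = (k, a, i, b)" by (cases t)
  note f = freeD[OF t[unfolded teq]]
  show ?thesis
  proof (cases "k = 1")
    case True
    have "(mi J 1 b)(1 := i) \<in> multi_indices d n 1" using upd_in[OF J f(1,2,4,5)] unfolding True .
    from single_in[OF this] show ?thesis by (simp add: teq True)
  next
    case False
    then have k: "2 \<le> k" "k - 1 \<in> {1..<d}" using f(1,2) by auto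
    have "(k - 1, row_of J k i b, ri J (k - 1) a) \<in> proj_indices d n"
      using row_of_less[OF J k(1) f(2,4,5)] ri_less[OF J k(2) f(3)] k(2) by (simp add: proj_indices_def)
    from sym_unit_in[OF this, of 1] show ?thesis using False by (simp add: teq)
  qed
qed

lemma slc_svec:
  assumes J: "valid_sel J" and t: "t \<in> free J" and t': "t' \<in> free J"
  shows "slc J t (svec J t') = (if t = t' then 1 else 0)"
proof -
  obtain k a i b where teq: "t = (k, a, i, b)" by (cases t)
  obtain k' a' i' b' where teq': "t' = (k', a', i', b')" by (cases t')
  note f = freeD[OF t[unfolded teq]] and f' = freeD[OF t'[unfolded teq']]
  show ?thesis
  proof (cases "k = 1")
    case True
    show ?thesis
    proof (cases "k' = 1")
      case k': True
      have m: "mi J 1 b \<in> multi_indices d n (Suc 1)" "mi J 1 b' \<in> multi_indices d n (Suc 1)"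
        using mi_in[OF J, of 1] f(2,5) f'(5) True k' by simp_all
      have "(mi J 1 b)(1 := i) = (mi J 1 b')(1 := i') \<longleftrightarrow> b = b' \<and> i = i'"
        using multi_indices_upd_inj[OF m] mi_inj[OF J, of 1] f(2,5) f'(5) True k' by (auto simp: inj_on_def)
      moreover have "a = 0" "a' = 0" using f(3) f'(3) True k' r0 by auto
      ultimately show ?thesis using True k'
        by (auto simp: teq teq' lookup_single when_def simp del: One_nat_def)
    next
      case False
      then show ?thesis using True by (simp add: teq teq')
    qed
  next
    case False
    then have k: "2 \<le> k" "k - 1 \<in> {1..<d}" using f(1,2) by auto
    show ?thesis
    proof (cases "k' = 1")
      case True
      then show ?thesis using False by (simp add: teq teq')
    next
      case k': False
      then have k2: "2 \<le> k'" using f'(1) by simp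
      have v: "slc J t (svec J t') = lookup
          (sym_unit (k' - 1) (row_of J k' i' b') (ri J (k' - 1) a')) (k - 1, row_of J k i b, ri J (k - 1) a)"
        using False k' by (simp add: teq teq')
      show ?thesis
      proof (cases "k = k'")
        case kk: True
        \<comment> \<open>This excludes the transposed position of the symmetric unit, which would
          match an unselected row with a selected one.\<close>
        have "row_of J k i b \<noteq> ri J (k - 1) a'"
          using row_of_not_ri[OF J t[unfolded teq] k(1)] f'(3) kk by simp
        moreover have "row_of J k i b = row_of J k i' b' \<longleftrightarrow> i = i' \<and> b = b'"
          using row_of_inj[OF J k(1) f(2,4,5)] f'(4,5) kk by auto
        moreover have "ri J (k - 1) a = ri J (k - 1) a' \<longleftrightarrow> a = a'"
          using ri_inj[OF J k(2)] f(3) f'(3) kk by (auto simp: inj_on_def)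
        ultimately have "(k - 1, row_of J k i b, ri J (k - 1) a) = (k - 1, row_of J k i' b', ri J (k - 1) a') \<longleftrightarrow> t = t'"
          "(k - 1, row_of J k i b, ri J (k - 1) a) \<noteq> (k - 1, ri J (k - 1) a', row_of J k i' b')"
          using kk by (auto simp: teq teq')
        then show ?thesis unfolding v lookup_sym_unit kk[symmetric] by simp
      next
        case kk: False
        then have "k - 1 \<noteq> k' - 1" using k k2 by auto
        then show ?thesis unfolding v lookup_sym_unit using kk by (simp add: teq teq')
      qed
    qed
  qed
qed

text \<open>Slice vectors change the projectors only at positions with one unselected index, whereas
  both indices of \<open>Q(S,S)\<close> are selected. This supplies the invariance modulo the slice
  that \<open>slice_chart\<close> asks for.\<close>

lemma qsub_cong:
  assumes J: "valid_sel J" and k: "k \<in> {1..<d}" and z: "y - y' \<in> span (svec J ` free J)"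
  shows "qsub J y k = qsub J y' k"
proof -
  have "lookup (snd z) (k, ri J k a, ri J k b) = 0"
    if z: "z \<in> span (svec J ` free J)" and ab: "a < r k" "b < r k" for z a b
    using z
  proof (induction rule: real_vector.span_induct_alt)
    case base
    show ?case by simp
  next
    case (step c x y)
    obtain l a' i b' where t: "(l, a', i, b') \<in> free J" "x = svec J (l, a', i, b')"
      using step(1) by auto
    have "lookup (snd x) (k, ri J k a, ri J k b) = 0"
    proof (cases "l = 1")
      case True
      then show ?thesis by (simp add: t(2))
    next
      case False
      then have l: "2 \<le> l" using freeD(1)[OF t(1)] by simp
      have sx: "snd x = sym_unit (l - 1) (row_of J l i b') (ri J (l - 1) a')" using False by (simp add: t(2))
      have "(k, ri J k a, ri J k b) \<noteq> (l - 1, row_of J l i b', ri J (l - 1) a')"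
      proof
        assume h: "(k, ri J k a, ri J k b) = (l - 1, row_of J l i b', ri J (l - 1) a')"
        then have kl: "k = l - 1" by (rule Pair_inject)
        from h have "ri J k a = row_of J l i b'" by (elim Pair_inject)
        then show False using row_of_not_ri[OF J t(1) l, of a] ab(1) unfolding kl by simp
      qed
      moreover have "(k, ri J k a, ri J k b) \<noteq> (l - 1, ri J (l - 1) a', row_of J l i b')"
      proof
        assume h: "(k, ri J k a, ri J k b) = (l - 1, ri J (l - 1) a', row_of J l i b')"
        then have kl: "k = l - 1" by (rule Pair_inject)
        from h have "ri J k b = row_of J l i b'" by (elim Pair_inject)
        then show False using row_of_not_ri[OF J t(1) l, of b] ab(2) unfolding kl by simp
      qed
      ultimately show ?thesis unfolding sx lookup_sym_unit by (simp only: if_False add_0_right)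
    qed
    then show ?case using step(2) by (simp add: lookup_add lookup_scaleR)
  qed
  from this[OF z] show ?thesis
    unfolding qsub_def by (intro eq_matI) (auto simp: lookup_minus)
qed

lemma unchart_cong:
  assumes J: "valid_sel J" and t: "t \<in> free J" and w: "\<And>t. t \<in> free J \<Longrightarrow> w t = w' t"
    and z: "y - y' \<in> span (svec J ` free J)"
  shows "unchart J w y t = unchart J w' y' t"
proof -
  obtain k a i b where teq: "t = (k, a, i, b)" by (cases t)
  note f = freeD[OF t[unfolded teq]]
  show ?thesis
  proof (cases "k = 1")
    case True
    then show ?thesis using w[OF t] by (simp add: teq)
  next
    case False
    then have k: "k - 1 \<in> {1..<d}" using f(1,2) by auto
    show ?thesis
      using False w f(7) qsub_cong[OF J k z] by (auto simp: teq intro!: sum.cong)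
  qed
qed

text \<open>\<open>unchart\<close> multiplies by the block whose inverse is used in
  \<open>chart\<close>, so the relation holds wherever the blocks are invertible, on the image or
  off it.\<close>

lemma slc_unchart:
  assumes t: "t \<in> free J" and det: "\<And>k. k \<in> {1..<d} \<Longrightarrow> det (qsub J y k) \<noteq> 0"
  shows "slc J t y = unchart J (chart J y) y t"
proof -
  obtain k a i b where teq: "t = (k, a, i, b)" by (cases t)
  note f = freeD[OF t[unfolded teq]]
  show ?thesis
  proof (cases "k = 1")
    case True
    then show ?thesis by (simp add: teq)
  next
    case False
    then have k: "k - 1 \<in> {1..<d}" using f(1,2) by auto
    let ?Q = "qsub J y (k - 1)" and ?m = "r (k - 1)"
    note iQ = minv_mat[OF qsub_carrier det[OF k]]
    have "unchart J (chart J y) y t =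
        (\<Sum>c<?m. \<Sum>e<?m. slc J (k, e, i, b) y * (minv ?Q $$ (e, c) * ?Q $$ (c, a)))"
      using False by (simp add: teq sum_negf sum_distrib_right mult.assoc del: slc.simps)
    also have "\<dots> = (\<Sum>e<?m. slc J (k, e, i, b) y * (\<Sum>c<?m. minv ?Q $$ (e, c) * ?Q $$ (c, a)))"
      by (subst sum.swap) (simp add: sum_distrib_left del: slc.simps)
    also have "\<dots> = (\<Sum>e<?m. if e = a then slc J (k, e, i, b) y else 0)"
    proof (rule sum.cong[OF refl])
      fix e assume "e \<in> {..<?m}"
      then have e: "e < ?m" by simp
      have "(\<Sum>c<?m. minv ?Q $$ (e, c) * ?Q $$ (c, a)) = (if e = a then 1 else 0)"
        unfolding mult_index_sum[OF iQ(1) qsub_carrier e f(3), symmetric] iQ(3) using e f(3) by simp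
      then show "slc J (k, e, i, b) y * (\<Sum>c<?m. minv ?Q $$ (e, c) * ?Q $$ (c, a)) =
          (if e = a then slc J (k, e, i, b) y else 0)" by (simp only: mult_1_right mult_zero_right split: if_split) simp
    qed
    also have "\<dots> = slc J t y" using f(3) by (simp add: teq del: slc.simps)
    finally show ?thesis by simp
  qed
qed

text \<open>Multiplying the relation by the inverse of \<open>Q(S,S)\<close> leaves no choice for
  the free entries.\<close>

lemma chart_unique:
  assumes t: "t \<in> free J" and det: "\<And>k. k \<in> {1..<d} \<Longrightarrow> det (qsub J y k) \<noteq> 0"
    and w: "\<And>t. t \<in> free J \<Longrightarrow> slc J t y = unchart J w y t"
  shows "chart J y t = w t"
proof -
  obtain k a i b where teq: "t = (k, a, i, b)" by (cases t)
  note f = freeD[OF t[unfolded teq]]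
  show ?thesis
  proof (cases "k = 1")
    case True
    then show ?thesis using w[OF t] by (simp add: teq)
  next
    case False
    then have k: "k - 1 \<in> {1..<d}" using f(1,2) by auto
    let ?Q = "qsub J y (k - 1)" and ?m = "r (k - 1)"
    note iQ = minv_mat[OF qsub_carrier det[OF k]]
    have sl: "slc J (k, c, i, b) y = - (\<Sum>e<?m. w (k, e, i, b) * ?Q $$ (e, c))" if "c < ?m" for c
      using w[OF f(7)[OF that]] False by simp
    have "chart J y t = (\<Sum>c<?m. \<Sum>e<?m. w (k, e, i, b) * (?Q $$ (e, c) * minv ?Q $$ (c, a)))"
      using False sl by (simp add: teq sum_negf sum_distrib_right mult.assoc del: slc.simps)
    also have "\<dots> = (\<Sum>e<?m. w (k, e, i, b) * (\<Sum>c<?m. ?Q $$ (e, c) * minv ?Q $$ (c, a)))"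
      by (subst sum.swap) (simp add: sum_distrib_left)
    also have "\<dots> = (\<Sum>e<?m. if e = a then w (k, e, i, b) else 0)"
    proof (rule sum.cong[OF refl])
      fix e assume "e \<in> {..<?m}"
      then have e: "e < ?m" by simp
      have "(\<Sum>c<?m. ?Q $$ (e, c) * minv ?Q $$ (c, a)) = (if e = a then 1 else 0)"
        unfolding mult_index_sum[OF qsub_carrier iQ(1) e f(3), symmetric] iQ(2) using e f(3) by simp
      then show "w (k, e, i, b) * (\<Sum>c<?m. ?Q $$ (e, c) * minv ?Q $$ (c, a)) =
          (if e = a then w (k, e, i, b) else 0)" by (simp only: mult_1_right mult_zero_right split: if_split) simp
    qed
    also have "\<dots> = w t" using f(3) by (simp add: teq)
    finally show ?thesis .
  qed
qed

section \<open>Smoothness\<close>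

text \<open>The cores are an arbitrary family \<open>U z\<close> with smooth entries. Rules stated
  for families can be applied one after another, without a chain rule for nonlinear maps.\<close>

lemma Cinf_on_ivec:
  assumes U: "\<And>s. Cinf_on E W (\<lambda>z. lookup (U z) s)"
  shows "k \<le> d \<Longrightarrow> b < r k \<Longrightarrow> Cinf_on E W (\<lambda>z. ivec (U z) k i b)"
proof (induction k arbitrary: b rule: inc_induct)
  case base
  then show ?case by (simp add: rd ivec_end Cinf_on_const)
next
  case (step k)
  have "Cinf_on E W (\<lambda>z. \<Sum>c<r (Suc k). entry (U z) (Suc k) b (i (Suc k)) c * ivec (U z) (Suc k) i c)"
    by (intro Cinf_on_sum Cinf_on_mult U step.IH) simp
  then show ?case using ivec_step[OF step.hyps(2) step.prems] by simp
qed

lemma Cinf_on_amat: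
  assumes U: "\<And>s. Cinf_on E W (\<lambda>z. lookup (U z) s)" and "k \<in> {1..<d}" "a < r k" "b < r k"
  shows "Cinf_on E W (\<lambda>z. amat J (U z) k $$ (a, b))"
  using assms(2-) Cinf_on_ivec[OF U, of k a] by (simp add: amat_def)

lemma Cinf_on_interface:
  assumes U: "\<And>s. Cinf_on E W (\<lambda>z. lookup (U z) s)"
    and "k \<le> d" "p < tail_size d n k" "b < r k"
  shows "Cinf_on E W (\<lambda>z. interface d n r (U z) k $$ (p, b))"
  using assms(2-) Cinf_on_ivec[OF U, of k b] by (simp add: interface_def flip: ivec_def)

text \<open>Membership in \<open>tt_params\<close> keeps the Gram determinant nonzero, so the
  projector is a rational function of the cores without poles on \<open>W\<close>.\<close>

lemma Cinf_on_interface_proj: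
  assumes U: "\<And>s. Cinf_on E W (\<lambda>z. lookup (U z) s)"
    and S: "\<And>z. z \<in> W \<Longrightarrow> U z \<in> tt_params d n r"
    and k: "k \<in> {1..<d}" and pq: "p < tail_size d n k" "q < tail_size d n k"
  shows "Cinf_on E W (\<lambda>z. interface_proj d n r (U z) k $$ (p, q))"
proof -
  let ?X = "\<lambda>z. interface d n r (U z) k" and ?N = "tail_size d n k"
  let ?G = "\<lambda>z. minv ((?X z)\<^sup>T * ?X z)"
  have kd: "k \<le> d" using k by simp
  note X = interface_carrier[of "U _" k]
  have XT: "(?X z)\<^sup>T \<in> carrier_mat (r k) ?N" for z using X by simp
  have H: "(?X z)\<^sup>T * ?X z \<in> carrier_mat (r k) (r k)" for z by (rule mult_carrier_mat[OF XT X])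
  note smX = Cinf_on_interface[OF U kd]
  have smG: "Cinf_on E W (\<lambda>z. ?G z $$ (a, b))" if ab: "a < r k" "b < r k" for a b
  proof (rule Cinf_on_minv[OF H gram_nonzero[OF S k] _ ab])
    fix a b assume ab: "a < r k" "b < r k"
    have e: "((?X z)\<^sup>T * ?X z) $$ (a, b) = (\<Sum>c<?N. ?X z $$ (c, a) * ?X z $$ (c, b))" for z
      unfolding mult_index_sum[OF XT X ab] using X[of z] ab by (intro sum.cong) auto
    show "Cinf_on E W (\<lambda>z. ((?X z)\<^sup>T * ?X z) $$ (a, b))"
      unfolding e by (intro Cinf_on_sum Cinf_on_mult smX ab) simp_all
  qed
  have eqn: "interface_proj d n r (U z) k $$ (p, q) =
      (if p = q then 1 else 0) - (\<Sum>c<r k. (\<Sum>e<r k. ?X z $$ (p, e) * ?G z $$ (e, c)) * ?X z $$ (q, c))"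
    if z: "z \<in> W" for z
  proof -
    have G: "?G z \<in> carrier_mat (r k) (r k)" by (rule minv_mat(1)[OF H gram_nonzero[OF S[OF z] k]])
    have XG: "?X z * ?G z \<in> carrier_mat ?N (r k)" by (rule mult_carrier_mat[OF X G])
    have "(?X z * ?G z * (?X z)\<^sup>T) $$ (p, q) = (\<Sum>c<r k. (?X z * ?G z) $$ (p, c) * (?X z)\<^sup>T $$ (c, q))"
      by (rule mult_index_sum[OF XG XT pq])
    also have "\<dots> = (\<Sum>c<r k. (\<Sum>e<r k. ?X z $$ (p, e) * ?G z $$ (e, c)) * ?X z $$ (q, c))"
    proof (rule sum.cong[OF refl])
      fix c assume "c \<in> {..<r k}"
      then have c: "c < r k" by simp
      show "(?X z * ?G z) $$ (p, c) * (?X z)\<^sup>T $$ (c, q) =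
          (\<Sum>e<r k. ?X z $$ (p, e) * ?G z $$ (e, c)) * ?X z $$ (q, c)"
        unfolding mult_index_sum[OF X G pq(1) c] using X[of z] c pq(2) by simp
    qed
    finally show ?thesis
      using XG XT[of z] pq by (simp add: interface_proj_def Let_def)
  qed
  have sm: "Cinf_on E W (\<lambda>z. (if p = q then 1 else 0) -
      (\<Sum>c<r k. (\<Sum>e<r k. ?X z $$ (p, e) * ?G z $$ (e, c)) * ?X z $$ (q, c)))"
    by (intro Cinf_on_diff Cinf_on_const Cinf_on_sum Cinf_on_mult smX smG pq) simp_all
  show ?thesis by (rule Cinf_on_cong[OF eqn[symmetric] sm])
qed

lemma Cinf_on_ttF:
  assumes U: "\<And>s. Cinf_on E W (\<lambda>z. lookup (U z) s)"
    and S: "\<And>z. z \<in> W \<Longrightarrow> U z \<in> tt_params d n r"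
  shows "Cinf_on E W (\<lambda>z. ttF (U z))"
  unfolding ttF_def tt_tensor_def
proof (intro Cinf_on_Pair Cinf_on_tabulate finite_multi_indices finite_proj_indices)
  fix i
  show "Cinf_on E W (\<lambda>z. slice_prod d r (U z) 1 i $$ (0, 0))"
    using Cinf_on_ivec[OF U, of 0 0 i] r0 by (simp add: ivec_def)
next
  fix s assume s: "s \<in> proj_indices d n"
  obtain k p q where "s = (k, p, q)" by (cases s)
  then show "Cinf_on E W (\<lambda>z. case s of (k, a, b) \<Rightarrow> interface_proj d n r (U z) k $$ (a, b))"
    using s Cinf_on_interface_proj[OF U S, of k p q] by (simp add: proj_indices_def)
qed

lemma Cinf_on_slc: "Cinf_on E W y \<Longrightarrow> Cinf_on E W (\<lambda>z. slc J t (y z))"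
  by (rule Cinf_on_postcompose[OF bounded_linear_slc])

lemma Cinf_on_qsub:
  assumes y: "Cinf_on E W y" and ab: "a < r k" "b < r k"
  shows "Cinf_on E W (\<lambda>z. qsub J (y z) k $$ (a, b))"
  unfolding qsub_def using ab
  by (simp add: Cinf_on_diff Cinf_on_const Cinf_on_lookup Cinf_on_postcompose[OF bounded_linear_snd y])

lemma Cinf_on_det_qsub:
  "Cinf_on E W y \<Longrightarrow> Cinf_on E W (\<lambda>z. det (qsub J (y z) k))"
  by (rule Cinf_on_det[OF qsub_carrier]) (rule Cinf_on_qsub)

lemma Cinf_on_chart:
  assumes y: "Cinf_on E W y" and t: "t \<in> free J"
    and det: "\<And>z k. z \<in> W \<Longrightarrow> k \<in> {1..<d} \<Longrightarrow> det (qsub J (y z) k) \<noteq> 0"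
  shows "Cinf_on E W (\<lambda>z. chart J (y z) t)"
proof -
  obtain k a i b where teq: "t = (k, a, i, b)" by (cases t)
  note f = freeD[OF t[unfolded teq]]
  show ?thesis
  proof (cases "k = 1")
    case True
    then show ?thesis using Cinf_on_slc[OF y, of J t] by (simp add: teq)
  next
    case False
    then have k: "k - 1 \<in> {1..<d}" using f(1,2) by auto
    have "Cinf_on E W (\<lambda>z. minv (qsub J (y z) (k - 1)) $$ (c, a))" if "c < r (k - 1)" for c
      by (rule Cinf_on_minv[OF qsub_carrier det[OF _ k] Cinf_on_qsub[OF y] that f(3)])
    then have "Cinf_on E W (\<lambda>z. - (\<Sum>c<r (k - 1). slc J (k, c, i, b) (y z) * minv (qsub J (y z) (k - 1)) $$ (c, a)))"
      by (intro Cinf_on_minus Cinf_on_sum Cinf_on_mult Cinf_on_slc[OF y]) simp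
    then show ?thesis using False by (simp add: teq del: slc.simps)
  qed
qed

lemma Cinf_on_unchart:
  assumes y: "Cinf_on E W y" and t: "t \<in> free J"
    and w: "\<And>t. t \<in> free J \<Longrightarrow> Cinf_on E W (\<lambda>z. w z t)"
  shows "Cinf_on E W (\<lambda>z. unchart J (w z) (y z) t)"
proof -
  obtain k a i b where teq: "t = (k, a, i, b)" by (cases t)
  note f = freeD[OF t[unfolded teq]]
  show ?thesis
  proof (cases "k = 1")
    case True
    then show ?thesis using w[OF t] by (simp add: teq)
  next
    case False
    have "Cinf_on E W (\<lambda>z. - (\<Sum>c<r (k - 1). w z (k, c, i, b) * qsub J (y z) (k - 1) $$ (c, a)))"
      by (intro Cinf_on_minus Cinf_on_sum Cinf_on_mult w f(7) Cinf_on_qsub[OF y] f(3)) simp_all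
    then show ?thesis using False by (simp add: teq)
  qed
qed

lemma Cinf_on_core_of:
  assumes w: "\<And>t. t \<in> free J \<Longrightarrow> Cinf_on E W (\<lambda>z. w z t)"
  shows "Cinf_on E W (\<lambda>z. lookup (core_of J (w z)) s)"
proof -
  obtain k a i b where s: "s = (k, a, i, b)" by (cases s)
  consider "s \<notin> core_idx" | "s \<in> free J" | "s \<in> core_idx" "s \<notin> free J" by blast
  then show ?thesis
  proof cases
    case 1
    then show ?thesis by (simp add: core_of_def lookup_tabulate finite_core_idx Cinf_on_const)
  next
    case 2
    then have "s \<in> core_idx" using free_subset by blast
    then show ?thesis using 2 w[OF 2] by (simp add: s entry_core_of)
  next
    case 3
    then show ?thesis by (simp add: s entry_core_of Cinf_on_const)
  qed
qed

lemma Cinf_on_ttF_core_of: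
  assumes "valid_sel J" "\<And>t. t \<in> free J \<Longrightarrow> Cinf_on E W (\<lambda>z. w z t)"
  shows "Cinf_on E W (\<lambda>z. ttF (core_of J (w z)))"
  by (intro Cinf_on_ttF Cinf_on_core_of assms core_of_params)

text \<open>Cut out by \<open>Q(S,S)\<close> alone, the region is stable under translations along
  the slice; on the image it singles out the points with representatives that are good for
  \<open>J\<close>.\<close>

definition chart_region :: "selection \<Rightarrow> tt_point set" where
  "chart_region J = {y \<in> tt_ambient d n. \<forall>k\<in>{1..<d}. det (qsub J y k) \<noteq> 0}"

lemma openin_chart_region: "openin (top_of_set (tt_ambient d n)) (chart_region J)"
  unfolding chart_region_def
  by (intro openin_nonzero Cinf_on_det_qsub Cinf_on_linear[OF bounded_linear_ident]) simp

lemma ttF_chart_region: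
  "valid_sel J \<Longrightarrow> U \<in> tt_params d n r \<Longrightarrow> ttF U \<in> chart_region J \<longleftrightarrow> good J U"
  using good_iff_qsub ttF_in by (simp add: chart_region_def)

text \<open>The rank conditions become a union, over all valid selections, of sets on which finitely
  many polynomials do not vanish.\<close>

lemma openin_params: "openin (top_of_set (core_space d n r)) (tt_params d n r)"
proof -
  let ?G = "\<lambda>J. {U \<in> core_space d n r. \<forall>k\<in>{1..<d}. det (amat J U k) \<noteq> 0}"
  have eq: "tt_params d n r = (\<Union>J\<in>Collect valid_sel. ?G J)"
  proof (intro equalityI subsetI)
    fix U assume U: "U \<in> tt_params d n r"
    obtain J where "valid_sel J" "good J U" using params_imp_good[OF U] .
    then show "U \<in> (\<Union>J\<in>Collect valid_sel. ?G J)"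
      using U by (auto simp: good_def tt_params_def)
  next
    fix U assume "U \<in> (\<Union>J\<in>Collect valid_sel. ?G J)"
    then show "U \<in> tt_params d n r" using good_imp_params[of _ U] by (auto simp: good_def)
  qed
  have op: "openin (top_of_set (core_space d n r)) (?G J)" for J
    by (intro openin_nonzero Cinf_on_det[OF amat_carrier] Cinf_on_amat Cinf_on_linear[OF bounded_linear_lookup]) simp_all
  show ?thesis unfolding eq by (rule openin_Union) (use op in auto)
qed

section \<open>The embedded submanifold\<close>

text \<open>Normalising does not change the image point, so inside the region the whole image is
  parametrised by the free entries.\<close>

lemma manifold_chart_region:
  assumes J: "valid_sel J"
  shows "tt_manifold d n r \<inter> chart_region J = range (\<lambda>w. ttF (core_of J w))"
proof (intro equalityI subsetI)
  fix y assume "y \<in> tt_manifold d n r \<inter> chart_region J"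
  then obtain U where U: "U \<in> tt_params d n r" "y = ttF U" "good J U"
    unfolding tt_manifold_eq using ttF_chart_region[OF J] by auto
  then have "y = ttF (core_of J (chart J y))" using ttF_core_of_chart[OF J] by simp
  then show "y \<in> range (\<lambda>w. ttF (core_of J w))" by blast
next
  fix y assume "y \<in> range (\<lambda>w. ttF (core_of J w))"
  then show "y \<in> tt_manifold d n r \<inter> chart_region J"
    unfolding tt_manifold_eq using ttF_chart_region[OF J core_of_params[OF J]] core_of_params[OF J] good_core_of[OF J] by auto
qed

lemma tt_slice_chart:
  assumes J: "valid_sel J"
  shows "\<exists>V \<phi>. diffeomorphism (tt_ambient d n) (chart_region J) (Rn (dim (tt_ambient d n))) V \<phi> \<and>
      \<phi> ` (tt_manifold d n r \<inter> chart_region J) = V \<inter> Rn (card (free J))"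
    and "card (free J) \<le> dim (tt_ambient d n)"
proof -
  have det: "det (qsub J y k) \<noteq> 0" if "y \<in> chart_region J" "k \<in> {1..<d}" for y k
    using that by (simp add: chart_region_def)
  have sm_id: "Cinf_on E W (\<lambda>y :: tt_point. y)" for E W by (rule Cinf_on_linear[OF bounded_linear_ident])
  have F_in: "ttF (core_of J w) \<in> chart_region J" for w
    using ttF_chart_region[OF J core_of_params[OF J]] good_core_of[OF J] by simp
  have sub: "chart_region J \<subseteq> tt_ambient d n" by (auto simp: chart_region_def)
  have dom_cong: "y \<in> chart_region J" if "y \<in> tt_ambient d n" "y' \<in> chart_region J"
    "y - y' \<in> span (svec J ` free J)" for y y'
    using that qsub_cong[OF J _ that(3)] by (simp add: chart_region_def)
  have sm_Fq: "Cinf_on (tt_ambient d n) W (\<lambda>y. ttF (core_of J (\<lambda>t. slc J t y)))" for W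
    by (intro Cinf_on_ttF_core_of J Cinf_on_slc sm_id)
  have svec: "svec J t \<in> tt_ambient d n" if "t \<in> free J" for t by (rule svec_in[OF J that])
  have dual: "slc J t (svec J t') = (if t = t' then 1 else 0)" if "t \<in> free J" "t' \<in> free J" for t t'
    by (rule slc_svec[OF J that])
  have range: "tt_manifold d n r \<inter> chart_region J = range (\<lambda>w. ttF (core_of J w))" by (rule manifold_chart_region[OF J])
  have chF: "chart J (ttF (core_of J w)) t = w t" if "t \<in> free J" for w t by (rule chart_core_of[OF J that])
  have F_cong: "ttF (core_of J w) = ttF (core_of J w')" if "\<And>t. t \<in> free J \<Longrightarrow> w t = w' t" for w w'
    using core_of_cong[OF that] by simp
  have uch: "slc J t y = unchart J (chart J y) y t" if "y \<in> chart_region J" "t \<in> free J" for y t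
    by (rule slc_unchart[OF that(2) det[OF that(1)]])
  have uch_cong: "unchart J w y t = unchart J w' y' t"
    if "t \<in> free J" "\<And>t. t \<in> free J \<Longrightarrow> w t = w' t" "y \<in> tt_ambient d n" "y' \<in> tt_ambient d n"
      "y - y' \<in> span (svec J ` free J)" for w w' y y' t
    by (rule unchart_cong[OF J that(1,2,5)])
  have uniq: "chart J y t = w t"
    if "y \<in> chart_region J" "\<And>t. t \<in> free J \<Longrightarrow> slc J t y = unchart J w y t" "t \<in> free J" for y w t
    by (rule chart_unique[OF that(3) det[OF that(1)] that(2)])
  have sm_ch: "Cinf_on (tt_ambient d n) (chart_region J) (\<lambda>y. chart J y t)" if "t \<in> free J" for t
    by (rule Cinf_on_chart[OF sm_id that det])
  have sm_Fg: "Cinf_on (tt_ambient d n) (chart_region J) (\<lambda>y. ttF (core_of J (chart J y)))"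
    by (rule Cinf_on_ttF_core_of[OF J sm_ch])
  have sm_uch: "Cinf_on (tt_ambient d n)
      {y \<in> tt_ambient d n. y + ttF (core_of J (\<lambda>t. slc J t y)) \<in> chart_region J}
      (\<lambda>y. unchart J (\<lambda>t. slc J t y) (y + ttF (core_of J (\<lambda>t. slc J t y))) t)" if "t \<in> free J" for t
    by (rule Cinf_on_unchart[OF Cinf_on_add[OF sm_id sm_Fq] that Cinf_on_slc[OF sm_id]])
  note facts = frame_ambient subspace_ambient finite_free svec bounded_linear_slc dual openin_chart_region F_in range
    chF F_cong uch uch_cong uniq dom_cong sm_ch sm_Fg sm_Fq sm_uch
  show "\<exists>V \<phi>. diffeomorphism (tt_ambient d n) (chart_region J) (Rn (dim (tt_ambient d n))) V \<phi> \<and>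
      \<phi> ` (tt_manifold d n r \<inter> chart_region J) = V \<inter> Rn (card (free J))"
    by (rule slice_chart(1)[where F = "\<lambda>w. ttF (core_of J w)" and g = "chart J" and p = "unchart J"
          and q = "slc J" and u = "svec J" and T = "free J"]; (fact facts | rule bounded_linear_slc)?)
  show "card (free J) \<le> dim (tt_ambient d n)"
    by (rule slice_chart(2)[where F = "\<lambda>w. ttF (core_of J w)" and g = "chart J" and p = "unchart J"
          and q = "slc J" and u = "svec J" and T = "free J"]; (fact facts | rule bounded_linear_slc)?)
qed

lemma tt_manifold_embedded:
  assumes "tt_params d n r \<noteq> {}" and m: "\<And>J. valid_sel J \<Longrightarrow> card (free J) = m"
  shows "embedded_submanifold (tt_ambient d n) (tt_manifold d n r) m"
  unfolding embedded_submanifold_def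
proof (intro conjI ballI subspace_ambient)
  show "tt_manifold d n r \<subseteq> tt_ambient d n" unfolding tt_manifold_eq using ttF_in by auto
  \<comment> \<open>Nonemptiness provides a valid selection, from which the bound on
    \<open>m\<close> is obtained.\<close>
  obtain U where U: "U \<in> tt_params d n r" using assms(1) by blast
  obtain J where J: "valid_sel J" "good J U" using params_imp_good[OF U] .
  show "m \<le> dim (tt_ambient d n)" using tt_slice_chart(2)[OF J(1)] m[OF J(1)] by simp
next
  fix x assume "x \<in> tt_manifold d n r"
  then obtain U where U: "U \<in> tt_params d n r" "x = ttF U" unfolding tt_manifold_eq by auto
  obtain J where J: "valid_sel J" "good J U" using params_imp_good[OF U(1)] .
  have "x \<in> chart_region J" using ttF_chart_region[OF J(1) U(1)] J(2) U(2) by simp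
  then show "\<exists>U V \<phi>. x \<in> U \<and> diffeomorphism (tt_ambient d n) U (Rn (dim (tt_ambient d n))) V \<phi> \<and>
      \<phi> ` (tt_manifold d n r \<inter> U) = V \<inter> Rn m"
    using tt_slice_chart(1)[OF J(1)] unfolding m[OF J(1)] by (intro exI[of _ "chart_region J"]) simp
qed

section \<open>The quotient manifold\<close>

lemma gauge_entry:
  assumes B: "gauge_mats B" and s: "(k, a, i, b) \<in> core_idx"
  shows "entry (gauge B X) k a i b =
    (\<Sum>c<r k. (\<Sum>e<r (k - 1). minv (B (k - 1)) $$ (a, e) * entry X k e i c) * B k $$ (c, b))"
proof -
  have k: "k \<le> d" "k - 1 \<le> d" and ab: "a < r (k - 1)" "b < r k" using s by (auto simp: core_idx_def)
  note M = gauge_matsD(3)[OF B k(2)] and N = gauge_matsD(1)[OF B k(1)]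
  have "entry (gauge B X) k a i b = (minv (B (k - 1)) * slice r X k i * B k) $$ (a, b)"
    using s by (simp add: gauge_def lookup_tabulate finite_core_idx)
  also have "\<dots> = (\<Sum>c<r k. (minv (B (k - 1)) * slice r X k i) $$ (a, c) * B k $$ (c, b))"
    by (rule mult_index_sum[OF mult_carrier_mat[OF M slice_carrier] N ab])
  also have "\<dots> = (\<Sum>c<r k. (\<Sum>e<r (k - 1). minv (B (k - 1)) $$ (a, e) * entry X k e i c) * B k $$ (c, b))"
  proof (rule sum.cong[OF refl])
    fix c assume "c \<in> {..<r k}"
    then have c: "c < r k" by simp
    show "(minv (B (k - 1)) * slice r X k i) $$ (a, c) * B k $$ (c, b) =
        (\<Sum>e<r (k - 1). minv (B (k - 1)) $$ (a, e) * entry X k e i c) * B k $$ (c, b)"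
      unfolding mult_index_sum[OF M slice_carrier ab(1) c] using c by (simp add: slice_index)
  qed
  finally show ?thesis .
qed

lemma gauge_linear:
  assumes B: "gauge_mats B" shows "gauge B (X + \<tau> *\<^sub>R Y) = gauge B X + \<tau> *\<^sub>R gauge B Y"
proof (rule poly_mapping_eqI)
  fix s :: "nat \<times> nat \<times> nat \<times> nat"
  obtain k a i b where s: "s = (k, a, i, b)" by (cases s)
  show "lookup (gauge B (X + \<tau> *\<^sub>R Y)) s = lookup (gauge B X + \<tau> *\<^sub>R gauge B Y) s"
  proof (cases "s \<in> core_idx")
    case True
    then show ?thesis
      unfolding s lookup_add lookup_scaleR
      by (simp only: gauge_entry[OF B] lookup_add lookup_scaleR)
        (simp add: algebra_simps sum.distrib sum_distrib_left sum_distrib_right)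
  next
    case False
    then show ?thesis by (simp add: gauge_def lookup_tabulate finite_core_idx lookup_add lookup_scaleR)
  qed
qed

text \<open>The normal form of \<open>U\<close> is moved along a line in its free entries, and the
  normalisation of \<open>U\<close> is undone by the fixed gauge \<open>B\<close>. The action of
  \<open>B\<close> is linear, so the result is a straight line through \<open>U\<close>; gauge
  invariance lets its charts be computed on the normal forms \<open>C\<close>.\<close>

lemma chart_directional:
  assumes J: "valid_sel J" and U: "U \<in> tt_params d n r" and g: "good J U"
  shows "\<exists>w\<in>core_space d n r. \<forall>\<tau>. U + \<tau> *\<^sub>R w \<in> tt_params d n r \<and> good J (U + \<tau> *\<^sub>R w) \<and>
    (\<forall>t\<in>free J. chart J (ttF (U + \<tau> *\<^sub>R w)) t = chart J (ttF U) t + \<tau> * v t)"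
proof -
  define A where "A = amat J U"
  define B where "B = (\<lambda>k. minv (A k))"
  have gA: "gauge_mats A" unfolding A_def by (rule gauge_mats_amat[OF g])
  have gB: "gauge_mats B" unfolding B_def by (rule gauge_mats_minv[OF gA])
  define w0 where "w0 = chart J (ttF U)"
  define Y where "Y = tabulate core_idx (\<lambda>t. if t \<in> free J then v t else 0)"
  define C where "C = (\<lambda>\<tau>. core_of J (\<lambda>t. w0 t + \<tau> * v t))"
  have C: "C \<tau> = norm_cores J U + \<tau> *\<^sub>R Y" for \<tau>
  proof -
    have "core_of J (\<lambda>t. w0 t + \<tau> * v t) = core_of J w0 + \<tau> *\<^sub>R Y"
      by (rule poly_mapping_eqI)
        (auto simp: core_of_def Y_def lookup_add lookup_scaleR lookup_tabulate finite_core_idx split: prod.split)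
    then show ?thesis unfolding C_def w0_def core_of_chart[OF J U g] .
  qed
  have UC: "U \<in> core_space d n r" using U by (simp add: tt_params_iff)
  have "gauged B (norm_cores J U) U"
    unfolding B_def A_def by (rule gauged_inverse[OF gauge_mats_amat[OF g] norm_gauged[OF g]])
  from gauged_unique[OF this UC] have "U = gauge B (norm_cores J U)" .
  then have eq: "U + \<tau> *\<^sub>R gauge B Y = gauge B (C \<tau>)" for \<tau>
    unfolding C gauge_linear[OF gB] by simp
  have gd: "gauged B (C \<tau>) (gauge B (C \<tau>))" for \<tau> by (rule gauge_gauged[OF gB])
  have CS: "C \<tau> \<in> tt_params d n r" for \<tau> unfolding C_def by (rule core_of_params[OF J])
  show ?thesis
  proof (intro bexI[of _ "gauge B Y"] allI conjI ballI; (unfold eq)?)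
    show "gauge B Y \<in> core_space d n r" by (rule gauge_in)
    show "gauge B (C \<tau>) \<in> tt_params d n r" for \<tau> by (rule params_gauged[OF gB gd CS gauge_in])
    show "good J (gauge B (C \<tau>))" for \<tau>
      by (rule good_gauged[OF gB gd J]) (simp add: C_def good_core_of[OF J])
    show "chart J (ttF (gauge B (C \<tau>))) t = chart J (ttF U) t + \<tau> * v t" if "t \<in> free J" for \<tau> t
      unfolding ttF_gauged[OF gB gd CS] unfolding C_def chart_core_of[OF J that] by (simp add: w0_def)
  qed
qed

lemma tt_params_quotient:
  assumes m: "\<And>J. valid_sel J \<Longrightarrow> card (free J) = m"
  shows "quotient_manifold (core_space d n r) (tt_params d n r) (tt_equiv d n r) m"
proof -
  let ?S = "tt_params d n r" and ?M = "tt_manifold d n r"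
  \<comment> \<open>Charts must take values in \<open>Rn m\<close>, so the free indices are
    numbered, separately for each selection.\<close>
  have "\<exists>h. bij_betw h {..<m} (free J)" if "valid_sel J" for J
    using ex_bij_betw_nat_finite[OF finite_free[of J]] m[OF that] by (simp add: atLeast0LessThan)
  then obtain h where h: "\<And>J. valid_sel J \<Longrightarrow> bij_betw (h J) {..<m} (free J)" by metis
  define hi where "hi = (\<lambda>J. the_inv_into {..<m} (h J))"
  have hi: "hi J (h J j) = j" if "valid_sel J" "j < m" for J j
    unfolding hi_def using h[OF that(1)] that(2) by (auto simp: bij_betw_def intro: the_inv_into_f_f)
  have hhi: "h J (hi J t) = t" "hi J t < m" if "valid_sel J" "t \<in> free J" for J t
    using h[OF that(1)] that(2) f_the_inv_into_f_bij_betw[OF h[OF that(1)]]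
      bij_betwE[OF bij_betw_the_inv_into[OF h[OF that(1)]]] by (auto simp: hi_def)
  have hf: "h J j \<in> free J" if "valid_sel J" "j < m" for J j using bij_betwE[OF h[OF that(1)]] that(2) by auto
  define g where "g = (\<lambda>J y. tabulate {..<m} (\<lambda>j. chart J y (h J j)))"
  define cf where "cf = (\<lambda>J z t. lookup (z :: nat \<Rightarrow>\<^sub>0 real) (hi J t))"
  define \<sigma> where "\<sigma> = (\<lambda>J z. core_of J (cf J z))"
  define W where "W = (\<lambda>J. ?M \<inter> chart_region J)"
  have WI: "ttF U \<in> W J \<longleftrightarrow> good J U" if "valid_sel J" "U \<in> ?S" for J U
    using ttF_chart_region[OF that] that(2) by (auto simp: W_def tt_manifold_eq)
  have WD: "\<exists>U. U \<in> ?S \<and> good J U \<and> y = ttF U" if "valid_sel J" "y \<in> W J" for J y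
    using that WI[OF that(1)] by (auto simp: W_def tt_manifold_eq)
  have \<sigma>S: "\<sigma> J z \<in> ?S" "good J (\<sigma> J z)" if "valid_sel J" for J z
    unfolding \<sigma>_def by (rule core_of_params[OF that], rule good_core_of[OF that])
  have sm_id: "Cinf_on E V (\<lambda>y. y)" for E V :: "'z::real_normed_vector set" by (rule Cinf_on_linear[OF bounded_linear_ident])
  have det: "det (qsub J y k) \<noteq> 0" if "y \<in> W J" "k \<in> {1..<d}" for y k J
    using that by (simp add: W_def chart_region_def)
  have sm_g: "Cinf_on E V (\<lambda>z. g J (y z))" if "valid_sel J" "Cinf_on E V y" "\<And>z. z \<in> V \<Longrightarrow> y z \<in> W J"
    for J and E V :: "'z::real_normed_vector set" and y
    unfolding g_def using hf[OF that(1)]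
    by (intro Cinf_on_tabulate Cinf_on_chart[OF that(2)] det[OF that(3)]) auto
  have sm_ttF: "Cinf_on E V (\<lambda>U. ttF U)" if "V \<subseteq> ?S" for E V
    using that by (intro Cinf_on_ttF Cinf_on_linear[OF bounded_linear_lookup]) auto
  have sm_\<sigma>: "Cinf_on E V (\<lambda>z. ttF (\<sigma> J z))" if "valid_sel J" for J E V
    unfolding \<sigma>_def cf_def by (intro Cinf_on_ttF_core_of[OF that] Cinf_on_linear[OF bounded_linear_lookup])
  have c\<sigma>: "continuous_on V (\<sigma> J)" for J V
  proof (rule Cinf_on_continuous[where E = UNIV])
    \<comment> \<open>Smoothness of the normal form is known entry by entry; tabulating its entries
      assembles one vector-valued smooth map.\<close>
    have "Cinf_on UNIV V (\<lambda>z. tabulate core_idx (lookup (\<sigma> J z)))"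
      unfolding \<sigma>_def cf_def
      by (intro Cinf_on_tabulate[OF finite_core_idx] Cinf_on_core_of Cinf_on_linear[OF bounded_linear_lookup])
    moreover have "tabulate core_idx (lookup (\<sigma> J z)) = \<sigma> J z" for z
      unfolding \<sigma>_def using core_of_in[unfolded core_space_eq] by (rule tabulate_lookup[OF finite_core_idx])
    ultimately show "Cinf_on UNIV V (\<sigma> J)" by simp
  qed
  have MF: "ttF ` ?S = ?M" by (simp add: tt_manifold_eq)
  have M_sub: "?M \<subseteq> tt_ambient d n" unfolding tt_manifold_eq using ttF_in by auto
  have g\<sigma>: "g J (ttF (\<sigma> J z)) = z" if "valid_sel J" "z \<in> Rn m" for J z
  proof -
    have "g J (ttF (\<sigma> J z)) = tabulate {..<m} (lookup z)"
      unfolding g_def \<sigma>_def using hf[OF that(1)] hi[OF that(1)]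
      by (intro tabulate_cong) (auto simp: chart_core_of[OF that(1)] cf_def)
    then show ?thesis using tabulate_lookup[OF _ that(2)] by simp
  qed
  have "quotient_manifold (core_space d n r) ?S {(x, y). x \<in> ?S \<and> y \<in> ?S \<and> ttF x = ttF y} m"
  proof (rule quotient_manifold_sections[where J = "Collect valid_sel" and W = W and g = g and \<sigma> = \<sigma>]; (unfold MF)?)
    show "real_vector.subspace (core_space d n r)" unfolding core_space_eq by (rule subspace_coord_space)
    show "openin (top_of_set (core_space d n r)) ?S" by (rule openin_params)
    show "second_countable (top_of_set ?M)"
      using second_countable_subtopology[OF second_countable_frame[OF frame_ambient], of ?M] M_sub
      by (simp add: subtopology_subtopology Int_absorb1)
    show "continuous_on ?S ttF" by (rule Cinf_on_continuous[OF sm_ttF]) simp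
    show "?M = (\<Union>J\<in>Collect valid_sel. W J)"
    proof (intro equalityI subsetI)
      fix y assume "y \<in> ?M"
      then obtain U where U: "U \<in> ?S" "y = ttF U" unfolding tt_manifold_eq by auto
      obtain J where "valid_sel J" "good J U" using params_imp_good[OF U(1)] .
      then show "y \<in> (\<Union>J\<in>Collect valid_sel. W J)" using WI U by auto
    qed (auto simp: W_def)
    fix J assume "J \<in> Collect valid_sel"
    then have J: "valid_sel J" by simp
    show "openin (top_of_set ?M) (W J)"
    proof -
      obtain T where T: "open T" "chart_region J = tt_ambient d n \<inter> T"
        using openin_chart_region[of J] unfolding openin_open by auto
      then have "W J = ?M \<inter> T" using M_sub by (auto simp: W_def)
      then show ?thesis using T(1) by auto
    qed
    show "continuous_on (W J) (g J)"
      by (rule Cinf_on_continuous[OF sm_g[OF J sm_id]])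
    show "continuous_on (Rn m) (\<sigma> J)" by (rule c\<sigma>)
    show "Cinf_on (core_space d n r) {x \<in> ?S. ttF x \<in> W J} (\<lambda>x. g J (ttF x))"
      by (rule sm_g[OF J sm_ttF]) auto
    show "g J y \<in> Rn m" for y unfolding g_def by (rule tabulate_in) simp
    show "\<sigma> J t \<in> ?S" "ttF (\<sigma> J t) \<in> W J" for t using \<sigma>S[OF J] WI[OF J] by auto
    show "g J (ttF (\<sigma> J t)) = t" if "t \<in> Rn m" for t by (rule g\<sigma>[OF J that])
    show "ttF (\<sigma> J (g J y)) = y" if y: "y \<in> W J" for y
    proof -
      obtain U where U: "U \<in> ?S" "good J U" "y = ttF U" using WD[OF J y] by auto
      \<comment> \<open>The normal form sees only the free entries, and on these the two numberings
        cancel.\<close>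
      have "\<sigma> J (g J y) = core_of J (chart J y)"
        unfolding \<sigma>_def by (rule core_of_cong) (simp add: cf_def g_def lookup_tabulate hhi[OF J])
      then show ?thesis using ttF_core_of_chart[OF J U(1,2)] U(3) by simp
    qed
    show "\<exists>w\<in>core_space d n r. \<forall>\<tau>. x + \<tau> *\<^sub>R w \<in> ?S \<and> ttF (x + \<tau> *\<^sub>R w) \<in> W J \<and>
        g J (ttF (x + \<tau> *\<^sub>R w)) = g J (ttF x) + \<tau> *\<^sub>R v"
      if x: "x \<in> ?S" "ttF x \<in> W J" and v: "v \<in> Rn m" for x v
    proof -
      have gx: "good J x" using WI[OF J x(1)] x(2) by simp
      obtain w where w0: "w \<in> core_space d n r" and "\<forall>\<tau>. x + \<tau> *\<^sub>R w \<in> ?S \<and> good J (x + \<tau> *\<^sub>R w) \<and>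
          (\<forall>t\<in>free J. chart J (ttF (x + \<tau> *\<^sub>R w)) t = chart J (ttF x) t + \<tau> * cf J v t)"
        using chart_directional[OF J x(1) gx, of "cf J v"] by (elim bexE)
      then have w: "x + \<tau> *\<^sub>R w \<in> ?S" "good J (x + \<tau> *\<^sub>R w)"
        "t \<in> free J \<Longrightarrow> chart J (ttF (x + \<tau> *\<^sub>R w)) t = chart J (ttF x) t + \<tau> * cf J v t" for \<tau> t
        by blast+
      have "g J (ttF (x + \<tau> *\<^sub>R w)) = g J (ttF x) + \<tau> *\<^sub>R v" for \<tau>
        using v hf[OF J] hi[OF J] w(3)
        by (intro poly_mapping_eqI)
          (auto simp: g_def lookup_tabulate lookup_add lookup_scaleR cf_def coord_space_iff)
      then show ?thesis using w(1,2) WI[OF J w(1)] by (intro bexI[OF _ w0]) simp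
    qed
    fix J' assume "J' \<in> Collect valid_sel"
    then have J': "valid_sel J'" by simp
    show "Cinf_on (Rn m) {t \<in> Rn m. ttF (\<sigma> J t) \<in> W J'} (\<lambda>t. g J' (ttF (\<sigma> J t)))"
      by (rule sm_g[OF J' sm_\<sigma>[OF J]]) simp
  qed
  then show ?thesis unfolding tt_equiv_eq .
qed

end

theorem theorem4:
  fixes d :: nat and n r :: "nat \<Rightarrow> nat"
  assumes "2 \<le> d"
    and "\<forall>k\<in>{1..d}. 0 < n k"
    and "\<forall>k\<in>{1..<d}. 0 < r k"
    and "r 0 = 1" and "r d = 1"
    and "tt_params d n r \<noteq> {}"
  shows "\<exists>m. embedded_submanifold (tt_ambient d n) (tt_manifold d n r) m \<and>
             quotient_manifold (core_space d n r) (tt_params d n r) (tt_equiv d n r) m \<and>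
             int m = (\<Sum>k=1..d. int (r (k - 1) * n k * r k)) - (\<Sum>k=1..<d. (int (r k))\<^sup>2)"
proof -
  interpret tt_format d n r using assms by unfold_locales auto
  obtain U where "U \<in> tt_params d n r" using assms(6) by blast
  then obtain J where J: "valid_sel J" and "good J U" by (rule params_imp_good)
  \<comment> \<open>The count of free entries does not mention the selection, so all charts of both
    manifolds have one common dimension.\<close>
  have m: "card (free J') = card (free J)" if "valid_sel J'" for J'
    using card_free[OF that] card_free[OF J] by simp
  show ?thesis
    using tt_manifold_embedded[OF assms(6) m] tt_params_quotient[OF m] card_free[OF J] by (intro exI[of _ "card (free J)"]) simp
qed

end
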